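(* Let $n\ge1$, let $\eta$ be a composition in $\mathbb{Z}_{\ge0}^n$, and let $e_1(z)=z_1+\dots+z_n$. Then $$e_1(z)E_\eta(z;q^{-1},t^{-1})=\sum_{I\in\mathbb{J}_\eta^I}a_{\eta,c_I(\eta)}\,E_{c_I(\eta)}(z;q^{-1},t^{-1}),$$ where $$a_{\eta,c_I(\eta)}:=\frac{-(q-1)\,d'_\eta(q^{-1},t^{-1})\,A_I(\overline\eta)\,\widetilde B_I(\overline\eta)}{q^{\eta_{\min(I)}+1}(t-1)\,d'_{c_I(\eta)}(q^{-1},t^{-1})}.$$
   Context: Polynomials are in $z=(z_1,\dots,z_n)$ over $\mathbb{Q}(q,t)$, with $q,t$ indeterminates. A composition is $\eta=(\eta_1,\dots,\eta_n)\in\mathbb{Z}_{\ge0}^n$; $|\eta|=\sum_i\eta_i$; $z^\eta=z_1^{\eta_1}\cdots z_n^{\eta_n}$. Put $$l'_\eta(i)=\#\{j<i:\eta_j\ge\eta_i\}+\#\{j>i:\eta_j>\eta_i\},\quad \overline\eta_i=q^{\eta_i}t^{-l'_\eta(i)},\quad \overline\eta=(\overline\eta_1,\dots,\overline\eta_n).$$ Empty products equal 1. Nonsymmetric Macdonald polynomials: let $s_i$ exchange $z_i$ and $z_{i+1}$ in a function, $(\tau_1f)(z)=f(qz_1,z_2,\dots,z_n)$, $\omega=s_{n-1}\cdots s_1\tau_1$, $T_i=t+\frac{tz_i-z_{i+1}}{z_i-z_{i+1}}(s_i-1)$, $Y_i=t^{-n+i}T_i\cdots T_{n-1}\,\omega\,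 T_1^{-1}\cdots T_{i-1}^{-1}$ ($1\le i\le n$). $E_\eta(z;q,t)$ is the unique polynomial with $Y_iE_\eta=\overline\eta_iE_\eta$ for all $i$ and of the form $z^\eta+\sum_{\nu\prec\eta}b_{\eta\nu}z^\nu$. Here, for $|\mu|=|\eta|$, $\mu\prec\eta$ iff $\mu^+<\eta^+$, or $\mu^+=\eta^+$ and $\mu<\eta$; $\eta^+$ is the partition obtained by permuting the parts of $\eta$, and $\mu<\eta$ means $\mu\neq\eta$ and $\sum_{i=1}^p(\eta_i-\mu_i)\ge0$ for all $1\le p\le n$. $E_\eta(z;q^{-1},t^{-1})$ is obtained by replacing $q,t$ by $q^{-1},t^{-1}$ in the coefficients. Functions: $\widehat a(x,y)=\frac{(t-1)x}{x-y}$, $\widehat b(x,y)=\frac{x-ty}{x-y}$, and for $I=\{t_1<\dots<t_s\}\ne\emptyset$ (so $\min(I)=t_1$), $$A_I(z)=\widehat a\left(\tfrac{z_{t_s}}q,z_{t_1}\right)\prod_{u=1}^{s-1}\widehat a(z_{t_u},z_{t_{u+1}}),$$ $$\widetilde B_I(z)=\left(qz_{t_1}-t^{-n+1}\right)\prod_{u=1}^{s}\prod_{j=t_{u-1}+1}^{t_u-1}\widehat b(z_{t_u},z_j)\prod_{j=t_s+1}^{n}\widehat b(qz_{t_1},z_j),\quad t_0:=0.$$ Maximal sets: a nonempty $I=\{t_1<\dots<t_s\}\subseteq\{1,\dots,n\}$ is maximal with respect to $\eta$ iff (1) $\eta_j\ne\eta_{t_u}$ for $j=t_{u-1}+1,\dots,t_u-1$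 and $u=1,\dots,s$ (with $t_0:=0$), and (2) $\eta_j\neq\eta_{t_1}+1$ for $j=t_s+1,\dots,n$. $\mathbb{J}^I_\eta$ is the set of all $I$ maximal with respect to $\eta$. The composition $c_I(\eta)$ is defined by $(c_I(\eta))_{t_k}=\eta_{t_{k+1}}$ for $k=1,\dots,s-1$, $(c_I(\eta))_{t_s}=\eta_{t_1}+1$, $(c_I(\eta))_j=\eta_j$ for $j\notin I$. Constants: $d'_\eta(q^{-1},t^{-1})=\prod_{(i,j):\,1\le i\le n,\,1\le j\le\eta_i}\left(1-q^{-a_\eta(i,j)-1}t^{-l_\eta(i,j)}\right)$, $a_\eta(i,j)=\eta_i-j$, $l_\eta(i,j)=\#\{k>i: j\le\eta_k\le\eta_i\}+\#\{k<i: j\le\eta_k+1\le\eta_i\}$. *)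

theory Defs
  imports
    "HOL-Library.Poly_Mapping"
    "HOL-Combinatorics.Transposition"
    "HOL-Computational_Algebra.Polynomial_Factorial"
begin

section \<open>The coefficient field\<close>

text \<open>
  The field of rational functions in two indeterminates over the rationals, as the fraction
  field of polynomials in \<open>t\<close> whose coefficients are polynomials in \<open>q\<close>.
\<close>

type_synonym qtfield = "rat poly poly fract"

definition qq :: qtfield where "qq = to_fract [:[:0, 1:]:]"

definition tt :: qtfield where "tt = to_fract [:0, 1:]"

text \<open>\<open>eval_qt x y p\<close> is the value of \<open>p\<close> at \<open>q = x\<close>, \<open>t = y\<close>.\<close>

definition eval_q :: "qtfield \<Rightarrow> rat poly \<Rightarrow> qtfield" where
  "eval_q x c = poly (map_poly of_rat c) x"

definition eval_qt :: "qtfield \<Rightarrow> qtfield \<Rightarrow> rat poly poly \<Rightarrow> qtfield" where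
  "eval_qt x y p = poly (map_poly (eval_q x) p) y"

lemma map_poly_hom_mult:
  fixes f :: "'a::comm_semiring_1 \<Rightarrow> 'b::comm_semiring_1"
  assumes [simp]: "f 0 = 0" and "\<And>x y. f (x + y) = f x + f y" and m: "\<And>x y. f (x * y) = f x * f y"
  shows "map_poly f (p * r) = map_poly f p * map_poly f r"
proof -
  have s: "f (sum g A) = (\<Sum>i\<in>A. f (g i))" if "finite A" for g :: "nat \<Rightarrow> 'a" and A
    using that by (induction A rule: finite_induct) (simp_all add: assms)
  show ?thesis
    by (rule poly_eqI) (simp add: coeff_map_poly coeff_mult s m)
qed

lemma map_poly_hom_add:
  fixes f :: "'a::comm_semiring_1 \<Rightarrow> 'b::comm_semiring_1"
  assumes [simp]: "f 0 = 0" and "\<And>x y. f (x + y) = f x + f y"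
  shows "map_poly f (p + r) = map_poly f p + map_poly f r"
  by (rule poly_eqI) (simp add: coeff_map_poly assms)

lemma eval_q_0 [simp]: "eval_q x 0 = 0"
  by (simp add: eval_q_def)

lemma eval_q_add: "eval_q x (c + d) = eval_q x c + eval_q x d"
  by (simp add: eval_q_def map_poly_hom_add of_rat_add)

lemma eval_q_mult: "eval_q x (c * d) = eval_q x c * eval_q x d"
  by (simp add: eval_q_def map_poly_hom_mult of_rat_add of_rat_mult)

lemma eval_qt_mult: "eval_qt x y (p * r) = eval_qt x y p * eval_qt x y r"
  by (simp add: eval_qt_def map_poly_hom_mult eval_q_add eval_q_mult)

lemma eval_q_monom: "eval_q x (monom a k) = of_rat a * x ^ k"
  by (simp add: eval_q_def map_poly_monom poly_monom)

lemma of_rat_qtfield: "(of_rat r :: qtfield) = to_fract [:[:r:]:]"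
proof -
  have n: "(of_nat k :: qtfield) = to_fract [:[:of_nat k:]:]" for k
    by (simp add: to_fract_def Fract_of_nat_eq [symmetric] of_nat_poly)
  have i: "(of_int k :: qtfield) = to_fract [:[:of_int k:]:]" for k
    by (cases k rule: int_cases2) (simp_all add: n flip: to_fract_uminus)
  obtain a b where r: "r = Rat.Fract a b" "b > 0"
    by (cases r) auto
  have "to_fract [:[:r:]:] * to_fract [:[:of_int b:]:] = to_fract [:[:of_int a:]:]"
    unfolding to_fract_mult [symmetric] using r by (simp add: Fract_of_int_quotient)
  then have "to_fract [:[:r:]:] * of_int b = of_int a"
    by (simp add: i)
  then show ?thesis
    using r by (simp add: of_rat_rat field_simps)
qed

lemma eval_q_qq: "eval_q qq c = to_fract [:c:]"
proof (induction c)
  case (pCons a c)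
  have "eval_q qq (pCons a c) = of_rat a + qq * eval_q qq c"
    by (simp add: eval_q_def map_poly_pCons)
  also have "\<dots> = to_fract ([:[:a:]:] + [:[:0, 1:]:] * [:c:])"
    unfolding pCons.IH by (simp only: of_rat_qtfield to_fract_add to_fract_mult qq_def)
  finally show ?case
    by simp
qed simp

lemma eval_qt_qq_tt: "eval_qt qq tt p = to_fract p"
proof (induction p)
  case (pCons a p)
  have "eval_qt qq tt (pCons a p) = eval_q qq a + tt * eval_qt qq tt p"
    by (simp add: eval_qt_def map_poly_pCons)
  also have "\<dots> = to_fract ([:a:] + [:0, 1:] * p)"
    unfolding pCons.IH by (simp only: eval_q_qq to_fract_add to_fract_mult tt_def)
  finally show ?case
    by simp
qed (simp add: eval_qt_def)

lemma qq_nonzero [simp]: "qq \<noteq> 0" and tt_nonzero [simp]: "tt \<noteq> 0"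
  by (simp_all add: qq_def tt_def)

lemma eval_q_inverse:
  assumes "degree c \<le> N"
  shows "qq ^ N * eval_q (inverse qq) c = eval_q qq (monom 1 (N - degree c) * reflect_poly c)"
proof -
  have "reflect_poly (map_poly of_rat c) = (map_poly of_rat (reflect_poly c) :: qtfield poly)"
    by (rule poly_eqI) (simp add: coeff_reflect_poly coeff_map_poly degree_map_poly)
  then have "eval_q qq (reflect_poly c) = qq ^ degree c * eval_q (inverse qq) c"
    using poly_reflect_poly_nz [of qq "map_poly of_rat c"] by (simp add: eval_q_def degree_map_poly)
  then show ?thesis
    using assms by (simp add: eval_q_mult eval_q_monom flip: power_add mult.assoc)
qed

lemma eval_qt_inverse_nonzero:
  assumes "p \<noteq> 0"
  shows "eval_qt (inverse qq) (inverse tt) p \<noteq> 0"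
proof -
  define N where "N = Max ((\<lambda>i. degree (coeff p i)) ` {..degree p})"
  define r where "r c = monom 1 (N - degree c) * reflect_poly c" for c :: "rat poly"
  have r0: "r c = 0 \<longleftrightarrow> c = 0" for c
    by (simp add: r_def)
  have inj: "eval_q qq c = 0 \<longleftrightarrow> c = 0" for c
    by (simp add: eval_q_qq)
  have deg: "degree (coeff p i) \<le> N" for i
  proof (cases "i \<le> degree p")
    case True
    then show ?thesis unfolding N_def by (intro Max_ge) auto
  qed (simp add: coeff_eq_0)
  have P: "smult (qq ^ N) (map_poly (eval_q (inverse qq)) p) = map_poly (eval_q qq) (map_poly r p)"
    by (rule poly_eqI) (simp add: coeff_map_poly eval_q_inverse [OF deg] r0 flip: r_def)
  have R: "reflect_poly (map_poly (eval_q qq) s) = map_poly (eval_q qq) (reflect_poly s)" for s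
    by (rule poly_eqI) (simp add: coeff_reflect_poly coeff_map_poly degree_map_poly inj)
  have "tt ^ degree (map_poly r p) * (qq ^ N * eval_qt (inverse qq) (inverse tt) p)
      = tt ^ degree (map_poly r p) * poly (map_poly (eval_q qq) (map_poly r p)) (inverse tt)"
    by (simp add: eval_qt_def flip: P)
  also have "\<dots> = to_fract (reflect_poly (map_poly r p))"
    using poly_reflect_poly_nz [of tt "map_poly (eval_q qq) (map_poly r p)"]
    by (simp add: R degree_map_poly inj flip: eval_qt_def eval_qt_qq_tt)
  also have "\<dots> \<noteq> 0"
    using assms by (simp add: map_poly_eq_0_iff r0)
  finally show ?thesis
    by auto
qed

text \<open>The automorphism replacing \<open>q, t\<close> by their inverses.\<close>

definition invert_qt :: "qtfield \<Rightarrow> qtfield" where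
  "invert_qt x = (THE y. \<exists>a b. b \<noteq> 0 \<and> x = Fract a b \<and>
     y = eval_qt (inverse qq) (inverse tt) a / eval_qt (inverse qq) (inverse tt) b)"

lemma invert_qt_Fract:
  assumes "b \<noteq> 0"
  shows "invert_qt (Fract a b) =
    eval_qt (inverse qq) (inverse tt) a / eval_qt (inverse qq) (inverse tt) b"
  unfolding invert_qt_def
proof (rule the_equality)
  show "\<exists>c d. d \<noteq> 0 \<and> Fract a b = Fract c d \<and>
      eval_qt (inverse qq) (inverse tt) a / eval_qt (inverse qq) (inverse tt) b =
      eval_qt (inverse qq) (inverse tt) c / eval_qt (inverse qq) (inverse tt) d"
    using assms by blast
next
  fix y
  assume "\<exists>c d. d \<noteq> 0 \<and> Fract a b = Fract c d \<and>
    y = eval_qt (inverse qq) (inverse tt) c / eval_qt (inverse qq) (inverse tt) d"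
  then obtain c d where cd: "d \<noteq> 0" "a * d = c * b"
    and y: "y = eval_qt (inverse qq) (inverse tt) c / eval_qt (inverse qq) (inverse tt) d"
    using assms by (auto simp: eq_fract)
  show "y = eval_qt (inverse qq) (inverse tt) a / eval_qt (inverse qq) (inverse tt) b"
    unfolding y using assms cd
    by (simp add: frac_eq_eq eval_qt_inverse_nonzero flip: eval_qt_mult)
qed


section \<open>Polynomials and Cherednik operators\<close>

text \<open>
  Polynomials in countably many variables \<open>z\<^sub>i\<close>; polynomials in \<open>z\<^sub>1, \<dots>, z\<^sub>n\<close> are those in which
  only variables with index in \<open>{1..n}\<close> occur.
\<close>

type_synonym zpoly = "(nat \<Rightarrow>\<^sub>0 nat) \<Rightarrow>\<^sub>0 qtfield"

definition Const :: "qtfield \<Rightarrow> zpoly" where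
  "Const c = Poly_Mapping.single 0 c"

definition zvar :: "nat \<Rightarrow> zpoly" where
  "zvar i = Poly_Mapping.single (Poly_Mapping.single i 1) 1"

text \<open>\<open>subst_z \<sigma> f\<close> is \<open>f\<close> with every variable \<open>z\<^sub>i\<close> replaced by \<open>\<sigma> i\<close>.\<close>

definition subst_z :: "(nat \<Rightarrow> zpoly) \<Rightarrow> zpoly \<Rightarrow> zpoly" where
  "subst_z \<sigma> f = (\<Sum>m\<in>Poly_Mapping.keys f.
     Const (Poly_Mapping.lookup f m) * (\<Prod>i\<in>Poly_Mapping.keys m. \<sigma> i ^ Poly_Mapping.lookup m i))"

definition s_op :: "nat \<Rightarrow> zpoly \<Rightarrow> zpoly" where
  "s_op i = subst_z (\<lambda>j. zvar (transpose i (i + 1) j))"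

definition tau1 :: "zpoly \<Rightarrow> zpoly" where
  "tau1 = subst_z (\<lambda>j. if j = 1 then Const qq * zvar 1 else zvar j)"

text \<open>Composition of a list of operators, the last one being applied first.\<close>

definition compose_ops :: "(zpoly \<Rightarrow> zpoly) list \<Rightarrow> zpoly \<Rightarrow> zpoly" where
  "compose_ops Fs = foldr (\<circ>) Fs id"

definition omega :: "nat \<Rightarrow> zpoly \<Rightarrow> zpoly" where
  "omega n = compose_ops (map s_op (rev [1..<n])) \<circ> tau1"

text \<open>
  The polynomial \<open>(s\<^sub>i f - f) / (z\<^sub>i - z\<^sub>i\<^sub>+\<^sub>1)\<close>: the division is exact, and the quotient is unique
  because \<^typ>\<open>zpoly\<close> is an integral domain.
\<close>

definition div_diff :: "nat \<Rightarrow> zpoly \<Rightarrow> zpoly" where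
  "div_diff i f = (THE g. (zvar i - zvar (i + 1)) * g = s_op i f - f)"

definition T_op :: "nat \<Rightarrow> zpoly \<Rightarrow> zpoly" where
  "T_op i f = Const tt * f + (Const tt * zvar i - zvar (i + 1)) * div_diff i f"

definition Y_op :: "nat \<Rightarrow> nat \<Rightarrow> zpoly \<Rightarrow> zpoly" where
  "Y_op n i f = Const (tt powi (int i - int n)) *
     (compose_ops (map T_op [i..<n]) \<circ> omega n \<circ> compose_ops (map (\<lambda>j. inv (T_op j)) [1..<i])) f"


section \<open>Compositions and nonsymmetric Macdonald polynomials\<close>

text \<open>A composition \<open>(\<eta>\<^sub>1, \<dots>, \<eta>\<^sub>n)\<close> is a function vanishing outside \<open>{1..n}\<close>.\<close>

definition composition :: "nat \<Rightarrow> (nat \<Rightarrow> nat) \<Rightarrow> bool" where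
  "composition n \<eta> \<longleftrightarrow> (\<forall>i. i \<notin> {1..n} \<longrightarrow> \<eta> i = 0)"

definition weight :: "nat \<Rightarrow> (nat \<Rightarrow> nat) \<Rightarrow> nat" where
  "weight n \<eta> = (\<Sum>i=1..n. \<eta> i)"

definition zpower :: "nat \<Rightarrow> (nat \<Rightarrow> nat) \<Rightarrow> zpoly" where
  "zpower n \<eta> = (\<Prod>i=1..n. zvar i ^ \<eta> i)"

definition leg' :: "nat \<Rightarrow> (nat \<Rightarrow> nat) \<Rightarrow> nat \<Rightarrow> nat" where
  "leg' n \<eta> i = card {j \<in> {1..n}. j < i \<and> \<eta> j \<ge> \<eta> i} + card {j \<in> {1..n}. j > i \<and> \<eta> j > \<eta> i}"

definition eigenval :: "nat \<Rightarrow> (nat \<Rightarrow> nat) \<Rightarrow> nat \<Rightarrow> qtfield" where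
  "eigenval n \<eta> i = qq ^ \<eta> i * tt powi (- int (leg' n \<eta> i))"

definition partition_of :: "nat \<Rightarrow> (nat \<Rightarrow> nat) \<Rightarrow> nat \<Rightarrow> nat" where
  "partition_of n \<eta> i = (if i \<in> {1..n} then rev (sort (map \<eta> [1..<n + 1])) ! (i - 1) else 0)"

definition dominated :: "nat \<Rightarrow> (nat \<Rightarrow> nat) \<Rightarrow> (nat \<Rightarrow> nat) \<Rightarrow> bool" where
  "dominated n \<mu> \<eta> \<longleftrightarrow> \<mu> \<noteq> \<eta> \<and> (\<forall>p\<in>{1..n}. (\<Sum>i=1..p. int (\<eta> i) - int (\<mu> i)) \<ge> 0)"

definition comp_prec :: "nat \<Rightarrow> (nat \<Rightarrow> nat) \<Rightarrow> (nat \<Rightarrow> nat) \<Rightarrow> bool" where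
  "comp_prec n \<mu> \<eta> \<longleftrightarrow> weight n \<mu> = weight n \<eta> \<and>
     (dominated n (partition_of n \<mu>) (partition_of n \<eta>) \<or>
      partition_of n \<mu> = partition_of n \<eta> \<and> dominated n \<mu> \<eta>)"

definition macdonald_E :: "nat \<Rightarrow> (nat \<Rightarrow> nat) \<Rightarrow> zpoly" where
  "macdonald_E n \<eta> = (THE f.
     (\<forall>i\<in>{1..n}. Y_op n i f = Const (eigenval n \<eta> i) * f) \<and>
     (\<exists>b. f = zpower n \<eta> +
        (\<Sum>\<nu> | composition n \<nu> \<and> comp_prec n \<nu> \<eta>. Const (b \<nu>) * zpower n \<nu>)))"

text \<open>\<open>E\<^sub>\<eta>(z; q\<^sup>-\<^sup>1, t\<^sup>-\<^sup>1)\<close>\<close>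

definition macdonald_E_inv :: "nat \<Rightarrow> (nat \<Rightarrow> nat) \<Rightarrow> zpoly" where
  "macdonald_E_inv n \<eta> = Poly_Mapping.map invert_qt (macdonald_E n \<eta>)"

definition e1 :: "nat \<Rightarrow> zpoly" where
  "e1 n = (\<Sum>i=1..n. zvar i)"


section \<open>Maximal sets and the coefficients\<close>

text \<open>\<open>I = {elem I 1 < \<dots> < elem I (card I)}\<close>, with the convention \<open>elem I 0 = 0\<close>.\<close>

definition elem :: "nat set \<Rightarrow> nat \<Rightarrow> nat" where
  "elem I u = (if u = 0 then 0 else sorted_list_of_set I ! (u - 1))"

definition maximal_sets :: "nat \<Rightarrow> (nat \<Rightarrow> nat) \<Rightarrow> nat set set" where
  "maximal_sets n \<eta> = {I. I \<noteq> {} \<and> I \<subseteq> {1..n} \<and>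
     (\<forall>u\<in>{1..card I}. \<forall>j\<in>{elem I (u - 1)<..<elem I u}. \<eta> j \<noteq> \<eta> (elem I u)) \<and>
     (\<forall>j\<in>{elem I (card I)<..n}. \<eta> j \<noteq> \<eta> (elem I 1) + 1)}"

definition shift_comp :: "nat set \<Rightarrow> (nat \<Rightarrow> nat) \<Rightarrow> nat \<Rightarrow> nat" where
  "shift_comp I \<eta> j =
     (if j \<in> I then
        let k = (THE k. k \<in> {1..card I} \<and> elem I k = j)
        in if k < card I then \<eta> (elem I (k + 1)) else \<eta> (elem I 1) + 1
      else \<eta> j)"

definition ahat :: "qtfield \<Rightarrow> qtfield \<Rightarrow> qtfield" where
  "ahat x y = (tt - 1) * x / (x - y)"

definition bhat :: "qtfield \<Rightarrow> qtfield \<Rightarrow> qtfield" where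
  "bhat x y = (x - tt * y) / (x - y)"

definition A_fun :: "nat set \<Rightarrow> (nat \<Rightarrow> qtfield) \<Rightarrow> qtfield" where
  "A_fun I x = ahat (x (elem I (card I)) / qq) (x (elem I 1)) *
     (\<Prod>u=1..card I - 1. ahat (x (elem I u)) (x (elem I (u + 1))))"

definition B_fun :: "nat \<Rightarrow> nat set \<Rightarrow> (nat \<Rightarrow> qtfield) \<Rightarrow> qtfield" where
  "B_fun n I x = (qq * x (elem I 1) - tt powi (1 - int n)) *
     (\<Prod>u=1..card I. \<Prod>j\<in>{elem I (u - 1)<..<elem I u}. bhat (x (elem I u)) (x j)) *
     (\<Prod>j\<in>{elem I (card I)<..n}. bhat (qq * x (elem I 1)) (x j))"

definition leg :: "nat \<Rightarrow> (nat \<Rightarrow> nat) \<Rightarrow> nat \<Rightarrow> nat \<Rightarrow> nat" where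
  "leg n \<eta> i j = card {k \<in> {1..n}. k > i \<and> j \<le> \<eta> k \<and> \<eta> k \<le> \<eta> i} +
     card {k \<in> {1..n}. k < i \<and> j \<le> \<eta> k + 1 \<and> \<eta> k + 1 \<le> \<eta> i}"

text \<open>\<open>d'\<^sub>\<eta>(x, y)\<close>; the truncated subtraction is the arm length, as \<open>j \<le> \<eta> i\<close>.\<close>

definition d' :: "nat \<Rightarrow> (nat \<Rightarrow> nat) \<Rightarrow> qtfield \<Rightarrow> qtfield \<Rightarrow> qtfield" where
  "d' n \<eta> x y = (\<Prod>i=1..n. \<Prod>j=1..\<eta> i. 1 - x ^ (\<eta> i - j + 1) * y ^ leg n \<eta> i j)"

definition pieri_coeff :: "nat \<Rightarrow> (nat \<Rightarrow> nat) \<Rightarrow> nat set \<Rightarrow> qtfield" where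
  "pieri_coeff n \<eta> I =
     - (qq - 1) * d' n \<eta> (inverse qq) (inverse tt) * A_fun I (eigenval n \<eta>) * B_fun n I (eigenval n \<eta>) /
     (qq ^ (\<eta> (Min I) + 1) * (tt - 1) * d' n (shift_comp I \<eta>) (inverse qq) (inverse tt))"

end

theory Submission
  imports Defs
begin

text \<open>
  The Pieri formula is read off from the interpolation polynomials of Knop and Sahi. The polynomial
  \<open>E_star n \<eta>\<close> has degree \<open>|\<eta>|\<close>, vanishes at the spectral points of all \<open>\<mu> \<noteq> \<eta>\<close> with \<open>|\<mu>| \<le> |\<eta>|\<close>, and
  its top component \<open>E_top n \<eta>\<close> is \<open>E\<^sub>\<eta>(z; 1/q, 1/t)\<close>. Hence \<open>e\<^sub>1 - e\<^sub>1(spectral point of \<eta>)\<close> times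
  \<open>E_star n \<eta>\<close> is a combination of the \<open>E_star n \<nu>\<close> with \<open>|\<nu>| = |\<eta>| + 1\<close>, whose coefficients are found by
  evaluation at the spectral points of these \<open>\<nu>\<close>. To evaluate \<open>E_star n \<eta>\<close> there, use the eigenvalue
  equation \<open>H\<^sub>m \<dots> H\<^sub>n\<^sub>-\<^sub>1 \<Phi> H\<^sub>1 \<dots> H\<^sub>m\<^sub>-\<^sub>1 E_star n \<eta> = (z\<^sub>m / y\<^sub>m - 1) E_star n \<eta>\<close>, where \<open>y\<close> is the spectral point
  of \<open>\<eta>\<close>. Expanding the Hecke operators \<open>H\<^sub>i\<close> turns the left-hand side into a sum over paths of
  spectral points. All paths end in zeros of \<open>E_star n \<eta>\<close>, except for at most one that ends in \<open>y\<close>; for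
  \<open>m = min I\<close> it exists at \<open>\<nu> = c\<^sub>I(\<eta>)\<close>, \<open>I\<close> maximal, and its weight is the product \<open>A\<^sub>I B\<^sub>I\<close>.
\<close>

text \<open>A path never leaves the spectral points: unequal neighbouring entries swap together with
  their coordinates, while the coordinates of equal neighbours differ by the factor t, where the
  swap coefficient \<open>bhat\<close> is zero. At most one path survives, because each factor puts
  one place out of reach of the remaining factors. That place must already carry a prescribed
  coordinate, and since coordinates are distinct, at most one of the two branches, staying (weight
  \<open>ahat\<close>) or swapping (weight \<open>bhat\<close>), achieves this. The set I consists
  of m and the places settled by staying; maximality says that all swaps are between unequal
  entries. Origin of the constants: dividing by \<open>z_m / y_m - 1\<close> supplies the factor
  \<open>ahat\<close> at m = min I, which belongs to no step, and leaves -1/(t - 1). The coordinate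
  sums of c_I(\<eta>) and \<eta> differ by (q - 1) \<open>y_m\<close>. The quotient of the values of
  the interpolation polynomials at their own points gives the constants d' and the power of q, and
  cancels \<open>y_m\<close>.\<close>

abbreviation supp :: "('a \<Rightarrow>\<^sub>0 'b::zero) \<Rightarrow> 'a set" where "supp \<equiv> Poly_Mapping.keys"
abbreviation coef :: "('a \<Rightarrow>\<^sub>0 'b::zero) \<Rightarrow> 'a \<Rightarrow> 'b" where "coef \<equiv> Poly_Mapping.lookup"
abbreviation monom_z :: "(nat \<Rightarrow>\<^sub>0 nat) \<Rightarrow> qtfield \<Rightarrow> zpoly" where "monom_z \<equiv> Poly_Mapping.single"

lemma poly_mapping_sum_singles: "f = (\<Sum>m\<in>supp f. Poly_Mapping.single m (coef f m))"
proof (rule poly_mapping_eqI)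
  fix k
  have "coef (\<Sum>m\<in>supp f. Poly_Mapping.single m (coef f m)) k
      = (\<Sum>m\<in>supp f. if m = k then coef f k else 0)"
    by (auto simp: lookup_sum lookup_single when_def intro!: sum.cong)
  also have "\<dots> = coef f k"
    by (simp add: in_keys_iff)
  finally show "coef f k = coef (\<Sum>m\<in>supp f. Poly_Mapping.single m (coef f m)) k" ..
qed

lemma zpoly_add_induct:
  assumes "\<And>m c. P (monom_z m c)" and "\<And>f g. P f \<Longrightarrow> P g \<Longrightarrow> P (f + g)"
  shows "P f"
proof -
  have "P (\<Sum>m\<in>A. monom_z m (coef f m))" if "finite A" for A
    using that
  proof (induction A rule: finite_induct)
    case empty
    show ?case using assms(1)[of 0 0] by simp
  next
    case (insert x F)
    then show ?case using assms by simp
  qed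
  then show ?thesis
    by (subst poly_mapping_sum_singles) simp
qed

section \<open>Evaluation of polynomials in commutative rings\<close>

definition mon :: "(nat \<Rightarrow> 'b::comm_monoid_mult) \<Rightarrow> (nat \<Rightarrow>\<^sub>0 nat) \<Rightarrow> 'b" where
  "mon x m = (\<Prod>i\<in>supp m. x i ^ coef m i)"

lemma mon_superset:
  assumes "finite A" "supp m \<subseteq> A"
  shows "mon x m = (\<Prod>i\<in>A. x i ^ coef m i)"
  unfolding mon_def using assms
  by (intro prod.mono_neutral_left) (auto simp: in_keys_iff)

lemma mon_add: "mon x (m + k) = mon x m * mon x k"
proof -
  let ?A = "supp m \<union> supp k"
  have "mon x (m + k) = (\<Prod>i\<in>?A. x i ^ coef (m + k) i)"
    using keys_add[of m k] by (intro mon_superset) auto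
  also have "\<dots> = (\<Prod>i\<in>?A. x i ^ coef m i) * (\<Prod>i\<in>?A. x i ^ coef k i)"
    by (simp add: lookup_add power_add prod.distrib)
  also have "\<dots> = mon x m * mon x k"
    by (simp add: mon_superset[of ?A])
  finally show ?thesis .
qed

lemma mon_0 [simp]: "mon x 0 = 1"
  by (simp add: mon_def)

lemma mon_cong: "(\<And>i. i \<in> supp m \<Longrightarrow> x i = y i) \<Longrightarrow> mon x m = mon y m"
  unfolding mon_def by (rule prod.cong) auto

lemma mon_single [simp]: "mon x (Poly_Mapping.single i k) = x i ^ k"
  by (cases "k = 0") (simp_all add: mon_def)

text \<open>Three coefficient maps are used: \<open>Const\<close>, which makes substitution of
  polynomials an evaluation; the identity of the field, for values at spectral points; and
  \<open>Const\<close> after \<open>invert_qt\<close>, which inverts q and t while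
  substituting.\<close>

locale coeff_hom =
  fixes h :: "qtfield \<Rightarrow> 'b::comm_ring_1"
  assumes h_add: "h (a + b) = h a + h b" and h_mult: "h (a * b) = h a * h b" and h_1: "h 1 = 1"
begin

lemma h_0: "h 0 = 0"
  using h_add[of 0 0] by simp

definition ev :: "(nat \<Rightarrow> 'b) \<Rightarrow> zpoly \<Rightarrow> 'b" where
  "ev x f = (\<Sum>m\<in>supp f. h (coef f m) * mon x m)"

lemma ev_superset:
  assumes "finite A" "supp f \<subseteq> A"
  shows "ev x f = (\<Sum>m\<in>A. h (coef f m) * mon x m)"
  unfolding ev_def using assms
  by (intro sum.mono_neutral_left) (auto simp: in_keys_iff h_0)

lemma ev_single: "ev x (monom_z m c) = h c * mon x m"
  by (cases "c = 0") (simp_all add: ev_def h_0)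

lemma ev_0 [simp]: "ev x 0 = 0"
  by (simp add: ev_def)

lemma ev_add: "ev x (f + g) = ev x f + ev x g"
proof -
  let ?A = "supp f \<union> supp g"
  have "ev x (f + g) = (\<Sum>m\<in>?A. h (coef (f + g) m) * mon x m)"
    using keys_add[of f g] by (intro ev_superset) auto
  also have "\<dots> = ev x f + ev x g"
    by (simp add: lookup_add h_add distrib_right sum.distrib ev_superset[of ?A])
  finally show ?thesis .
qed

lemma ev_mult: "ev x (f * g) = ev x f * ev x g"
proof (induction f rule: zpoly_add_induct)
  case (1 m c)
  show ?case
    by (induction g rule: zpoly_add_induct)
      (simp_all add: ev_single mult_single h_mult mon_add distrib_left ev_add mult.assoc mult.left_commute)
next
  case (2 f g')
  then show ?case by (simp add: distrib_right ev_add)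
qed

lemma ev_Const [simp]: "ev x (Const c) = h c"
  by (simp add: Const_def ev_single)

lemma ev_zvar [simp]: "ev x (zvar i) = x i"
  by (simp add: zvar_def ev_single h_1)

lemma ev_1 [simp]: "ev x 1 = 1"
  using ev_single[of x 0 1] by (simp add: h_1)

lemma ev_uminus: "ev x (- f) = - ev x f"
  using ev_add[of x f "- f"] by (simp add: eq_neg_iff_add_eq_0 add.commute)

lemma ev_diff: "ev x (f - g) = ev x f - ev x g"
  using ev_add[of x f "- g"] by (simp add: ev_uminus)

lemma ev_sum: "ev x (sum f A) = (\<Sum>a\<in>A. ev x (f a))"
  by (induction A rule: infinite_finite_induct) (simp_all add: ev_add)

lemma ev_power: "ev x (f ^ k) = ev x f ^ k"
  by (induction k) (simp_all add: ev_mult)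

lemma ev_cong:
  assumes "\<And>m i. m \<in> supp f \<Longrightarrow> i \<in> supp m \<Longrightarrow> x i = y i"
  shows "ev x f = ev y f"
  unfolding ev_def using assms mon_cong[of _ x y] by (intro sum.cong) auto

end

lemma Const_0 [simp]: "Const 0 = 0" and Const_1 [simp]: "Const 1 = 1"
  and Const_add: "Const (a + b) = Const a + Const b"
  and Const_mult: "Const (a * b) = Const a * Const b"
  by (simp_all add: Const_def single_add mult_single)

lemma Const_power: "Const (a ^ k) = Const a ^ k"
  by (induction k) (simp_all add: Const_mult)

lemma Const_eq_iff [simp]: "Const a = Const b \<longleftrightarrow> a = b"
  by (metis Const_def lookup_single_eq)

lemma Const_diff: "Const (a - b) = Const a - Const b"
  by (simp add: Const_def single_diff)

lemma coef_Const_mult: "coef (Const c * f) m = c * coef f m"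
  by (induction f rule: zpoly_add_induct)
    (simp_all add: Const_def mult_single lookup_single when_def lookup_add distrib_left)

lemma monom_z_eq: "monom_z m c = Const c * mon zvar m"
proof -
  have "mon zvar m = monom_z m 1"
  proof -
    have "(\<Prod>i\<in>A. zvar i ^ coef m i) = monom_z (\<Sum>i\<in>A. Poly_Mapping.single i (coef m i)) 1"
      if "finite A" for A
    proof -
      have "zvar i ^ k = monom_z (Poly_Mapping.single i k) 1" for i k
        by (induction k) (simp_all add: zvar_def mult_single flip: single_add)
      with that show ?thesis
        by (induction A rule: finite_induct) (simp_all add: mult_single)
    qed
    then show ?thesis
      unfolding mon_def by (simp add: poly_mapping_sum_singles[of m, symmetric])
  qed
  then show ?thesis by (simp add: Const_def mult_single)
qed

lemma zpoly_gen_induct: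
  assumes "\<And>c. P (Const c)" and "\<And>i. P (zvar i)"
    and "\<And>f g. P f \<Longrightarrow> P g \<Longrightarrow> P (f + g)" and "\<And>f g. P f \<Longrightarrow> P g \<Longrightarrow> P (f * g)"
  shows "P f"
proof (induction f rule: zpoly_add_induct)
  case (1 m c)
  have pw: "P (zvar i ^ k)" for i k
    using assms(1)[of 1] assms(2,4) by (induction k) auto
  have "P (\<Prod>i\<in>A. zvar i ^ coef m i)" if "finite A" for A
    using that assms(1)[of 1] assms(4) pw by (induction A rule: finite_induct) auto
  then show ?case
    unfolding monom_z_eq mon_def using assms(1,4) by simp
qed (rule assms)

global_interpretation C: coeff_hom Const
  by unfold_locales (simp_all add: Const_add Const_mult)

global_interpretation K: coeff_hom "\<lambda>c. c :: qtfield"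
  by unfold_locales simp_all

lemma subst_z_eq: "subst_z = C.ev"
  by (intro ext) (simp add: subst_z_def C.ev_def mon_def)

lemma (in coeff_hom) ev_subst: "ev x (subst_z \<sigma> f) = ev (\<lambda>i. ev x (\<sigma> i)) f"
  unfolding subst_z_eq
  by (induction f rule: zpoly_gen_induct)
    (simp_all add: ev_add ev_mult C.ev_add C.ev_mult)

lemma subst_id: "subst_z zvar f = f"
  unfolding subst_z_eq
  by (induction f rule: zpoly_gen_induct) (simp_all add: C.ev_add C.ev_mult)

lemma (in coeff_hom) ev_s_op: "ev x (s_op i f) = ev (x \<circ> transpose i (i + 1)) f"
  by (simp add: s_op_def ev_subst comp_def)

lemma zvar_eq_iff [simp]: "zvar i = zvar j \<longleftrightarrow> i = j"
proof
  assume *: "zvar i = zvar j"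
  have keys: "Poly_Mapping.keys (zvar k) = {Poly_Mapping.single k 1}" for k
    unfolding zvar_def by (rule trans[OF keys_single]) (simp only: one_neq_zero if_False)
  have "Poly_Mapping.single i (1::nat) = Poly_Mapping.single j 1"
    using arg_cong[OF *, of Poly_Mapping.keys] unfolding keys by blast
  then have "Poly_Mapping.keys (Poly_Mapping.single i (1::nat)) = Poly_Mapping.keys (Poly_Mapping.single j (1::nat))"
    by (rule arg_cong)
  then show "i = j" unfolding keys_single by simp
qed (rule arg_cong)

lemma zvar_neq_0 [simp]: "zvar i \<noteq> 0"
  unfolding zvar_def by (metis keys_single keys_zero empty_not_insert one_neq_zero)

section \<open>Divided differences\<close>

lemma div_diff_exists: "\<exists>g. (zvar i - zvar (Suc i)) * g = s_op i f - f"
proof (induction f rule: zpoly_gen_induct)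
  case (1 c)
  show ?case by (rule exI[of _ 0]) (simp add: s_op_def subst_z_eq)
next
  case (2 j)
  show ?case
    by (rule exI[of _ "if j = i then - 1 else if j = i + 1 then 1 else 0"])
      (simp add: s_op_def subst_z_eq transpose_def)
next
  case (3 f g)
  then obtain a b where "(zvar i - zvar (Suc i)) * a = s_op i f - f"
    "(zvar i - zvar (Suc i)) * b = s_op i g - g" by blast
  then show ?case
    by (intro exI[of _ "a + b"]) (simp add: s_op_def subst_z_eq C.ev_add distrib_left)
next
  case (4 f g)
  then obtain a b where ab: "(zvar i - zvar (Suc i)) * a = s_op i f - f"
    "(zvar i - zvar (Suc i)) * b = s_op i g - g" by blast
  \<comment> \<open>Twisted Leibniz rule: s(fg) - fg = (s f - f) s g + f (s g - g).\<close>
  have "(zvar i - zvar (Suc i)) * (a * s_op i g + f * b)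
      = ((zvar i - zvar (Suc i)) * a) * s_op i g + f * ((zvar i - zvar (Suc i)) * b)"
    by (simp add: algebra_simps)
  also have "\<dots> = s_op i (f * g) - f * g"
    unfolding ab by (simp add: s_op_def subst_z_eq C.ev_mult algebra_simps)
  finally show ?case by blast
qed

text \<open>Existence, together with cancellation in an integral domain, justifies the description
  in \<open>div_diff\<close>. From here on the operator is handled through these two rules.\<close>

lemma div_diff_mult: "(zvar i - zvar (Suc i)) * div_diff i f = s_op i f - f"
  and div_diff_unique: "(zvar i - zvar (Suc i)) * g = s_op i f - f \<Longrightarrow> div_diff i f = g"
proof -
  have u: "g = g'" if "(zvar i - zvar (Suc i)) * g = s_op i f - f"
    "(zvar i - zvar (Suc i)) * g' = s_op i f - f" for g g'
    using mult_left_cancel[of "zvar i - zvar (Suc i)" g g'] that by simp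
  then have "\<exists>!g. (zvar i - zvar (Suc i)) * g = s_op i f - f"
    using div_diff_exists by metis
  then show *: "(zvar i - zvar (Suc i)) * div_diff i f = s_op i f - f"
    unfolding div_diff_def Suc_eq_plus1 by (rule theI')
  show "(zvar i - zvar (Suc i)) * g = s_op i f - f \<Longrightarrow> div_diff i f = g"
    using u * by blast
qed

lemma s_op_simps: "s_op i (f + g) = s_op i f + s_op i g"
  "s_op i (f * g) = s_op i f * s_op i g" "s_op i (Const c) = Const c"
  "s_op i (f - g) = s_op i f - s_op i g"
  "s_op i (zvar j) = zvar (transpose i (Suc i) j)"
  by (simp_all add: s_op_def subst_z_eq C.ev_add C.ev_mult C.ev_diff)

lemma s_op_s_op [simp]: "s_op i (s_op i f) = f"
proof -
  have "s_op i (s_op i f) = subst_z zvar f"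
    by (simp add: s_op_def[of i] subst_z_eq C.ev_subst[unfolded subst_z_eq])
  then show ?thesis by (simp add: subst_id)
qed

lemma div_diff_add: "div_diff i (f + g) = div_diff i f + div_diff i g"
  by (rule div_diff_unique) (simp add: distrib_left div_diff_mult s_op_simps)

lemma div_diff_Const_mult: "div_diff i (Const c * f) = Const c * div_diff i f"
  by (rule div_diff_unique)
    (simp add: mult.left_commute[of _ "Const c"] div_diff_mult s_op_simps right_diff_distrib )

section \<open>Hecke operators and their action on monomials\<close>

text \<open>
  \<open>hecke i\<close> acts as \<open>ahat(z\<^sub>i, z\<^sub>i\<^sub>+\<^sub>1) + bhat(z\<^sub>i, z\<^sub>i\<^sub>+\<^sub>1) s\<^sub>i\<close>. It is the inverse of \<open>T\<^sub>i\<close>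
  with \<open>t\<close> replaced by its inverse; in the same way \<open>cyc\<close> comes from \<open>omega\<close>.
\<close>

definition hecke :: "nat \<Rightarrow> zpoly \<Rightarrow> zpoly" where
  "hecke i f = Const tt * f + (zvar i - Const tt * zvar (Suc i)) * div_diff i f"

definition cyc :: "nat \<Rightarrow> zpoly \<Rightarrow> zpoly" where
  "cyc n = subst_z (\<lambda>j. if j = 1 then Const (inverse qq) * zvar n
     else if j \<in> {2..n} then zvar (j - 1) else zvar j)"

lemma hecke_mult: "(zvar i - zvar (Suc i)) * hecke i f
    = Const (tt - 1) * zvar i * f + (zvar i - Const tt * zvar (Suc i)) * s_op i f"
proof -
  have "(zvar i - zvar (Suc i)) * hecke i f = Const tt * (zvar i - zvar (Suc i)) * f
    + (zvar i - Const tt * zvar (Suc i)) * ((zvar i - zvar (Suc i)) * div_diff i f)"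
    unfolding hecke_def by (simp add: algebra_simps)
  then show ?thesis
    unfolding div_diff_mult by (simp add: Const_diff algebra_simps)
qed

lemma hecke_add: "hecke i (f + g) = hecke i f + hecke i g"
  by (simp add: hecke_def div_diff_add algebra_simps)

lemma hecke_Const_mult: "hecke i (Const c * f) = Const c * hecke i f"
  unfolding hecke_def div_diff_Const_mult by (simp add: algebra_simps)

lemma hecke_0 [simp]: "hecke i 0 = 0"
  using hecke_Const_mult[of i 0 0] by simp

lemma hecke_diff: "hecke i (f - g) = hecke i f - hecke i g"
  using hecke_add[of i "f - g" g] by (simp add: algebra_simps)

lemma hecke_sum: "hecke i (sum f A) = (\<Sum>a\<in>A. hecke i (f a))"
  by (induction A rule: infinite_finite_induct) (simp_all add: hecke_add)

lemma cyc_add: "cyc n (f + g) = cyc n f + cyc n g" and cyc_mult: "cyc n (f * g) = cyc n f * cyc n g"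
  and cyc_Const [simp]: "cyc n (Const c) = Const c" and cyc_diff: "cyc n (f - g) = cyc n f - cyc n g"
  and cyc_sum: "cyc n (sum F A) = (\<Sum>a\<in>A. cyc n (F a))" and cyc_0 [simp]: "cyc n 0 = 0"
  by (simp_all add: cyc_def subst_z_eq C.ev_add C.ev_mult C.ev_diff C.ev_sum)

context coeff_hom
begin

text \<open>With the denominator cleared, the rule makes sense in every commutative ring. It serves
  at spectral points and, in \<open>ev_chain_zero\<close>, at polynomial points with a zero
  coordinate.\<close>

lemma ev_hecke: "(x i - x (Suc i)) * ev x (hecke i f)
    = (h tt - 1) * x i * ev x f + (x i - h tt * x (Suc i)) * ev (x \<circ> transpose i (Suc i)) f"
proof -
  have "ev x ((zvar i - zvar (Suc i)) * hecke i f) =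
    ev x (Const (tt - 1) * zvar i * f + (zvar i - Const tt * zvar (Suc i)) * s_op i f)"
    unfolding hecke_mult ..
  moreover have "h (tt - 1) = h tt - 1"
    using h_add[of "tt - 1" 1] by (simp add: algebra_simps h_1)
  ultimately show ?thesis
    by (simp add: ev_mult ev_diff ev_add ev_s_op)
qed

lemma ev_cyc: "ev x (cyc n f) = ev (\<lambda>j. if j = 1 then h (inverse qq) * x n
     else if j \<in> {2..n} then x (j - 1) else x j) f"
  by (simp add: cyc_def ev_subst ev_mult if_distrib[of "ev x"] cong: if_cong)

end

section \<open>Degrees and supports\<close>

definition tdeg :: "(nat \<Rightarrow>\<^sub>0 nat) \<Rightarrow> nat" where
  "tdeg m = (\<Sum>i\<in>supp m. coef m i)"

lemma tdeg_superset: "finite A \<Longrightarrow> supp m \<subseteq> A \<Longrightarrow> tdeg m = (\<Sum>i\<in>A. coef m i)"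
  unfolding tdeg_def by (intro sum.mono_neutral_left) (auto simp: in_keys_iff)

lemma tdeg_add: "tdeg (m + k) = tdeg m + tdeg k"
  using keys_add[of m k]
  by (simp add: tdeg_superset[of "supp m \<union> supp k"] lookup_add sum.distrib)

lemma tdeg_single [simp]: "tdeg (Poly_Mapping.single i k) = k"
  by (cases "k = 0") (simp_all add: tdeg_def)

text \<open>One notion for three uses: \<open>{d}\<close> for homogeneous polynomials,
  \<open>{..d}\<close> and \<open>{..<d}\<close> for bounded degree. The restriction of the
  variables is included because \<open>zpoly\<close> has infinitely many.\<close>

definition graded :: "nat \<Rightarrow> nat set \<Rightarrow> zpoly set" where
  "graded n S = {f. \<forall>m\<in>supp f. supp m \<subseteq> {1..n} \<and> tdeg m \<in> S}"

lemma graded_0 [simp]: "0 \<in> graded n S"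
  by (simp add: graded_def)

lemma graded_add: "f \<in> graded n S \<Longrightarrow> g \<in> graded n S \<Longrightarrow> f + g \<in> graded n S"
  using keys_add[of f g] by (auto simp: graded_def)

lemma graded_uminus: "f \<in> graded n S \<Longrightarrow> - f \<in> graded n S"
  by (simp add: graded_def in_keys_iff)

lemma graded_diff: "f \<in> graded n S \<Longrightarrow> g \<in> graded n S \<Longrightarrow> f - g \<in> graded n S"
  using graded_add[of f n S "- g"] graded_uminus[of g] by simp

lemma graded_sum: "(\<And>a. a \<in> A \<Longrightarrow> F a \<in> graded n S) \<Longrightarrow> sum F A \<in> graded n S"
  by (induction A rule: infinite_finite_induct) (auto intro: graded_add)

lemma graded_mono: "f \<in> graded n S \<Longrightarrow> S \<subseteq> T \<Longrightarrow> f \<in> graded n T"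
  by (auto simp: graded_def)

lemma graded_mult:
  assumes "f \<in> graded n S" "g \<in> graded n T" "\<And>a b. a \<in> S \<Longrightarrow> b \<in> T \<Longrightarrow> a + b \<in> U"
  shows "f * g \<in> graded n U"
proof -
  have "supp m \<subseteq> {1..n} \<and> tdeg m \<in> U" if m: "m \<in> supp (f * g)" for m
  proof -
    obtain a b where ab: "m = a + b" "a \<in> supp f" "b \<in> supp g"
      using keys_mult[of f g] m by auto
    then show ?thesis
      using assms keys_add[of a b] by (fastforce simp: graded_def tdeg_add)
  qed
  then show ?thesis by (auto simp: graded_def)
qed

lemma graded_Const [simp]: "Const c \<in> graded n {0}"
  by (cases "c = 0") (auto simp: graded_def Const_def tdeg_def)

lemma graded_zvar: "i \<in> {1..n} \<Longrightarrow> zvar i \<in> graded n {1}"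
  by (auto simp: graded_def zvar_def)

lemma graded_Const_mult: "f \<in> graded n S \<Longrightarrow> Const c * f \<in> graded n S"
  by (rule graded_mult[OF graded_Const]) auto

lemma graded_disjoint:
  assumes "f \<in> graded n S" "f \<in> graded n T" "S \<inter> T = {}"
  shows "f = 0"
  using assms unfolding graded_def by (metis (no_types, lifting) disjoint_iff keys_eq_empty mem_Collect_eq equals0I keys_zero)

text \<open>For \<open>hecke\<close> and \<open>cyc\<close> it then suffices to look at single
  monomials, whatever the set \<open>S\<close> of degrees is.\<close>

lemma graded_additive:
  assumes "f \<in> graded n S" and "A 0 = 0" and "\<And>f g. A (f + g) = A f + A g"
    and "\<And>m c. supp m \<subseteq> {1..n} \<Longrightarrow> A (monom_z m c) \<in> graded n {tdeg m}"
  shows "A f \<in> graded n S"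
proof -
  have "A (\<Sum>m\<in>B. monom_z m (coef f m)) = (\<Sum>m\<in>B. A (monom_z m (coef f m)))" if "finite B" for B
    using that assms(2,3) by (induction B rule: finite_induct) auto
  then have "A f = (\<Sum>m\<in>supp f. A (monom_z m (coef f m)))"
    by (subst (2) poly_mapping_sum_singles) simp
  moreover have "A (monom_z m (coef f m)) \<in> graded n S" if "m \<in> supp f" for m
    using that assms(1) by (intro graded_mono[OF assms(4)]) (auto simp: graded_def)
  ultimately show ?thesis by (simp add: graded_sum)
qed

text \<open>These are the exponents that \<open>hecke i\<close> can produce from one monomial: the
  pair at i and Suc i moves along the segment between (a, b) and (b, a).\<close>

definition spread :: "nat \<Rightarrow> (nat \<Rightarrow> nat) \<Rightarrow> (nat \<Rightarrow> nat) \<Rightarrow> bool" where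
  "spread i m k \<longleftrightarrow> (\<forall>j. j \<noteq> i \<longrightarrow> j \<noteq> Suc i \<longrightarrow> k j = m j) \<and> k i + k (Suc i) = m i + m (Suc i) \<and>
     min (m i) (m (Suc i)) \<le> k i \<and> k i \<le> max (m i) (m (Suc i))"

definition with_pair :: "nat \<Rightarrow> (nat \<Rightarrow>\<^sub>0 nat) \<Rightarrow> nat \<Rightarrow> nat \<Rightarrow> (nat \<Rightarrow>\<^sub>0 nat)" where
  "with_pair i m a b = Abs_poly_mapping ((coef m)(i := a, Suc i := b))"

lemma coef_with_pair [simp]: "coef (with_pair i m a b) = (coef m)(i := a, Suc i := b)"
  unfolding with_pair_def
proof (rule lookup_Abs_poly_mapping)
  have "{x. ((coef m)(i := a, Suc i := b)) x \<noteq> 0} \<subseteq> supp m \<union> {i, Suc i}"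
    by (auto simp: in_keys_iff)
  then show "finite {x. ((coef m)(i := a, Suc i := b)) x \<noteq> 0}"
    by (rule finite_subset) simp
qed

lemma with_pair_id: "with_pair i m (coef m i) (coef m (Suc i)) = m"
  by (rule poly_mapping_eqI) simp

lemma zvar_mult_with_pair:
  "zvar i * monom_z (with_pair i m a b) c = monom_z (with_pair i m (Suc a) b) c"
  "zvar (Suc i) * monom_z (with_pair i m a b) c = monom_z (with_pair i m a (Suc b)) c"
proof -
  have "Poly_Mapping.single i 1 + with_pair i m a b = with_pair i m (Suc a) b"
    "Poly_Mapping.single (Suc i) 1 + with_pair i m a b = with_pair i m a (Suc b)"
    by (rule poly_mapping_eqI, simp add: lookup_add lookup_single when_def)+
  then show "zvar i * monom_z (with_pair i m a b) c = monom_z (with_pair i m (Suc a) b) c"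
    "zvar (Suc i) * monom_z (with_pair i m a b) c = monom_z (with_pair i m a (Suc b)) c"
    by (simp_all add: zvar_def mult_single)
qed

lemma with_pair_factor:
  "monom_z (with_pair i m a b) c = monom_z (with_pair i m 0 0) c * zvar i ^ a * zvar (Suc i) ^ b"
proof -
  have 1: "monom_z (with_pair i m a 0) c = monom_z (with_pair i m 0 0) c * zvar i ^ a" for a
    by (induction a) (simp_all add: zvar_mult_with_pair(1)[symmetric] mult_ac)
  show ?thesis
  proof (induction b)
    case 0
    show ?case using 1[of a] by simp
  qed (simp add: zvar_mult_with_pair(2)[symmetric] mult_ac)
qed

lemma s_op_with_pair: "s_op i (monom_z (with_pair i m a b) c) = monom_z (with_pair i m b a) c"
proof -
  have "s_op i (monom_z (with_pair i m 0 0) c) = monom_z (with_pair i m 0 0) c"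
  proof -
    have "mon (\<lambda>j. zvar (transpose i (Suc i) j)) (with_pair i m 0 0) = mon zvar (with_pair i m 0 0)"
      by (rule mon_cong) (auto simp: in_keys_iff transpose_def)
    then show ?thesis
      by (simp add: s_op_def subst_z_eq C.ev_single) (simp add: monom_z_eq)
  qed
  moreover have "s_op i (zvar j ^ k) = s_op i (zvar j) ^ k" for j k
    by (simp add: s_op_def subst_z_eq C.ev_power)
  ultimately show ?thesis
    unfolding with_pair_factor[of i m a] with_pair_factor[of i m b]
    by (simp add: s_op_simps mult_ac)
qed

text \<open>Up to a common factor this is the geometric sum for (x^(b-a) - y^(b-a)) / (x - y). The
  swap exchanges the two monomials, hence the sign for the reversed pair.\<close>

lemma div_diff_with_pair:
  assumes "a \<le> b"
  shows "div_diff i (monom_z (with_pair i m a b) c)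
    = (\<Sum>l<b - a. monom_z (with_pair i m (a + l) (b - Suc l)) c)"
    and "div_diff i (monom_z (with_pair i m b a) c)
    = - (\<Sum>l<b - a. monom_z (with_pair i m (a + l) (b - Suc l)) c)"
proof -
  let ?x = "zvar i" and ?y = "zvar (Suc i)" and ?M = "monom_z (with_pair i m 0 0) c"
  have "(?x - ?y) * (\<Sum>l<b - a. monom_z (with_pair i m (a + l) (b - Suc l)) c)
      = ?M * ?x ^ a * ?y ^ a * ((?x - ?y) * (\<Sum>l<b - a. ?y ^ (b - a - Suc l) * ?x ^ l))"
  proof -
    have "monom_z (with_pair i m (a + l) (b - Suc l)) c
        = ?M * ?x ^ a * ?y ^ a * (?y ^ (b - a - Suc l) * ?x ^ l)" if "l < b - a" for l
    proof -
      have "b - Suc l = a + (b - a - Suc l)" using that by simp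
      then show ?thesis
        unfolding with_pair_factor[of i m "a + l"] by (simp add: power_add mult_ac)
    qed
    then have "(\<Sum>l<b - a. monom_z (with_pair i m (a + l) (b - Suc l)) c)
        = ?M * ?x ^ a * ?y ^ a * (\<Sum>l<b - a. ?y ^ (b - a - Suc l) * ?x ^ l)"
      by (simp add: sum_distrib_left)
    then show ?thesis by (simp add: mult_ac)
  qed
  also have "\<dots> = ?M * ?x ^ a * ?y ^ a * (?x ^ (b - a) - ?y ^ (b - a))"
    by (simp only: power_diff_sumr2)
  also have "\<dots> = monom_z (with_pair i m b a) c - monom_z (with_pair i m a b) c"
  proof -
    have "?x ^ b = ?x ^ a * ?x ^ (b - a)" "?y ^ b = ?y ^ a * ?y ^ (b - a)"
      using assms by (simp_all flip: power_add)
    then show ?thesis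
      unfolding with_pair_factor[of i m a] with_pair_factor[of i m b] by (simp add: algebra_simps)
  qed
  finally have *: "(?x - ?y) * (\<Sum>l<b - a. monom_z (with_pair i m (a + l) (b - Suc l)) c)
    = monom_z (with_pair i m b a) c - monom_z (with_pair i m a b) c" .
  show "div_diff i (monom_z (with_pair i m a b) c)
    = (\<Sum>l<b - a. monom_z (with_pair i m (a + l) (b - Suc l)) c)"
    by (rule div_diff_unique) (simp only: * s_op_with_pair)
  show "div_diff i (monom_z (with_pair i m b a) c)
    = - (\<Sum>l<b - a. monom_z (with_pair i m (a + l) (b - Suc l)) c)"
    by (rule div_diff_unique) (simp only: mult_minus_right * s_op_with_pair minus_diff_eq)
qed

lemma hecke_with_pair_div_diff:
  fixes D :: zpoly
  assumes "D = (\<Sum>l<b - a. monom_z (with_pair i m (a + l) (b - Suc l)) c)"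
  shows "(zvar i - Const tt * zvar (Suc i)) * D
    = (\<Sum>l<b - a. monom_z (with_pair i m (Suc (a + l)) (b - Suc l)) c
         - monom_z (with_pair i m (a + l) (b - l)) (tt * c))"
proof -
  have "(zvar i - Const tt * zvar (Suc i)) * monom_z (with_pair i m (a + l) (b - Suc l)) c
    = monom_z (with_pair i m (Suc (a + l)) (b - Suc l)) c
         - monom_z (with_pair i m (a + l) (b - l)) (tt * c)" if "l < b - a" for l
  proof -
    have "Suc (b - Suc l) = b - l" using that by simp
    then show ?thesis
      by (simp add: left_diff_distrib zvar_mult_with_pair mult.assoc)
        (simp add: Const_def mult_single)
  qed
  then show ?thesis by (simp add: assms sum_distrib_left)
qed

lemma supp_hecke_monom:
  assumes "k \<in> supp (hecke i (monom_z m c))"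
  shows "spread i (coef m) (coef k)"
proof -
  define a b where "a = min (coef m i) (coef m (Suc i))" and "b = max (coef m i) (coef m (Suc i))"
  define T where "T = (\<Sum>l<b - a. monom_z (with_pair i m (Suc (a + l)) (b - Suc l)) c
         - monom_z (with_pair i m (a + l) (b - l)) (tt * c))"
  have ab: "a \<le> b" by (simp add: a_def b_def)
  \<comment> \<open>The two orders of the pair differ only in the sign of the divided difference, so
    one list \<open>T\<close> of candidate exponents covers both.\<close>
  have "hecke i (monom_z m c) = Const tt * monom_z m c + T \<or> hecke i (monom_z m c) = Const tt * monom_z m c - T"
  proof (cases "coef m i \<le> coef m (Suc i)")
    case True
    then have "m = with_pair i m a b" by (simp add: a_def b_def with_pair_id)
    then have "div_diff i (monom_z m c) = (\<Sum>l<b - a. monom_z (with_pair i m (a + l) (b - Suc l)) c)"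
      using div_diff_with_pair(1)[OF ab, of i m c] by simp
    then show ?thesis unfolding hecke_def T_def by (simp add: hecke_with_pair_div_diff)
  next
    case False
    then have "m = with_pair i m b a" by (simp add: a_def b_def with_pair_id)
    then have "div_diff i (monom_z m c) = - (\<Sum>l<b - a. monom_z (with_pair i m (a + l) (b - Suc l)) c)"
      using div_diff_with_pair(2)[OF ab, of i m c] by simp
    then show ?thesis unfolding hecke_def T_def by (simp add: hecke_with_pair_div_diff)
  qed
  then have "k \<in> supp (Const tt * monom_z m c) \<union> supp T"
    using assms keys_add[of "Const tt * monom_z m c" T] keys_diff[of "Const tt * monom_z m c" T] by auto
  moreover have "Const tt * monom_z m c = monom_z m (tt * c)"
    by (simp add: Const_def mult_single)
  moreover have "\<exists>l<b - a. k = with_pair i m (Suc (a + l)) (b - Suc l) \<or> k = with_pair i m (a + l) (b - l)"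
    if "k \<in> supp T"
  proof -
    from that obtain l where "l < b - a" and l: "k \<in> supp (monom_z (with_pair i m (Suc (a + l)) (b - Suc l)) c
         - monom_z (with_pair i m (a + l) (b - l)) (tt * c))"
      using keys_sum[of "\<lambda>l. monom_z (with_pair i m (Suc (a + l)) (b - Suc l)) c
         - monom_z (with_pair i m (a + l) (b - l)) (tt * c)" "{..<b - a}"] unfolding T_def by blast
    moreover have "k = with_pair i m (Suc (a + l)) (b - Suc l) \<or> k = with_pair i m (a + l) (b - l)"
      using subsetD[OF keys_diff l] by (auto split: if_splits)
    ultimately show ?thesis by blast
  qed
  ultimately have "k = m \<or> (\<exists>l<b - a. k = with_pair i m (Suc (a + l)) (b - Suc l) \<or> k = with_pair i m (a + l) (b - l))"
    by (auto split: if_splits)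
  then show ?thesis
  proof
    assume "\<exists>l<b - a. k = with_pair i m (Suc (a + l)) (b - Suc l) \<or> k = with_pair i m (a + l) (b - l)"
    then show ?thesis
      by (auto simp: spread_def a_def b_def)
  qed (auto simp: spread_def)
qed

lemma hecke_eq_sum: "hecke i f = (\<Sum>m\<in>supp f. hecke i (monom_z m (coef f m)))"
  by (subst poly_mapping_sum_singles[of f]) (simp only: hecke_sum)

lemma supp_hecke:
  assumes "k \<in> supp (hecke i f)"
  obtains m where "m \<in> supp f" "spread i (coef m) (coef k)"
proof -
  have "k \<in> (\<Union>m\<in>supp f. supp (hecke i (monom_z m (coef f m))))"
    using assms keys_sum[of "\<lambda>m. hecke i (monom_z m (coef f m))" "supp f"]
    by (subst (asm) hecke_eq_sum) blast
  then show thesis using that supp_hecke_monom by blast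
qed

text \<open>Only the last term of the geometric sum, multiplied by the variable at i, reaches the
  swapped exponent, and it does so without a factor t. Hence leading coefficients stay 1 in
  \<open>interp_swap\<close>.\<close>

lemma coef_hecke_monom_swap:
  assumes "coef m i < coef m (Suc i)"
  shows "coef (hecke i (monom_z m c)) (with_pair i m (coef m (Suc i)) (coef m i)) = c"
proof -
  define a b where "a = coef m i" and "b = coef m (Suc i)"
  have ab: "a < b" using assms by (simp add: a_def b_def)
  have m: "m = with_pair i m a b" by (simp add: a_def b_def with_pair_id)
  have eq: "with_pair i m p r = with_pair i m p' r' \<longleftrightarrow> p = p' \<and> r = r'" for p r p' r'
  proof
    assume "with_pair i m p r = with_pair i m p' r'"
    then have "coef (with_pair i m p r) = coef (with_pair i m p' r')" by simp
    from fun_cong[OF this, of i] fun_cong[OF this, of "Suc i"]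
    show "p = p' \<and> r = r'" by simp
  qed simp
  have "hecke i (monom_z m c) = monom_z m (tt * c) + (\<Sum>l<b - a. monom_z (with_pair i m (Suc (a + l)) (b - Suc l)) c
         - monom_z (with_pair i m (a + l) (b - l)) (tt * c))"
    using div_diff_with_pair(1)[of a b i m c] ab m
    unfolding hecke_def by (simp add: hecke_with_pair_div_diff) (simp add: Const_def mult_single)
  then have "coef (hecke i (monom_z m c)) (with_pair i m b a) =
    coef (monom_z (with_pair i m a b) (tt * c)) (with_pair i m b a) + (\<Sum>l<b - a. (c when (Suc (a + l) = b \<and> b - Suc l = a))
       - (tt * c when (a + l = b \<and> b - l = a)))"
    using m by (simp only: lookup_add lookup_sum lookup_minus lookup_single eq)
  also have "coef (monom_z (with_pair i m a b) (tt * c)) (with_pair i m b a) = 0"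
    using ab by (simp add: lookup_single eq when_def)
  also have "(\<Sum>l<b - a. (c when (Suc (a + l) = b \<and> b - Suc l = a)) - (tt * c when (a + l = b \<and> b - l = a)))
     = (\<Sum>l<b - a. if l = b - a - 1 then c else 0)"
    using ab by (intro sum.cong) (auto simp: when_def)
  also have "\<dots> = c" using ab by simp
  finally show ?thesis by (simp add: a_def b_def)
qed

text \<open>The second hypothesis excludes contributions of other monomials;
  \<open>bruhat_le_spread_eq\<close> will provide it for leading exponents.\<close>

lemma coef_hecke_swap:
  assumes "coef m i < coef m (Suc i)"
    and "\<And>k. k \<in> supp f \<Longrightarrow> spread i (coef k) ((coef m)(i := coef m (Suc i), Suc i := coef m i)) \<Longrightarrow> k = m"
  shows "coef (hecke i f) (with_pair i m (coef m (Suc i)) (coef m i)) = coef f m"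
proof -
  let ?s = "with_pair i m (coef m (Suc i)) (coef m i)"
  have "coef (hecke i f) ?s = (\<Sum>k\<in>supp f. coef (hecke i (monom_z k (coef f k))) ?s)"
    by (subst hecke_eq_sum) (simp only: lookup_sum)
  also have "\<dots> = (\<Sum>k\<in>supp f. if k = m then coef f m else 0)"
  proof (rule sum.cong)
    fix k assume k: "k \<in> supp f"
    show "coef (hecke i (monom_z k (coef f k))) ?s = (if k = m then coef f m else 0)"
    proof (cases "k = m")
      case False
      then have "?s \<notin> supp (hecke i (monom_z k (coef f k)))"
        using assms(2)[OF k] supp_hecke_monom[of ?s i k "coef f k"] by auto
      then show ?thesis using False by (simp add: in_keys_iff)
    qed (simp add: coef_hecke_monom_swap[OF assms(1)])
  qed simp
  also have "\<dots> = coef f m" by (simp add: in_keys_iff)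
  finally show ?thesis .
qed

lemma graded_hecke:
  assumes "f \<in> graded n S" "i \<in> {1..<n}"
  shows "hecke i f \<in> graded n S"
  using assms(1)
proof (rule graded_additive)
  fix m :: "nat \<Rightarrow>\<^sub>0 nat" and c assume m: "supp m \<subseteq> {1..n}"
  show "hecke i (monom_z m c) \<in> graded n {tdeg m}"
    unfolding graded_def
  proof (intro CollectI ballI conjI)
    fix k assume "k \<in> supp (hecke i (monom_z m c))"
    then have k: "spread i (coef m) (coef k)" by (rule supp_hecke_monom)
    show sk: "supp k \<subseteq> {1..n}"
    proof
      fix j assume j: "j \<in> supp k"
      show "j \<in> {1..n}"
      proof (cases "j = i \<or> j = Suc i")
        case False
        then have "j \<in> supp m" using j k by (simp add: spread_def in_keys_iff)
        then show ?thesis using m by blast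
      qed (use assms(2) in auto)
    qed
    have "(\<Sum>j\<in>{1..n}. coef k j) = (\<Sum>j\<in>{1..n} - {i, Suc i}. coef k j) + (coef k i + coef k (Suc i))"
      using assms(2) by (subst sum.subset_diff[of "{i, Suc i}"]) auto
    also have "\<dots> = (\<Sum>j\<in>{1..n} - {i, Suc i}. coef m j) + (coef m i + coef m (Suc i))"
      using k by (simp add: spread_def)
    also have "\<dots> = (\<Sum>j\<in>{1..n}. coef m j)"
      using assms(2) by (subst (2) sum.subset_diff[of "{i, Suc i}"]) auto
    finally show "tdeg k \<in> {tdeg m}"
      using m sk by (simp add: tdeg_superset[of "{1..n}"])
  qed
qed (simp_all add: hecke_add)

section \<open>Compositions as exponents, and the cyclic shift\<close>

definition expo :: "nat \<Rightarrow> (nat \<Rightarrow> nat) \<Rightarrow> (nat \<Rightarrow>\<^sub>0 nat)" where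
  "expo n \<eta> = (\<Sum>i=1..n. Poly_Mapping.single i (\<eta> i))"

lemma coef_expo: "coef (expo n \<eta>) i = (if i \<in> {1..n} then \<eta> i else 0)"
  by (simp add: expo_def lookup_sum lookup_single when_def)

lemma coef_expo_composition [simp]: "composition n \<eta> \<Longrightarrow> coef (expo n \<eta>) = \<eta>"
  by (auto simp: coef_expo composition_def)

lemma supp_expo: "supp (expo n \<eta>) \<subseteq> {1..n}"
  by (auto simp: in_keys_iff coef_expo split: if_splits)

lemma composition_coef: "supp m \<subseteq> {1..n} \<Longrightarrow> composition n (coef m)"
  by (auto simp: composition_def in_keys_iff)

lemma expo_coef: "supp m \<subseteq> {1..n} \<Longrightarrow> expo n (coef m) = m"
  by (rule poly_mapping_eqI) (auto simp: coef_expo in_keys_iff)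

lemma tdeg_expo: "tdeg (expo n \<eta>) = weight n \<eta>"
  using supp_expo[of n \<eta>] by (simp add: tdeg_superset[of "{1..n}"] weight_def coef_expo)

lemma zpower_eq: "zpower n \<eta> = monom_z (expo n \<eta>) 1"
  using supp_expo[of n \<eta>]
  by (simp add: zpower_def monom_z_eq mon_superset[of "{1..n}"] coef_expo)

text \<open>The raising map of Knop and Sahi. Every nonzero composition arises from one of smaller
  weight by \<open>up\<close> and adjacent swaps, which drives the recursion in
  \<open>interp_exists\<close>.\<close>

definition up :: "nat \<Rightarrow> (nat \<Rightarrow> nat) \<Rightarrow> nat \<Rightarrow> nat" where
  "up n \<eta> j = (if j = n then \<eta> 1 + 1 else if j \<in> {1..<n} then \<eta> (j + 1) else 0)"

text \<open>The power of q appears because the first variable is replaced by the last one divided by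
  q; \<open>interp_up\<close> undoes it by its prefactor.\<close>

lemma cyc_monom:
  assumes "n \<ge> 1" "supp m \<subseteq> {1..n}"
  shows "zvar n * cyc n (monom_z m c) = monom_z (expo n (up n (coef m))) (c * inverse qq ^ coef m 1)"
proof -
  let ?e = "coef m" and ?\<sigma> = "\<lambda>j. if j = 1 then Const (inverse qq) * zvar n
     else if j \<in> {2..n} then zvar (j - 1) else zvar j"
  have "cyc n (monom_z m c) = Const c * mon ?\<sigma> m"
    by (simp add: cyc_def subst_z_eq C.ev_single)
  also have "mon ?\<sigma> m = (\<Prod>j\<in>insert 1 {2..n}. ?\<sigma> j ^ ?e j)"
    using assms by (intro mon_superset) auto
  also have "\<dots> = (Const (inverse qq) * zvar n) ^ ?e 1 * (\<Prod>j\<in>{2..n}. zvar (j - 1) ^ ?e j)"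
    by (subst prod.insert) (auto intro!: prod.cong)
  also have "(\<Prod>j\<in>{2..n}. zvar (j - 1) ^ ?e j) = (\<Prod>j\<in>{1..<n}. zvar j ^ ?e (j + 1))"
    by (rule prod.reindex_bij_witness[of _ "\<lambda>j. j + 1" "\<lambda>j. j - 1"]) auto
  finally have "zvar n * cyc n (monom_z m c)
    = Const (c * inverse qq ^ ?e 1) * (zvar n ^ (?e 1 + 1) * (\<Prod>j\<in>{1..<n}. zvar j ^ ?e (j + 1)))"
    by (simp add: Const_mult power_mult_distrib mult_ac Const_power)
  also have "zvar n ^ (?e 1 + 1) * (\<Prod>j\<in>{1..<n}. zvar j ^ ?e (j + 1)) = (\<Prod>j\<in>insert n {1..<n}. zvar j ^ up n ?e j)"
    by (subst prod.insert) (auto simp: up_def intro!: prod.cong)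
  also have "insert n {1..<n} = {1..n}" using assms by auto
  also have "(\<Prod>j\<in>{1..n}. zvar j ^ up n ?e j) = monom_z (expo n (up n ?e)) 1"
    by (simp only: zpower_eq flip: zpower_def)
  finally show ?thesis by (simp add: Const_def mult_single)
qed

lemma graded_cyc:
  assumes "f \<in> graded n S" "n \<ge> 1"
  shows "cyc n f \<in> graded n S"
  using assms(1)
proof (rule graded_additive)
  fix m :: "nat \<Rightarrow>\<^sub>0 nat" and c assume m: "supp m \<subseteq> {1..n}"
  let ?\<sigma> = "\<lambda>j. if j = 1 then Const (inverse qq) * zvar n
     else if j \<in> {2..n} then zvar (j - 1) else zvar j"
  have pw: "g \<in> graded n {1} \<Longrightarrow> g ^ k \<in> graded n {k}" for g k
  proof (induction k)
    case 0 show ?case using graded_Const[of 1 n] by simp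
  next
    case (Suc k) then show ?case by (auto intro!: graded_mult[of g n "{1}" "g ^ k" "{k}"])
  qed
  have pr: "(\<Prod>j\<in>A. ?\<sigma> j ^ coef m j) \<in> graded n {\<Sum>j\<in>A. coef m j}" if "finite A" "A \<subseteq> {1..n}" for A
    using that
  proof (induction A rule: finite_induct)
    case empty show ?case using graded_Const[of 1 n] by simp
  next
    case (insert j A)
    have "?\<sigma> j \<in> graded n {1}"
    proof (cases "j = 1")
      case True
      then show ?thesis using assms(2) graded_zvar[of n n] by (simp add: graded_Const_mult)
    next
      case False
      then have "j - 1 \<in> {1..n}" "j \<in> {2..n}" using insert.prems by auto
      then show ?thesis using False graded_zvar[of "j - 1" n] by simp
    qed
    from pw[OF this, of "coef m j"] show ?case
      using insert by (auto intro!: graded_mult[of _ n "{coef m j}" _ "{\<Sum>j\<in>A. coef m j}"] simp del: One_nat_def)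
  qed
  show "cyc n (monom_z m c) \<in> graded n {tdeg m}"
    using pr[of "supp m"] m
    by (simp add: cyc_def subst_z_eq C.ev_single mon_def tdeg_def graded_Const_mult)
qed (simp_all add: cyc_add)

section \<open>An affine Bruhat order on compositions\<close>

text \<open>
  Extend \<open>\<mu>\<close> to all integers by \<open>\<mu>(k + n) = \<mu>(k) + 1\<close>. Then \<open>bcount n \<mu> p c\<close> is the number of
  \<open>k \<le> p\<close> with \<open>\<mu>(k) \<ge> c\<close>; truncated subtraction serves as positive part. The resulting order is
  an affine Bruhat order: unlike \<^const>\<open>comp_prec\<close>, it is invariant under the shift \<^const>\<open>up\<close>.
\<close>

definition bcount :: "nat \<Rightarrow> (nat \<Rightarrow> nat) \<Rightarrow> nat \<Rightarrow> nat \<Rightarrow> nat" where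
  "bcount n \<mu> p c = (\<Sum>j=1..n. \<mu> j + (if j \<le> p then 1 else 0) - c)"

definition bruhat_le :: "nat \<Rightarrow> (nat \<Rightarrow> nat) \<Rightarrow> (nat \<Rightarrow> nat) \<Rightarrow> bool" where
  "bruhat_le n \<nu> \<eta> \<longleftrightarrow> weight n \<nu> = weight n \<eta> \<and> (\<forall>p\<le>n. \<forall>c. bcount n \<nu> p c \<le> bcount n \<eta> p c)"

lemma bcount_Suc:
  assumes "p < n"
  shows "bcount n \<mu> (Suc p) c = bcount n \<mu> p c + (if c \<le> \<mu> (Suc p) then 1 else 0)"
proof -
  have *: "bcount n \<mu> q c = (\<Sum>j\<in>{1..n} - {Suc p}. \<mu> j + (if j \<le> q then 1 else 0) - c)
      + (\<mu> (Suc p) + (if Suc p \<le> q then 1 else 0) - c)" for q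
    unfolding bcount_def using assms by (subst sum.remove[of _ "Suc p"]) auto
  have "(\<Sum>j\<in>{1..n} - {Suc p}. \<mu> j + (if j \<le> Suc p then 1 else 0) - c)
      = (\<Sum>j\<in>{1..n} - {Suc p}. \<mu> j + (if j \<le> p then 1 else 0) - c)"
    by (intro sum.cong) (auto simp: le_Suc_eq)
  then show ?thesis unfolding *[of p] *[of "Suc p"] by auto
qed

lemma bcount_eq_0: "p \<le> n \<Longrightarrow> bcount n \<mu> p c = bcount n \<mu> 0 c + (\<Sum>j=1..p. if c \<le> \<mu> j then 1 else 0)"
  by (induction p) (simp_all add: bcount_Suc)

text \<open>Quasi-periodicity: a full turn of n positions raises every entry by one, which the
  threshold absorbs.\<close>

lemma bcount_top: "bcount n \<mu> n (Suc c) = bcount n \<mu> 0 c"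
  unfolding bcount_def by (intro sum.cong) auto

lemma bcount_0: "bcount n \<mu> 0 c = (\<Sum>j=1..n. \<mu> j - c)"
  unfolding bcount_def by (intro sum.cong) auto

lemma bcount_c0: "p \<le> n \<Longrightarrow> bcount n \<mu> p 0 = weight n \<mu> + p"
  by (subst bcount_eq_0) (simp_all add: bcount_0 weight_def)

lemma composition_up: "composition n (up n \<mu>)" if "n \<ge> 1"
  using that by (auto simp: composition_def up_def)

text \<open>Stated for commutative monoids to obtain at once \<open>sum.up\<close> for weights,
  counts and legs and \<open>prod.up\<close> for \<open>d_inv\<close> and
  \<open>self_val\<close>.\<close>

lemma (in comm_monoid_set) up:
  assumes "n \<ge> 1"
  shows "F (\<lambda>j. h j (up n \<mu> j)) {1..n} = F (\<lambda>j. h (j - 1) (\<mu> j)) {2..n} \<^bold>* h n (\<mu> 1 + 1)"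
proof -
  have "{1..n} = insert n {1..<n}" using assms by auto
  then have "F (\<lambda>j. h j (up n \<mu> j)) {1..n} = F (\<lambda>j. h j (up n \<mu> j)) {1..<n} \<^bold>* h n (up n \<mu> n)"
    by (simp add: commute)
  also have "F (\<lambda>j. h j (up n \<mu> j)) {1..<n} = F (\<lambda>j. h (j - 1) (\<mu> j)) {2..n}"
    by (rule reindex_bij_witness[of _ "\<lambda>j. j - 1" "\<lambda>j. j + 1"]) (auto simp: up_def)
  finally show ?thesis by (simp add: up_def)
qed

lemma (in comm_monoid_set) from_1: "n \<ge> 1 \<Longrightarrow> F g {1..n} = F g {2..n} \<^bold>* g 1" for n :: nat
  by (simp add: atLeast_Suc_atMost numeral_2_eq_2 commute)

lemma weight_up: "n \<ge> 1 \<Longrightarrow> weight n (up n \<mu>) = weight n \<mu> + 1"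
  unfolding weight_def by (subst sum.up, simp, subst sum.from_1) simp_all

lemma bcount_up: "p < n \<Longrightarrow> bcount n (up n \<mu>) p c = bcount n \<mu> (Suc p) c"
proof -
  assume p: "p < n"
  have "(\<Sum>j=2..n. \<mu> j + (if j - 1 \<le> p then 1 else 0) - c) = (\<Sum>j=2..n. \<mu> j + (if j \<le> Suc p then 1 else 0) - c)"
    by (intro sum.cong) auto
  with p show ?thesis
    unfolding bcount_def
    by (subst sum.up[of n "\<lambda>j x. x + (if j \<le> p then 1 else 0) - c"], simp, subst sum.from_1) simp_all
qed

text \<open>For p < n the rotation only renames positions. Position n reduces to position 0 by
  \<open>bcount_top\<close>, except at threshold 0, where the count is determined by the
  weight.\<close>

lemma bruhat_le_up:
  assumes "n \<ge> 1" "bruhat_le n \<nu> \<eta>"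
  shows "bruhat_le n (up n \<nu>) (up n \<eta>)"
proof -
  have lt: "bcount n (up n \<nu>) p c \<le> bcount n (up n \<eta>) p c" if "p < n" for p c
    using assms(2) that by (auto simp: bcount_up bruhat_le_def)
  have "bcount n (up n \<nu>) n c \<le> bcount n (up n \<eta>) n c" for c
  proof (cases c)
    case 0
    then show ?thesis using assms by (simp add: bcount_c0 weight_up bruhat_le_def)
  qed (use lt[of 0] assms(1) in \<open>simp add: bcount_top\<close>)
  with lt show ?thesis
    using assms weight_up[OF assms(1)] by (auto simp: bruhat_le_def le_less)
qed

lemma bruhat_le_trans: "bruhat_le n a b \<Longrightarrow> bruhat_le n b c \<Longrightarrow> bruhat_le n a c"
  unfolding bruhat_le_def by (metis le_trans)

lemma bruhat_le_refl [simp]: "bruhat_le n a a"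
  by (simp add: bruhat_le_def)

text \<open>The increment of the count from p to Suc p tells, for each threshold c, whether the
  entry at Suc p reaches c.\<close>

lemma bruhat_le_antisym:
  assumes "composition n \<nu>" "composition n \<eta>" "bruhat_le n \<nu> \<eta>" "bruhat_le n \<eta> \<nu>"
  shows "\<nu> = \<eta>"
proof
  fix j
  show "\<nu> j = \<eta> j"
  proof (cases "j \<in> {1..n}")
    case True
    then obtain p where p: "j = Suc p" "p < n" by (cases j) auto
    have "bcount n \<nu> r c = bcount n \<eta> r c" if "r \<le> n" for r c
      using assms(3,4) that by (auto simp: bruhat_le_def intro: le_antisym)
    then have "c \<le> \<nu> j \<longleftrightarrow> c \<le> \<eta> j" for c
      using bcount_Suc[OF p(2), of \<nu> c] bcount_Suc[OF p(2), of \<eta> c] p by (auto split: if_splits)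
    then show ?thesis by (meson le_antisym le_refl)
  qed (use assms in \<open>simp add: composition_def\<close>)
qed

lemma sum_split_pair:
  fixes f :: "nat \<Rightarrow> 'a :: comm_monoid_add"
  assumes "i \<in> {1..<n}"
  shows "(\<Sum>j=1..n. f j) = (\<Sum>j\<in>{1..n} - {i, Suc i}. f j) + (f i + f (Suc i))"
  using assms by (subst sum.subset_diff[of "{i, Suc i}"]) auto

lemma spread_swap: "spread i \<eta> (\<eta> \<circ> transpose i (Suc i))"
  by (auto simp: spread_def transpose_def)

lemma weight_spread: "i \<in> {1..<n} \<Longrightarrow> spread i \<nu> \<kappa> \<Longrightarrow> weight n \<kappa> = weight n \<nu>"
proof -
  assume i: "i \<in> {1..<n}" and sp: "spread i \<nu> \<kappa>"
  have "sum \<kappa> ({1..n} - {i, Suc i}) = sum \<nu> ({1..n} - {i, Suc i})"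
    using sp by (intro sum.cong) (auto simp: spread_def)
  then show ?thesis
    using sp unfolding weight_def sum_split_pair[OF i] by (simp add: spread_def)
qed

text \<open>The function max(x - c, 0) is convex, so its sum over a pair cannot grow when the pair
  moves inward. For p \<noteq> i both places of the pair get the same summand
  \<open>e\<close>.\<close>

lemma bcount_spread:
  assumes "i \<in> {1..<n}" "spread i \<nu> \<kappa>" "p \<noteq> i"
  shows "bcount n \<kappa> p c \<le> bcount n \<nu> p c"
proof -
  define e :: nat where "e = (if i \<le> p then 1 else 0)"
  have e: "(if Suc i \<le> p then 1 else 0) = e" using assms(3) by (auto simp: e_def)
  have "(\<kappa> i + e - c) + (\<kappa> (Suc i) + e - c) \<le> (\<nu> i + e - c) + (\<nu> (Suc i) + e - c)"
    using assms(2) unfolding spread_def min_def max_def by (auto split: if_splits)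
  moreover have "(\<Sum>j\<in>{1..n} - {i, Suc i}. \<kappa> j + (if j \<le> p then 1 else 0) - c)
    = (\<Sum>j\<in>{1..n} - {i, Suc i}. \<nu> j + (if j \<le> p then 1 else 0) - c)"
    using assms(2) by (simp add: spread_def)
  ultimately show ?thesis
    unfolding bcount_def sum_split_pair[OF assms(1)] e e_def[symmetric] by simp
qed

lemma bcount_swap:
  assumes "i \<in> {1..<n}" "p \<noteq> i"
  shows "bcount n (\<eta> \<circ> transpose i (Suc i)) p c = bcount n \<eta> p c"
proof (rule le_antisym)
  show "bcount n (\<eta> \<circ> transpose i (Suc i)) p c \<le> bcount n \<eta> p c"
    by (rule bcount_spread[OF assms(1) spread_swap assms(2)])
  show "bcount n \<eta> p c \<le> bcount n (\<eta> \<circ> transpose i (Suc i)) p c"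
    using bcount_spread[OF assms(1) spread_swap assms(2), of "\<eta> \<circ> transpose i (Suc i)" c]
    by (simp add: comp_assoc)
qed

text \<open>
  For \<open>p \<noteq> i\<close> the count at \<open>p\<close> only decreases under \<^const>\<open>spread\<close>; the count at \<open>i\<close> is controlled
  by its neighbours, because a step of \<^const>\<open>bcount\<close> in \<open>p\<close> is 0 or 1.
\<close>

lemma bruhat_le_spread_swap:
  assumes i: "i \<in> {1..<n}" and "bruhat_le n \<nu> \<eta>" and sp: "spread i \<nu> \<kappa>" and asc: "\<eta> i \<le> \<eta> (Suc i)"
  shows "bruhat_le n \<kappa> (\<eta> \<circ> transpose i (Suc i))"
proof -
  let ?\<eta> = "\<eta> \<circ> transpose i (Suc i)"
  have ne: "bcount n \<kappa> p c \<le> bcount n \<eta> p c" if "p \<le> n" "p \<noteq> i" for p c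
    using bcount_spread[OF i sp that(2), of c] assms(2) that by (auto simp: bruhat_le_def intro: le_trans)
  obtain p where p: "i = Suc p" "p < n" "Suc p < n" using i by (cases i) auto
  have "bcount n \<kappa> i c \<le> bcount n ?\<eta> i c" for c
    using ne[of p c] ne[of "Suc i" c] bcount_Suc[OF p(2), of \<kappa> c] bcount_Suc[OF p(3), of \<kappa> c]
      bcount_Suc[OF p(2), of ?\<eta> c] bcount_swap[OF i, of p \<eta> c] asc
      bcount_Suc[OF p(2), of \<eta> c] bcount_Suc[OF p(3), of \<eta> c] p
    by (auto split: if_splits)
  then have "bcount n \<kappa> p c \<le> bcount n ?\<eta> p c" if "p \<le> n" for p c
    using ne[OF that] bcount_swap[OF i, of p \<eta> c] by (cases "p = i") auto
  then show ?thesis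
    using assms(2) weight_spread[OF i sp] weight_spread[OF i spread_swap[of i \<eta>]] by (simp add: bruhat_le_def)
qed

text \<open>Ensures that the leading monomial of \<open>hecke i G\<close> comes from that of
  \<open>G\<close> alone. For p \<noteq> i the counts of \<nu> lie between those of the swapped
  composition and those of \<eta>, which agree. So the pair of \<nu> reaches each threshold as often
  as the pair of \<eta>, and the count at i decides the order of the two entries.\<close>

lemma bruhat_le_spread_eq:
  assumes i: "i \<in> {1..<n}" and le: "bruhat_le n \<nu> \<eta>" and asc: "\<eta> i < \<eta> (Suc i)"
    and sp: "spread i \<nu> (\<eta> \<circ> transpose i (Suc i))"
    and comp: "composition n \<nu>" "composition n \<eta>"
  shows "\<nu> = \<eta>"
proof -
  let ?\<eta> = "\<eta> \<circ> transpose i (Suc i)"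
  have ne: "bcount n \<nu> p c = bcount n \<eta> p c" if "p \<le> n" "p \<noteq> i" for p c
    using bcount_spread[OF i sp that(2), of c] le that bcount_swap[OF i that(2), of \<eta> c]
    by (auto simp: bruhat_le_def intro: le_antisym)
  obtain p where p: "i = Suc p" "p < n" "Suc p < n" using i by (cases i) auto
  have *: "(if c \<le> \<nu> i then 1 else 0) + (if c \<le> \<nu> (Suc i) then 1 else 0)
     = (if c \<le> \<eta> i then 1 else 0) + (if c \<le> \<eta> (Suc i) then (1::nat) else 0)" for c
    using ne[of p c] ne[of "Suc i" c] bcount_Suc[OF p(2), of \<nu> c] bcount_Suc[OF p(3), of \<nu> c]
      bcount_Suc[OF p(2), of \<eta> c] bcount_Suc[OF p(3), of \<eta> c] p by simp
  have le_i: "c \<le> \<nu> i \<Longrightarrow> c \<le> \<eta> i" for c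
  proof -
    have "bcount n \<nu> i c \<le> bcount n \<eta> i c" using le i by (auto simp: bruhat_le_def)
    then show "c \<le> \<nu> i \<Longrightarrow> c \<le> \<eta> i"
      using ne[of p c] bcount_Suc[OF p(2), of \<nu> c] bcount_Suc[OF p(2), of \<eta> c] p
      by (auto split: if_splits)
  qed
  have sum: "\<nu> i + \<nu> (Suc i) = \<eta> i + \<eta> (Suc i)" using sp by (simp add: spread_def)
  have "\<nu> i \<le> \<eta> i" using le_i by blast
  moreover have "\<eta> (Suc i) \<ge> \<nu> (Suc i)"
    using *[of "\<nu> (Suc i)"] asc by (auto split: if_splits)
  ultimately have "\<nu> i = \<eta> i" "\<nu> (Suc i) = \<eta> (Suc i)" using sum by auto
  moreover have "\<nu> j = \<eta> j" if "j \<noteq> i" "j \<noteq> Suc i" for j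
    using sp that by (simp add: spread_def transpose_def)
  ultimately show ?thesis by (metis ext)
qed

lemma finite_compositions: "finite {\<nu>. composition n \<nu> \<and> weight n \<nu> \<le> d}"
proof (rule finite_subset)
  show "{\<nu>. composition n \<nu> \<and> weight n \<nu> \<le> d} \<subseteq> {\<nu>. \<forall>i. (i \<in> {1..n} \<longrightarrow> \<nu> i \<in> {..d}) \<and> (i \<notin> {1..n} \<longrightarrow> \<nu> i = 0)}"
  proof (intro subsetI CollectI allI conjI impI)
    fix \<nu> i assume "\<nu> \<in> {\<nu>. composition n \<nu> \<and> weight n \<nu> \<le> d}"
    then have \<nu>: "composition n \<nu>" "weight n \<nu> \<le> d" by auto
    show "\<nu> i \<in> {..d}" if "i \<in> {1..n}"
      using member_le_sum[of i "{1..n}" \<nu>] \<nu>(2) that by (simp add: weight_def)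
    show "\<nu> i = 0" if "i \<notin> {1..n}"
      using \<nu>(1) that by (simp add: composition_def)
  qed
qed (rule finite_set_of_finite_funs, auto)

lemma partition_of_conv:
  assumes "i \<in> {1..n}"
  shows "partition_of n \<eta> i = rev (sort (map \<eta> [1..<n + 1])) ! (i - 1)"
  using assms by (simp add: partition_of_def)

lemma sum_partition_of: "(\<Sum>i=1..n. f (partition_of n \<eta> i)) = (\<Sum>i=1..n. f (\<eta> i) :: 'a :: comm_monoid_add)"
proof -
  let ?L = "rev (sort (map \<eta> [1..<n + 1]))"
  have "(\<Sum>i=1..n. f (partition_of n \<eta> i)) = (\<Sum>i<n. f (?L ! i))"
    by (rule sum.reindex_bij_witness[of _ "\<lambda>i. i + 1" "\<lambda>i. i - 1"]) (auto simp: partition_of_conv simp del: upt_Suc)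
  also have "\<dots> = sum_list (map f ?L)"
    by (simp add: sum_list_sum_nth atLeast0LessThan del: upt_Suc)
  also have "\<dots> = sum_list (map f (map \<eta> [1..<n + 1]))"
    by (simp only: sum_mset_sum_list[symmetric] mset_map mset_rev mset_sort)
  also have "\<dots> = (\<Sum>i=1..n. f (\<eta> i))"
    by (simp add: interv_sum_list_conv_sum_set_nat comp_def atLeastLessThanSuc_atLeastAtMost del: upt_Suc)
  finally show ?thesis .
qed

lemma partition_of_antimono:
  assumes "i \<in> {1..n}" "j \<in> {1..n}" "i \<le> j"
  shows "partition_of n \<eta> j \<le> partition_of n \<eta> i"
proof -
  have "sorted_wrt (\<ge>) (rev (sort (map \<eta> [1..<n + 1])))"
    by (simp add: sorted_wrt_rev del: upt_Suc)
  then show ?thesis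
    using assms sorted_wrt_nth_less[of "(\<ge>)" "rev (sort (map \<eta> [1..<n + 1]))" "i - 1" "j - 1"]
    by (cases "i = j") (auto simp: partition_of_conv simp del: upt_Suc)
qed

text \<open>The counts at p = 0 depend only on the multiset of entries. If the partitions agree,
  these counts cancel, and the remaining inequalities, summed over all thresholds, bound the partial
  sums. If not, the counts at 0 already bound the partial sums of the partitions.\<close>

lemma bruhat_le_imp_prec:
  assumes comp: "composition n \<nu>" "composition n \<eta>" and le: "bruhat_le n \<nu> \<eta>" and ne: "\<nu> \<noteq> \<eta>"
  shows "comp_prec n \<nu> \<eta>"
proof (cases "partition_of n \<nu> = partition_of n \<eta>")
  case True
  have "(\<Sum>j=1..n. \<nu> j - c) = (\<Sum>j=1..n. \<eta> j - c)" for c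
    using sum_partition_of[of "\<lambda>x. x - c" n \<nu>] sum_partition_of[of "\<lambda>x. x - c" n \<eta>] True by simp
  then have eq0: "bcount n \<nu> 0 c = bcount n \<eta> 0 c" for c
    by (simp add: bcount_0)
  have "(\<Sum>i=1..p. \<nu> i) \<le> (\<Sum>i=1..p. \<eta> i)" if p: "p \<in> {1..n}" for p
  proof -
    define M where "M = weight n \<nu>"
    have M: "\<nu> j \<le> M \<and> \<eta> j \<le> M" if "j \<in> {1..n}" for j
      using member_le_sum[of j "{1..n}" \<nu>] member_le_sum[of j "{1..n}" \<eta>] le that
      by (auto simp: M_def weight_def bruhat_le_def)
    \<comment> \<open>Each entry is the number of positive thresholds it reaches; \<open>M\<close>
      only has to bound all entries.\<close>
    have cnt: "x = (\<Sum>c=1..M. if c \<le> x then 1 else 0)" if "x \<le> M" for x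
    proof -
      have "{1..M} \<inter> {c. c \<le> x} = {1..x}" using that by auto
      then show ?thesis by (simp add: sum.If_cases)
    qed
    have A: "(\<Sum>i=1..p. \<mu> i) = (\<Sum>c=1..M. \<Sum>i=1..p. if c \<le> \<mu> i then 1 else 0)"
      if "\<And>j. j \<in> {1..n} \<Longrightarrow> \<mu> j \<le> M" for \<mu>
    proof -
      have "(\<Sum>i=1..p. \<mu> i) = (\<Sum>i=1..p. \<Sum>c=1..M. if c \<le> \<mu> i then 1 else 0)"
        using that p by (intro sum.cong refl cnt) auto
      then show ?thesis by (subst sum.swap)
    qed
    have "(\<Sum>i=1..p. if c \<le> \<nu> i then 1 else 0) \<le> (\<Sum>i=1..p. if c \<le> \<eta> i then 1 else (0::nat))" for c
      using bcount_eq_0[of p n \<nu> c] bcount_eq_0[of p n \<eta> c] le p eq0[of c]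
      by (simp add: bruhat_le_def) (metis add_le_cancel_left)
    then show ?thesis
      using M by (subst (1 2) A) (auto intro: sum_mono)
  qed
  then have "(\<Sum>i=1..p. int (\<eta> i) - int (\<nu> i)) \<ge> 0" if "p \<in> {1..n}" for p
    using that by (simp add: sum_subtractf flip: of_nat_sum)
  then show ?thesis using True ne le by (auto simp: comp_prec_def dominated_def bruhat_le_def)
next
  case False
  have "(\<Sum>i=1..p. partition_of n \<nu> i) \<le> (\<Sum>i=1..p. partition_of n \<eta> i)" if p: "p \<in> {1..n}" for p
  proof -
    let ?a = "partition_of n \<nu>" and ?b = "partition_of n \<eta>"
    \<comment> \<open>For any threshold c, p * c plus the sum of max(part - c, 0) bounds the first p
      parts from above. For the partition of \<eta> this bound is attained when c is its own part
      p.\<close>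
    define c where "c = ?b p"
    have "(\<Sum>i=1..p. ?a i) \<le> (\<Sum>i=1..p. c + (?a i - c))" by (intro sum_mono) auto
    also have "\<dots> = p * c + (\<Sum>i=1..p. ?a i - c)" by (simp add: sum.distrib)
    also have "(\<Sum>i=1..p. ?a i - c) \<le> (\<Sum>i=1..n. ?a i - c)"
      using p by (intro sum_mono2) auto
    also have "\<dots> = bcount n \<nu> 0 c"
      by (simp only: sum_partition_of[of "\<lambda>x. x - c"] bcount_0)
    also have "\<dots> \<le> bcount n \<eta> 0 c" using le by (simp add: bruhat_le_def)
    also have "\<dots> = (\<Sum>i=1..n. ?b i - c)"
      by (simp only: sum_partition_of[of "\<lambda>x. x - c"] bcount_0)
    also have "\<dots> = (\<Sum>i=1..p. ?b i - c)"
    proof (rule sum.mono_neutral_right)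
      show "\<forall>i\<in>{1..n} - {1..p}. ?b i - c = 0"
        using partition_of_antimono[of p n _ \<eta>] p by (auto simp: c_def)
    qed (use p in auto)
    also have "p * c + (\<Sum>i=1..p. ?b i - c) = (\<Sum>i=1..p. c + (?b i - c))" by (simp add: sum.distrib)
    also have "\<dots> = (\<Sum>i=1..p. ?b i)"
      using partition_of_antimono[of _ n p \<eta>] p by (intro sum.cong) (auto simp: c_def)
    finally show ?thesis by simp
  qed
  then have "(\<Sum>i=1..p. int (partition_of n \<eta> i) - int (partition_of n \<nu> i)) \<ge> 0" if "p \<in> {1..n}" for p
    using that by (simp add: sum_subtractf flip: of_nat_sum)
  then show ?thesis using False le by (auto simp: comp_prec_def dominated_def bruhat_le_def)
qed

section \<open>Spectral points\<close>

definition spec :: "nat \<Rightarrow> nat \<Rightarrow> qtfield" where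
  "spec a l = qq ^ a * tt powi (- int l)"

lemma eigenval_eq: "eigenval n \<eta> i = spec (\<eta> i) (leg' n \<eta> i)"
  by (simp add: eigenval_def spec_def)

lemma spec_mult: "spec a l * tt ^ l = qq ^ a"
  by (simp add: spec_def power_int_minus)

lemma spec_nonzero [simp]: "spec a l \<noteq> 0"
  by (simp add: spec_def power_int_eq_0_iff)

lemma spec_Suc1: "spec (Suc a) l = qq * spec a l"
  by (simp add: spec_def)

lemma spec_Suc2: "spec a l = tt * spec a (Suc l)"
  unfolding spec_def power_int_minus power_int_of_nat by (simp add: field_simps)

lemma qq_tt_power: "qq ^ a * tt ^ k = to_fract (monom (monom 1 a) k)"
proof -
  have p: "to_fract p ^ k = to_fract (p ^ k)" for p :: "rat poly poly" and k
    by (induction k) (simp_all add: to_fract_mult)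
  have "[:[:0, 1:]:] ^ a * [:0, 1:] ^ k = (monom (monom 1 a) k :: rat poly poly)"
  proof -
    have "[:0, 1:] ^ k = (monom 1 k :: rat poly poly)" for k
      by (simp add: monom_altdef)
    moreover have "[:[:0, 1:]:] ^ a = [:monom 1 a :: rat poly:]"
      by (induction a) (simp_all add: monom_Suc one_pCons)
    ultimately show ?thesis by (simp add: smult_monom)
  qed
  then show ?thesis by (simp add: qq_def tt_def p to_fract_mult[symmetric])
qed

lemma qq_tt_power_eq_iff [simp]: "qq ^ a * tt ^ k = qq ^ b * tt ^ l \<longleftrightarrow> a = b \<and> k = l"
proof
  assume "qq ^ a * tt ^ k = qq ^ b * tt ^ l"
  then have *: "(monom (monom 1 a) k :: rat poly poly) = monom (monom 1 b) l"
    unfolding qq_tt_power by simp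
  then have "k = l" using degree_monom_eq[of "monom 1 a :: rat poly" k] degree_monom_eq[of "monom 1 b :: rat poly" l]
    by simp
  with * have "(monom 1 a :: rat poly) = monom 1 b" by (metis coeff_monom)
  then have "a = b" by (metis degree_monom_eq zero_neq_one)
  with \<open>k = l\<close> show "a = b \<and> k = l" by simp
qed simp

text \<open>Multiplying away the negative powers of t reduces this to the distinctness of monomials
  in the indeterminates q and t.\<close>

lemma spec_eq_iff [simp]: "spec a l = spec b m \<longleftrightarrow> a = b \<and> l = m"
proof
  assume "spec a l = spec b m"
  then have "spec a l * tt ^ l * tt ^ m = spec b m * tt ^ m * tt ^ l" by simp
  then have "qq ^ a * tt ^ m = qq ^ b * tt ^ l" by (simp only: spec_mult)
  then show "a = b \<and> l = m" by simp
qed simp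

lemma qq_neq_1: "qq \<noteq> 1" and tt_neq_1: "tt \<noteq> 1"
  using qq_tt_power_eq_iff[of 1 0 0 0] qq_tt_power_eq_iff[of 0 1 0 0] by simp_all

text \<open>Indicator form of the sets counted by \<open>leg'\<close>, so that legs can be reindexed
  by transpositions and by \<open>sum.up\<close>; \<open>lleg\<close> does the same for
  \<open>leg\<close>.\<close>

definition above :: "nat \<Rightarrow> nat \<Rightarrow> nat \<Rightarrow> nat \<Rightarrow> nat" where
  "above i v k x = (if k < i \<and> v \<le> x \<or> i < k \<and> v < x then 1 else 0)"

lemma leg'_eq: "leg' n \<eta> i = (\<Sum>k=1..n. above i (\<eta> i) k (\<eta> k))"
proof -
  have "(\<Sum>k=1..n. above i (\<eta> i) k (\<eta> k)) =
    (\<Sum>k=1..n. (if k < i \<and> \<eta> i \<le> \<eta> k then 1 else 0) + (if i < k \<and> \<eta> i < \<eta> k then 1 else 0))"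
    by (intro sum.cong) (auto simp: above_def)
  also have "\<dots> = card ({1..n} \<inter> {k. k < i \<and> \<eta> i \<le> \<eta> k}) + card ({1..n} \<inter> {k. i < k \<and> \<eta> i < \<eta> k})"
    by (simp add: sum.distrib sum.If_cases)
  also have "\<dots> = leg' n \<eta> i"
    unfolding leg'_def by (intro arg_cong2[where f = "(+)"] arg_cong[where f = card]) auto
  finally show ?thesis ..
qed

lemma bij_transpose: "i \<in> {1..<n} \<Longrightarrow> bij_betw (transpose i (Suc i)) {1..n} {1..n}"
  by (rule bij_betw_byWitness[of _ "transpose i (Suc i)"]) (auto simp: transpose_def)

lemma sum_transpose:
  "i \<in> {1..<n} \<Longrightarrow> (\<Sum>k=1..n. f (transpose i (Suc i) k)) = (\<Sum>k=1..n. f k)"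
  by (rule sum.reindex_bij_betw) (rule bij_transpose)

lemma prod_transpose:
  "i \<in> {1..<n} \<Longrightarrow> (\<Prod>k=1..n. f (transpose i (Suc i) k)) = (\<Prod>k=1..n. f k)"
  by (rule prod.reindex_bij_betw) (rule bij_transpose)

text \<open>Between unequal entries the comparison in \<open>above\<close> does not depend on which
  one stands left, so the coordinates travel with their entries.\<close>

lemma eigenval_swap:
  assumes i: "i \<in> {1..<n}" and ne: "\<mu> i \<noteq> \<mu> (Suc i)"
  shows "eigenval n (\<mu> \<circ> transpose i (Suc i)) j = eigenval n \<mu> (transpose i (Suc i) j)"
proof -
  let ?t = "transpose i (Suc i)"
  have "leg' n (\<mu> \<circ> ?t) j = (\<Sum>k=1..n. above j (\<mu> (?t j)) (?t k) (\<mu> k))"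
    using sum_transpose[OF i, of "\<lambda>k. above j (\<mu> (?t j)) k (\<mu> (?t k))"]
    by (simp add: leg'_eq)
  also have "\<dots> = (\<Sum>k=1..n. above (?t j) (\<mu> (?t j)) k (\<mu> k))"
    using ne by (intro sum.cong) (auto simp: above_def transpose_def split: if_splits)
  finally show ?thesis by (simp add: eigenval_eq leg'_eq)
qed

text \<open>The right one of two equal neighbours counts the left one in addition. The factor t is
  exactly the ratio at which \<open>bhat\<close> vanishes.\<close>

lemma eigenval_equal:
  assumes i: "i \<in> {1..<n}" and eq: "\<mu> i = \<mu> (Suc i)"
  shows "eigenval n \<mu> i = tt * eigenval n \<mu> (Suc i)"
proof -
  have "(\<Sum>k\<in>{1..n} - {i, Suc i}. above (Suc i) (\<mu> (Suc i)) k (\<mu> k))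
     = (\<Sum>k\<in>{1..n} - {i, Suc i}. above i (\<mu> i) k (\<mu> k))"
    using eq by (intro sum.cong) (auto simp: above_def)
  then have "leg' n \<mu> (Suc i) = Suc (leg' n \<mu> i)"
    unfolding leg'_eq sum_split_pair[OF i] using eq by (simp add: above_def)
  then have "spec (\<mu> i) (leg' n \<mu> i) = tt * spec (\<mu> (Suc i)) (leg' n \<mu> (Suc i))"
    using spec_Suc2[of "\<mu> i" "leg' n \<mu> i"] eq by metis
  then show ?thesis unfolding eigenval_eq .
qed

text \<open>The first entry passes to the far right and grows by one, so a weak inequality from the
  left becomes a strict one from the right and all comparisons persist.\<close>

lemma eigenval_up:
  assumes "j \<in> {1..<n}"
  shows "eigenval n (up n \<mu>) j = eigenval n \<mu> (Suc j)"
proof -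
  have n: "n \<ge> 1" using assms by auto
  have "leg' n (up n \<mu>) j = (\<Sum>k=1..n. above j (\<mu> (Suc j)) k (up n \<mu> k))"
  proof -
    have "up n \<mu> j = \<mu> (Suc j)" using assms by (simp add: up_def)
    then show ?thesis unfolding leg'_eq by (simp only:)
  qed
  also have "\<dots> = (\<Sum>k=2..n. above j (\<mu> (Suc j)) (k - 1) (\<mu> k)) + above j (\<mu> (Suc j)) n (\<mu> 1 + 1)"
    by (rule sum.up[OF n])
  also have "(\<Sum>k=2..n. above j (\<mu> (Suc j)) (k - 1) (\<mu> k)) = (\<Sum>k=2..n. above (Suc j) (\<mu> (Suc j)) k (\<mu> k))"
    by (intro sum.cong) (auto simp: above_def)
  also have "above j (\<mu> (Suc j)) n (\<mu> 1 + 1) = above (Suc j) (\<mu> (Suc j)) 1 (\<mu> 1)"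
    using assms by (auto simp: above_def)
  also have "(\<Sum>k=2..n. above (Suc j) (\<mu> (Suc j)) k (\<mu> k)) + \<dots> = leg' n \<mu> (Suc j)"
    unfolding leg'_eq by (rule sum.from_1[symmetric, OF n])
  finally have "leg' n (up n \<mu>) j = leg' n \<mu> (Suc j)" .
  moreover have "up n \<mu> j = \<mu> (Suc j)" using assms by (simp add: up_def)
  ultimately show ?thesis by (simp add: eigenval_eq)
qed

lemma eigenval_up_top:
  assumes n: "n \<ge> 1"
  shows "eigenval n (up n \<mu>) n = qq * eigenval n \<mu> 1"
proof -
  have "leg' n (up n \<mu>) n = (\<Sum>k=1..n. above n (Suc (\<mu> 1)) k (up n \<mu> k))"
  proof -
    have "up n \<mu> n = Suc (\<mu> 1)" by (simp add: up_def)
    then show ?thesis unfolding leg'_eq by (simp only:)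
  qed
  also have "\<dots> = (\<Sum>k=2..n. above n (Suc (\<mu> 1)) (k - 1) (\<mu> k)) + above n (Suc (\<mu> 1)) n (\<mu> 1 + 1)"
    by (rule sum.up[OF n])
  also have "(\<Sum>k=2..n. above n (Suc (\<mu> 1)) (k - 1) (\<mu> k)) = (\<Sum>k=2..n. above 1 (\<mu> 1) k (\<mu> k))"
    by (intro sum.cong) (auto simp: above_def)
  also have "above n (Suc (\<mu> 1)) n (\<mu> 1 + 1) = above 1 (\<mu> 1) 1 (\<mu> 1)"
    by (auto simp: above_def)
  also have "(\<Sum>k=2..n. above 1 (\<mu> 1) k (\<mu> k)) + \<dots> = leg' n \<mu> 1"
    unfolding leg'_eq by (rule sum.from_1[symmetric, OF n])
  finally have "leg' n (up n \<mu>) n = leg' n \<mu> 1" .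
  moreover have "up n \<mu> n = Suc (\<mu> 1)" by (simp add: up_def)
  ultimately show ?thesis by (simp add: eigenval_eq spec_Suc1)
qed

text \<open>All n - 1 places to the left count, since no entry is below 0. This is the origin of the
  constant in \<open>phi\<close>, which has to vanish at the spectral points outside the image of
  \<open>up\<close>.\<close>

lemma eigenval_last_zero:
  assumes n: "n \<ge> 1" and "\<mu> n = 0"
  shows "eigenval n \<mu> n = tt powi (1 - int n)"
proof -
  have "leg' n \<mu> n = (\<Sum>k=1..n. if k < n then 1 else 0)"
    unfolding leg'_eq using assms(2) by (intro sum.cong) (auto simp: above_def)
  also have "{1..n} \<inter> {k. k < n} = {1..<n}" by auto
  then have "(\<Sum>k=1..n. if k < n then 1 else 0) = n - 1"
    by (simp add: sum.If_cases)
  finally show ?thesis using assms by (simp add: eigenval_eq spec_def of_nat_diff)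
qed

text \<open>Equal powers of q force equal entries, and of two equal entries the right one has the
  strictly larger leg.\<close>

lemma eigenval_inj:
  assumes "i \<in> {1..n}" "j \<in> {1..n}" "eigenval n \<mu> i = eigenval n \<mu> j"
  shows "i = j"
proof -
  have *: "\<not> i < j" if "i \<in> {1..n}" "j \<in> {1..n}" and e: "eigenval n \<mu> i = eigenval n \<mu> j" for i j
  proof
    assume ij: "i < j"
    have m: "\<mu> i = \<mu> j" "leg' n \<mu> i = leg' n \<mu> j" using e by (simp_all add: eigenval_eq)
    have "leg' n \<mu> i < leg' n \<mu> j"
      unfolding leg'_eq
    proof (rule sum_strict_mono_ex1)
      show "\<forall>k\<in>{1..n}. above i (\<mu> i) k (\<mu> k) \<le> above j (\<mu> j) k (\<mu> k)"
        using ij m(1) by (auto simp: above_def) (metis linorder_neqE_nat nat_neq_iff)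
      show "\<exists>k\<in>{1..n}. above i (\<mu> i) k (\<mu> k) < above j (\<mu> j) k (\<mu> k)"
        using that ij m(1) by (intro bexI[of _ i]) (auto simp: above_def)
    qed simp
    with m show False by simp
  qed
  show ?thesis using *[of i j] *[of j i] assms by (metis linorder_neqE_nat)
qed

lemma eigenval_nonzero [simp]: "eigenval n \<mu> i \<noteq> 0"
  by (simp add: eigenval_eq)

lemma eigenval_eq_imp: "eigenval n \<mu> i = eigenval m \<nu> j \<Longrightarrow> \<mu> i = \<nu> j"
  by (simp add: eigenval_eq)

lemma composition_eqI:
  assumes "composition n \<mu>" "composition n \<nu>" "\<And>i. i \<in> {1..n} \<Longrightarrow> eigenval n \<mu> i = eigenval n \<nu> i"
  shows "\<mu> = \<nu>"
proof
  fix i show "\<mu> i = \<nu> i"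
    using assms eigenval_eq_imp[of n \<mu> i n \<nu> i] by (cases "i \<in> {1..n}") (auto simp: composition_def)
qed

section \<open>The constants d' and the self-values\<close>

definition lleg :: "nat \<Rightarrow> nat \<Rightarrow> nat \<Rightarrow> nat \<Rightarrow> nat \<Rightarrow> nat" where
  "lleg i v j k x = (if i < k \<and> j \<le> x \<and> x \<le> v \<or> k < i \<and> j \<le> x + 1 \<and> x + 1 \<le> v then 1 else 0)"

text \<open>The length \<open>v\<close> is kept apart from the entry at i, so that a row can be
  compared with itself after it has moved to another place.\<close>

definition row :: "nat \<Rightarrow> (nat \<Rightarrow> nat) \<Rightarrow> nat \<Rightarrow> nat \<Rightarrow> qtfield" where
  "row n \<eta> i v = (\<Prod>j=1..v. 1 - inverse qq ^ (v - j + 1) * inverse tt ^ (\<Sum>k=1..n. lleg i v j k (\<eta> k)))"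

lemma leg_eq: "leg n \<eta> i j = (\<Sum>k=1..n. lleg i (\<eta> i) j k (\<eta> k))"
proof -
  have "(\<Sum>k=1..n. lleg i (\<eta> i) j k (\<eta> k)) =
    (\<Sum>k=1..n. (if i < k \<and> j \<le> \<eta> k \<and> \<eta> k \<le> \<eta> i then 1 else 0) + (if k < i \<and> j \<le> \<eta> k + 1 \<and> \<eta> k + 1 \<le> \<eta> i then 1 else 0))"
    by (intro sum.cong) (auto simp: lleg_def)
  also have "\<dots> = card ({1..n} \<inter> {k. i < k \<and> j \<le> \<eta> k \<and> \<eta> k \<le> \<eta> i}) + card ({1..n} \<inter> {k. k < i \<and> j \<le> \<eta> k + 1 \<and> \<eta> k + 1 \<le> \<eta> i})"
    by (simp add: sum.distrib sum.If_cases)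
  also have "\<dots> = leg n \<eta> i j"
    unfolding leg_def by (intro arg_cong2[where f = "(+)"] arg_cong[where f = card]) auto
  finally show ?thesis ..
qed

abbreviation d_inv :: "nat \<Rightarrow> (nat \<Rightarrow> nat) \<Rightarrow> qtfield" where
  "d_inv n \<eta> \<equiv> d' n \<eta> (inverse qq) (inverse tt)"

lemma d_inv_eq: "d_inv n \<eta> = (\<Prod>i=1..n. row n \<eta> i (\<eta> i))"
  by (simp add: d'_def row_def leg_eq)

lemma qq_tt_inverse_neq_1: "a \<noteq> 0 \<Longrightarrow> inverse qq ^ a * inverse tt ^ l \<noteq> 1"
  using qq_tt_power_eq_iff[of a l 0 0] by (auto simp: field_simps simp del: qq_tt_power_eq_iff)

lemma d_inv_nonzero: "d_inv n \<eta> \<noteq> 0"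
proof -
  have "1 - inverse qq ^ (v - j + 1) * inverse tt ^ l \<noteq> 0" for v j l
    unfolding right_minus_eq by (rule qq_tt_inverse_neq_1[THEN not_sym]) simp
  then show ?thesis unfolding d_inv_eq row_def by (simp only: prod_zero_iff finite_atLeastAtMost) blast
qed

text \<open>All rows but the first only change place. The first row moves to the end and gains a
  first box, its old boxes moving one column to the right. The new box has arm
  \<open>\<eta> 1\<close>, and its leg counts the other places that \<open>leg'\<close> at 1 does
  not count.\<close>

lemma d_inv_up:
  assumes n: "n \<ge> 1"
  shows "d_inv n (up n \<eta>) = d_inv n \<eta> * (1 - inverse qq ^ (\<eta> 1 + 1) * inverse tt ^ (n - 1 - leg' n \<eta> 1))"
proof -
  have 1: "row n (up n \<eta>) (i - 1) (\<eta> i) = row n \<eta> i (\<eta> i)" if "i \<in> {2..n}" for i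
  proof -
    have "(\<Sum>k=1..n. lleg (i - 1) (\<eta> i) j k (up n \<eta> k)) = (\<Sum>k=1..n. lleg i (\<eta> i) j k (\<eta> k))" for j
    proof -
      have "(\<Sum>k=1..n. lleg (i - 1) (\<eta> i) j k (up n \<eta> k))
         = (\<Sum>k=2..n. lleg (i - 1) (\<eta> i) j (k - 1) (\<eta> k)) + lleg (i - 1) (\<eta> i) j n (\<eta> 1 + 1)"
        by (rule sum.up[OF n])
      also have "(\<Sum>k=2..n. lleg (i - 1) (\<eta> i) j (k - 1) (\<eta> k)) = (\<Sum>k=2..n. lleg i (\<eta> i) j k (\<eta> k))"
        using that by (intro sum.cong) (auto simp: lleg_def)
      also have "lleg (i - 1) (\<eta> i) j n (\<eta> 1 + 1) = lleg i (\<eta> i) j 1 (\<eta> 1)"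
        using that by (auto simp: lleg_def)
      finally show ?thesis by (simp only: sum.from_1[OF n])
    qed
    then show ?thesis by (simp add: row_def)
  qed
  have 2: "(\<Sum>k=1..n. lleg n (\<eta> 1 + 1) (Suc j) k (up n \<eta> k)) = (\<Sum>k=1..n. lleg 1 (\<eta> 1) j k (\<eta> k))" for j
  proof -
    have "(\<Sum>k=1..n. lleg n (\<eta> 1 + 1) (Suc j) k (up n \<eta> k))
       = (\<Sum>k=2..n. lleg n (\<eta> 1 + 1) (Suc j) (k - 1) (\<eta> k)) + lleg n (\<eta> 1 + 1) (Suc j) n (\<eta> 1 + 1)"
      by (rule sum.up[OF n])
    also have "(\<Sum>k=2..n. lleg n (\<eta> 1 + 1) (Suc j) (k - 1) (\<eta> k)) = (\<Sum>k=2..n. lleg 1 (\<eta> 1) j k (\<eta> k))"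
      by (intro sum.cong) (auto simp: lleg_def)
    also have "lleg n (\<eta> 1 + 1) (Suc j) n (\<eta> 1 + 1) = lleg 1 (\<eta> 1) j 1 (\<eta> 1)"
      by (auto simp: lleg_def)
    finally show ?thesis by (simp only: sum.from_1[OF n])
  qed
  have 3: "(\<Sum>k=1..n. lleg n (\<eta> 1 + 1) 1 k (up n \<eta> k)) = n - 1 - leg' n \<eta> 1"
  proof -
    have "(\<Sum>k=1..n. lleg n (\<eta> 1 + 1) 1 k (up n \<eta> k))
       = (\<Sum>k=2..n. lleg n (\<eta> 1 + 1) 1 (k - 1) (\<eta> k)) + lleg n (\<eta> 1 + 1) 1 n (\<eta> 1 + 1)"
      by (rule sum.up[OF n])
    also have "lleg n (\<eta> 1 + 1) 1 n (\<eta> 1 + 1) = 0" by (simp add: lleg_def)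
    finally have "(\<Sum>k=1..n. lleg n (\<eta> 1 + 1) 1 k (up n \<eta> k)) + leg' n \<eta> 1
        = (\<Sum>k=2..n. lleg n (\<eta> 1 + 1) 1 (k - 1) (\<eta> k) + above 1 (\<eta> 1) k (\<eta> k)) + above 1 (\<eta> 1) 1 (\<eta> 1)"
      unfolding leg'_eq sum.from_1[OF n] by (simp add: sum.distrib)
    also have "(\<Sum>k=2..n. lleg n (\<eta> 1 + 1) 1 (k - 1) (\<eta> k) + above 1 (\<eta> 1) k (\<eta> k)) = (\<Sum>k=2..n. 1)"
      by (intro sum.cong) (auto simp: lleg_def above_def)
    finally show ?thesis by (simp add: above_def)
  qed
  have "row n (up n \<eta>) n (\<eta> 1 + 1) = (1 - inverse qq ^ (\<eta> 1 + 1) * inverse tt ^ (n - 1 - leg' n \<eta> 1)) * row n \<eta> 1 (\<eta> 1)"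
  proof -
    let ?f = "\<lambda>j. 1 - inverse qq ^ (\<eta> 1 + 1 - j + 1) * inverse tt ^ (\<Sum>k=1..n. lleg n (\<eta> 1 + 1) j k (up n \<eta> k))"
    have "row n (up n \<eta>) n (\<eta> 1 + 1) = (\<Prod>j=1..\<eta> 1 + 1. ?f j)" by (simp add: row_def)
    also have "\<dots> = ?f 1 * (\<Prod>j=2..\<eta> 1 + 1. ?f j)"
      by (simp add: prod.atLeast_Suc_atMost numeral_2_eq_2 del: prod.cl_ivl_Suc)
    also have "(\<Prod>j=2..\<eta> 1 + 1. ?f j) = (\<Prod>j=1..\<eta> 1. ?f (Suc j))"
      by (rule prod.reindex_bij_witness[of _ Suc "\<lambda>j. j - 1"]) auto
    also have "\<dots> = row n \<eta> 1 (\<eta> 1)"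
      unfolding 2 row_def by (intro prod.cong) auto
    finally show ?thesis unfolding 3 by simp
  qed
  moreover have "(\<Prod>j=2..n. row n (up n \<eta>) (j - 1) (\<eta> j)) = (\<Prod>j=2..n. row n \<eta> j (\<eta> j))"
    by (rule prod.cong) (use 1 in auto)
  ultimately have "d_inv n (up n \<eta>) = (\<Prod>j=2..n. row n \<eta> j (\<eta> j)) *
     ((1 - inverse qq ^ (\<eta> 1 + 1) * inverse tt ^ (n - 1 - leg' n \<eta> 1)) * row n \<eta> 1 (\<eta> 1))"
    unfolding d_inv_eq prod.up[OF n] by simp
  then show ?thesis unfolding d_inv_eq prod.from_1[OF n] by (simp only: mult_ac)
qed

text \<open>Exactly one box changes its leg: the one in the row of the larger entry, in the column
  just beyond the smaller entry. Its leg is the difference of the two values of \<open>leg'\<close>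
  and drops by one.\<close>

lemma d_inv_swap:
  assumes i: "i \<in> {1..<n}" and asc: "\<eta> i < \<eta> (Suc i)"
  defines "l \<equiv> leg' n \<eta> i - leg' n \<eta> (Suc i)"
  shows "l \<ge> 1" and "leg' n \<eta> (Suc i) \<le> leg' n \<eta> i"
    and "d_inv n (\<eta> \<circ> transpose i (Suc i)) * (1 - inverse qq ^ (\<eta> (Suc i) - \<eta> i) * inverse tt ^ l)
     = d_inv n \<eta> * (1 - inverse qq ^ (\<eta> (Suc i) - \<eta> i) * inverse tt ^ (l - 1))"
proof -
  let ?t = "transpose i (Suc i)"
  let ?L = "\<lambda>r j. \<Sum>k=1..n. lleg r (\<eta> r) j k (\<eta> k)"
  let ?M = "\<lambda>r j. \<Sum>k=1..n. lleg (?t r) (\<eta> r) j k (\<eta> (?t k))"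
  have M: "?M r j = (\<Sum>k=1..n. lleg (?t r) (\<eta> r) j (?t k) (\<eta> k))" for r j
    using sum_transpose[OF i, of "\<lambda>k. lleg (?t r) (\<eta> r) j k (\<eta> (?t k))"] by simp
  have other: "?M r j = ?L r j" if "r \<noteq> Suc i" for r j
    unfolding M using asc that
    by (intro sum.cong) (auto simp: lleg_def transpose_def)
  have row1: "?L (Suc i) j = ?M (Suc i) j + (if j = \<eta> i + 1 then 1 else 0)" for j
  proof -
    have "(\<Sum>k\<in>{1..n} - {i, Suc i}. lleg (Suc i) (\<eta> (Suc i)) j k (\<eta> k))
      = (\<Sum>k\<in>{1..n} - {i, Suc i}. lleg (?t (Suc i)) (\<eta> (Suc i)) j (?t k) (\<eta> k))"
      by (intro sum.cong) (auto simp: lleg_def transpose_def)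
    then show ?thesis
      unfolding M sum_split_pair[OF i] using asc by (auto simp: lleg_def)
  qed
  have legs: "?L (Suc i) (\<eta> i + 1) + leg' n \<eta> (Suc i) = leg' n \<eta> i"
  proof -
    have "(\<Sum>k\<in>{1..n} - {i, Suc i}. lleg (Suc i) (\<eta> (Suc i)) (\<eta> i + 1) k (\<eta> k))
        + (\<Sum>k\<in>{1..n} - {i, Suc i}. above (Suc i) (\<eta> (Suc i)) k (\<eta> k))
        = (\<Sum>k\<in>{1..n} - {i, Suc i}. above i (\<eta> i) k (\<eta> k))"
      unfolding sum.distrib[symmetric] using asc by (intro sum.cong) (auto simp: lleg_def above_def)
    then show ?thesis
      unfolding leg'_eq sum_split_pair[OF i] using asc by (auto simp: lleg_def above_def)
  qed
  then show le: "leg' n \<eta> (Suc i) \<le> leg' n \<eta> i" by simp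
  have l: "?L (Suc i) (\<eta> i + 1) = l" using legs by (simp add: l_def)
  then have l': "?M (Suc i) (\<eta> i + 1) = l - 1" and l1: "l \<ge> 1" using row1[of "\<eta> i + 1"] by auto
  show "l \<ge> 1" by (rule l1)
  have rows: "row n (\<eta> \<circ> ?t) (?t r) (\<eta> r) = row n \<eta> r (\<eta> r)" if "r \<noteq> Suc i" for r
    using other[OF that] by (simp add: row_def)
  let ?f = "\<lambda>L j. 1 - inverse qq ^ (\<eta> (Suc i) - j + 1) * inverse tt ^ (L j)"
  have row2: "row n (\<eta> \<circ> ?t) i (\<eta> (Suc i)) * ?f (?L (Suc i)) (\<eta> i + 1)
    = row n \<eta> (Suc i) (\<eta> (Suc i)) * ?f (?M (Suc i)) (\<eta> i + 1)"
  proof -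
    have mem: "\<eta> i + 1 \<in> {1..\<eta> (Suc i)}" using asc by auto
    have a: "row n (\<eta> \<circ> ?t) i (\<eta> (Suc i)) = (\<Prod>j=1..\<eta> (Suc i). ?f (?M (Suc i)) j)"
      by (simp add: row_def)
    have b: "row n \<eta> (Suc i) (\<eta> (Suc i)) = (\<Prod>j=1..\<eta> (Suc i). ?f (?L (Suc i)) j)"
      by (simp add: row_def)
    have "(\<Prod>j\<in>{1..\<eta> (Suc i)} - {\<eta> i + 1}. ?f (?M (Suc i)) j) = (\<Prod>j\<in>{1..\<eta> (Suc i)} - {\<eta> i + 1}. ?f (?L (Suc i)) j)"
    proof (intro prod.cong refl)
      fix j assume "j \<in> {1..\<eta> (Suc i)} - {\<eta> i + 1}"
      then have "?L (Suc i) j = ?M (Suc i) j" using row1[of j] by simp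
      then show "?f (?M (Suc i)) j = ?f (?L (Suc i)) j" by (simp only:)
    qed
    then show ?thesis
      unfolding a b prod.remove[OF finite_atLeastAtMost mem] by (simp only: mult_ac)
  qed
  have P: "d_inv n (\<eta> \<circ> ?t) = (\<Prod>r=1..n. row n (\<eta> \<circ> ?t) (?t r) (\<eta> r))"
    using prod_transpose[OF i, of "\<lambda>r. row n (\<eta> \<circ> ?t) r (\<eta> (?t r))"] by (simp add: d_inv_eq)
  have Si: "Suc i \<in> {1..n}" using i by auto
  have Q: "(\<Prod>r\<in>{1..n} - {Suc i}. row n (\<eta> \<circ> ?t) (?t r) (\<eta> r)) = (\<Prod>r\<in>{1..n} - {Suc i}. row n \<eta> r (\<eta> r))"
    by (intro prod.cong) (use rows in auto)
  have e: "\<eta> (Suc i) - (\<eta> i + 1) + 1 = \<eta> (Suc i) - \<eta> i" using asc by simp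
  have "d_inv n (\<eta> \<circ> ?t) * ?f (?L (Suc i)) (\<eta> i + 1) = d_inv n \<eta> * ?f (?M (Suc i)) (\<eta> i + 1)"
    unfolding P d_inv_eq[of n \<eta>] prod.remove[OF finite_atLeastAtMost Si] Q
    using row2 by (simp add: mult_ac del: One_nat_def)
  then show "d_inv n (\<eta> \<circ> transpose i (Suc i)) * (1 - inverse qq ^ (\<eta> (Suc i) - \<eta> i) * inverse tt ^ l)
     = d_inv n \<eta> * (1 - inverse qq ^ (\<eta> (Suc i) - \<eta> i) * inverse tt ^ (l - 1))"
    unfolding e l l' .
qed

text \<open>The value of the interpolation polynomial of \<open>\<eta>\<close> at its own spectral point.\<close>

definition self_val :: "nat \<Rightarrow> (nat \<Rightarrow> nat) \<Rightarrow> qtfield" where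
  "self_val n \<eta> = d_inv n \<eta> * (\<Prod>i=1..n. eigenval n \<eta> i ^ \<eta> i)"

lemma self_val_nonzero: "self_val n \<eta> \<noteq> 0"
  by (simp add: self_val_def d_inv_nonzero)

text \<open>The factor is the one in \<open>val_phi_up\<close>, up to the power of q that keeps the
  leading coefficient 1; likewise \<open>self_val_swap\<close> matches \<open>val_hecke\<close>.
  With the value 1 at the zero composition, these two recursions dictate the closed form of
  \<open>self_val\<close>.\<close>

lemma self_val_up:
  assumes n: "n \<ge> 1"
  shows "self_val n (up n \<eta>) = qq ^ \<eta> 1 * (qq * eigenval n \<eta> 1 - tt powi (1 - int n)) * self_val n \<eta>"
proof -
  have "(\<Prod>j=1..n. eigenval n (up n \<eta>) j ^ up n \<eta> j)
     = (\<Prod>j=2..n. eigenval n (up n \<eta>) (j - 1) ^ \<eta> j) * eigenval n (up n \<eta>) n ^ (\<eta> 1 + 1)"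
    by (rule prod.up[OF n])
  also have "(\<Prod>j=2..n. eigenval n (up n \<eta>) (j - 1) ^ \<eta> j) = (\<Prod>j=2..n. eigenval n \<eta> j ^ \<eta> j)"
    by (intro prod.cong refl) (subst eigenval_up, auto)
  finally have P: "(\<Prod>j=1..n. eigenval n (up n \<eta>) j ^ up n \<eta> j)
      = (\<Prod>j=1..n. eigenval n \<eta> j ^ \<eta> j) * (qq ^ (\<eta> 1 + 1) * eigenval n \<eta> 1)"
    unfolding eigenval_up_top[OF n] prod.from_1[OF n] by (simp add: power_mult_distrib mult_ac)
  have leg: "leg' n \<eta> 1 \<le> n - 1"
  proof -
    have "(\<Sum>k=2..n. above 1 (\<eta> 1) k (\<eta> k)) \<le> (\<Sum>k=2..n. 1)"
      by (intro sum_mono) (auto simp: above_def)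
    then show ?thesis unfolding leg'_eq sum.from_1[OF n] by (simp add: above_def)
  qed
  define l where "l = leg' n \<eta> 1"
  have pw: "tt powi (1 - int n) * (tt ^ (n - 1 - l) * tt ^ l) = 1"
  proof -
    have "tt ^ (n - 1 - l) * tt ^ l = tt powi (int n - 1)"
      using leg n by (simp add: l_def power_int_def nat_diff_distrib flip: power_add)
    then show ?thesis by (simp flip: power_int_add)
  qed
  have sp: "eigenval n \<eta> 1 * tt ^ l = qq ^ \<eta> 1"
    by (simp add: eigenval_eq l_def spec_mult)
  \<comment> \<open>The new factor of \<open>d_inv\<close> times the new factor of the product of
    coordinates.\<close>
  have "(1 - inverse qq ^ (\<eta> 1 + 1) * inverse tt ^ (n - 1 - l)) * (qq ^ (\<eta> 1 + 1) * eigenval n \<eta> 1)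
     = qq ^ \<eta> 1 * (qq * eigenval n \<eta> 1 - tt powi (1 - int n))"
  proof -
    have B: "inverse tt ^ (n - 1 - l) = tt powi (1 - int n) * tt ^ l"
      using pw by (simp add: field_simps)
    have "qq ^ (\<eta> 1 + 1) - inverse tt ^ (n - 1 - l) = (qq * eigenval n \<eta> 1 - tt powi (1 - int n)) * tt ^ l"
      unfolding B using sp by (simp add: algebra_simps)
    then have "(qq ^ (\<eta> 1 + 1) - inverse tt ^ (n - 1 - l)) * eigenval n \<eta> 1 * tt ^ l
       = (eigenval n \<eta> 1 * tt ^ l) * (qq * eigenval n \<eta> 1 - tt powi (1 - int n)) * tt ^ l"
      by (simp only: mult_ac)
    then have "(qq ^ (\<eta> 1 + 1) - inverse tt ^ (n - 1 - l)) * eigenval n \<eta> 1 * tt ^ l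
       = qq ^ \<eta> 1 * (qq * eigenval n \<eta> 1 - tt powi (1 - int n)) * tt ^ l"
      unfolding sp .
    then have *: "(qq ^ (\<eta> 1 + 1) - inverse tt ^ (n - 1 - l)) * eigenval n \<eta> 1
       = qq ^ \<eta> 1 * (qq * eigenval n \<eta> 1 - tt powi (1 - int n))"
      by (metis mult_right_cancel power_not_zero tt_nonzero)
    have "(1 - inverse qq ^ k * B) * (qq ^ k * e) = (qq ^ k - B) * e" for k B e
      by (simp add: algebra_simps) (simp flip: power_mult_distrib)
    then show ?thesis by (simp only: *)
  qed
  then show ?thesis
    unfolding self_val_def P d_inv_up[OF n] l_def by (simp add: mult_ac)
qed

lemma self_val_swap:
  assumes i: "i \<in> {1..<n}" and asc: "\<eta> i < \<eta> (Suc i)"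
  shows "self_val n (\<eta> \<circ> transpose i (Suc i)) = bhat (eigenval n \<eta> (Suc i)) (eigenval n \<eta> i) * self_val n \<eta>"
proof -
  let ?t = "transpose i (Suc i)"
  define l where "l = leg' n \<eta> i - leg' n \<eta> (Suc i)"
  define \<delta> where "\<delta> = \<eta> (Suc i) - \<eta> i"
  note D = d_inv_swap[OF i asc, folded l_def \<delta>_def]
  have P: "(\<Prod>j=1..n. eigenval n (\<eta> \<circ> ?t) j ^ (\<eta> \<circ> ?t) j) = (\<Prod>j=1..n. eigenval n \<eta> j ^ \<eta> j)"
    using prod_transpose[OF i, of "\<lambda>j. eigenval n \<eta> j ^ \<eta> j"] asc
    by (simp add: eigenval_swap[OF i])
  define x y where "x = eigenval n \<eta> (Suc i)" and "y = eigenval n \<eta> i"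
  have xy: "x \<noteq> 0" "y \<noteq> 0" "x - y \<noteq> 0"
    using asc eigenval_eq_imp[of n \<eta> "Suc i" n \<eta> i] by (auto simp: x_def y_def)
  \<comment> \<open>The monomial of the exceptional box in \<open>d_inv_swap\<close> is the quotient
    of the two coordinates, so the quotient of the box factors becomes \<open>bhat\<close>.\<close>
  have y: "y = x * (inverse qq ^ \<delta> * inverse tt ^ l)"
  proof -
    have "y * (qq ^ \<delta> * tt ^ l) * tt ^ leg' n \<eta> (Suc i) = y * tt ^ leg' n \<eta> i * qq ^ \<delta>"
      using D(2) by (simp add: l_def mult_ac flip: power_add)
    also have "\<dots> = qq ^ \<eta> (Suc i)"
      using asc by (simp add: y_def eigenval_eq spec_mult \<delta>_def flip: power_add)
    also have "\<dots> = x * tt ^ leg' n \<eta> (Suc i)" by (simp add: x_def eigenval_eq spec_mult)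
    finally show ?thesis by (simp add: field_simps)
  qed
  have ty: "tt * y = x * (inverse qq ^ \<delta> * inverse tt ^ (l - 1))"
    unfolding y using D(1) by (cases l) (simp_all add: field_simps)
  have "x * d_inv n (\<eta> \<circ> ?t) * (1 - inverse qq ^ \<delta> * inverse tt ^ l) = x * d_inv n \<eta> * (1 - inverse qq ^ \<delta> * inverse tt ^ (l - 1))"
    using D(3) by simp
  moreover have "x - y = x * (1 - inverse qq ^ \<delta> * inverse tt ^ l)"
    by (subst y) (simp add: algebra_simps)
  moreover have "x - tt * y = x * (1 - inverse qq ^ \<delta> * inverse tt ^ (l - 1))"
    by (subst ty) (simp add: algebra_simps)
  ultimately have "d_inv n (\<eta> \<circ> ?t) * (x - y) = d_inv n \<eta> * (x - tt * y)"
    by (simp only: mult_ac)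
  then have "d_inv n (\<eta> \<circ> ?t) = bhat x y * d_inv n \<eta>"
    using xy by (simp add: bhat_def field_simps)
  then show ?thesis unfolding self_val_def P x_def y_def by simp
qed

section \<open>Interpolation polynomials\<close>

definition val :: "nat \<Rightarrow> zpoly \<Rightarrow> (nat \<Rightarrow> nat) \<Rightarrow> qtfield" where
  "val n f \<mu> = K.ev (eigenval n \<mu>) f"

lemma val_simps: "val n (f + g) \<mu> = val n f \<mu> + val n g \<mu>" "val n (f - g) \<mu> = val n f \<mu> - val n g \<mu>"
  "val n (f * g) \<mu> = val n f \<mu> * val n g \<mu>" "val n (Const c) \<mu> = c" "val n (zvar i) \<mu> = eigenval n \<mu> i"
  "val n (sum h A) \<mu> = (\<Sum>a\<in>A. val n (h a) \<mu>)"
  by (simp_all add: val_def K.ev_add K.ev_diff K.ev_mult K.ev_sum)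

lemma ahat_bhat_cases:
  assumes "(x - y) * e = (tt - 1) * x * a + (x - tt * y) * b" "x \<noteq> y"
  shows "e = ahat x y * a + bhat x y * b"
proof -
  have "e = ((tt - 1) * x * a + (x - tt * y) * b) / (x - y)"
    using assms by (simp add: eq_divide_eq mult.commute)
  then show ?thesis by (simp add: ahat_def bhat_def add_divide_distrib)
qed

lemma bhat_eigenval_equal:
  assumes "i \<in> {1..<n}" "\<mu> i = \<mu> (Suc i)"
  shows "bhat (eigenval n \<mu> i) (eigenval n \<mu> (Suc i)) = 0"
  using eigenval_equal[OF assms] by (simp add: bhat_def)

text \<open>For unequal entries the swapped coordinates form the spectral point of the swapped
  composition. For equal ones they do not, but then their coefficient \<open>bhat\<close> is
  zero.\<close>

lemma val_hecke:
  assumes i: "i \<in> {1..<n}"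
  shows "val n (hecke i f) \<mu> = ahat (eigenval n \<mu> i) (eigenval n \<mu> (Suc i)) * val n f \<mu>
    + bhat (eigenval n \<mu> i) (eigenval n \<mu> (Suc i)) * val n f (\<mu> \<circ> transpose i (Suc i))"
proof -
  let ?x = "eigenval n \<mu>"
  have ne: "?x i \<noteq> ?x (Suc i)" using eigenval_inj[of i n "Suc i" \<mu>] i by auto
  have e: "val n (hecke i f) \<mu> = ahat (?x i) (?x (Suc i)) * val n f \<mu>
     + bhat (?x i) (?x (Suc i)) * K.ev (?x \<circ> transpose i (Suc i)) f"
    unfolding val_def by (rule ahat_bhat_cases[OF K.ev_hecke ne])
  show ?thesis
  proof (cases "\<mu> i = \<mu> (Suc i)")
    case True
    then show ?thesis using e bhat_eigenval_equal[OF i True] by simp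
  next
    case False
    then have "eigenval n (\<mu> \<circ> transpose i (Suc i)) = ?x \<circ> transpose i (Suc i)"
      using eigenval_swap[OF i False] by auto
    then show ?thesis using e by (simp add: val_def)
  qed
qed

lemma ev_graded_cong:
  assumes "f \<in> graded n S" "\<And>i. i \<in> {1..n} \<Longrightarrow> x i = y i"
  shows "K.ev x f = K.ev y f"
proof (rule K.ev_cong)
  fix m i assume "m \<in> supp f" "i \<in> supp m"
  then have "i \<in> {1..n}" using assms(1) by (auto simp only: graded_def)
  then show "x i = y i" by (rule assms(2))
qed

text \<open>The raising operator of Knop and Sahi. At points in the image of \<open>up\<close> its
  values come from smaller weight; at all other spectral points the last entry is 0 and the first
  factor vanishes.\<close>

definition phi :: "nat \<Rightarrow> zpoly \<Rightarrow> zpoly" where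
  "phi n f = (zvar n - Const (tt powi (1 - int n))) * cyc n f"

lemma val_cyc:
  assumes n: "n \<ge> 1" and f: "f \<in> graded n S"
  shows "val n (cyc n f) (up n \<mu>) = val n f \<mu>"
  unfolding val_def K.ev_cyc
proof (rule ev_graded_cong[OF f])
  fix j assume j: "j \<in> {1..n}"
  have "eigenval n (up n \<mu>) (j - 1) = eigenval n \<mu> j" if "j \<noteq> 1"
  proof -
    have "j - 1 \<in> {1..<n}" using that j by auto
    from eigenval_up[OF this, of \<mu>] show ?thesis using that j by simp
  qed
  then show "(if j = 1 then inverse qq * eigenval n (up n \<mu>) n
      else if j \<in> {2..n} then eigenval n (up n \<mu>) (j - 1) else eigenval n (up n \<mu>) j) = eigenval n \<mu> j"
    using eigenval_up_top[OF n, of \<mu>] j by auto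
qed

lemma val_phi_up:
  assumes "n \<ge> 1" "f \<in> graded n S"
  shows "val n (phi n f) (up n \<mu>) = (qq * eigenval n \<mu> 1 - tt powi (1 - int n)) * val n f \<mu>"
  unfolding phi_def val_simps val_cyc[OF assms] eigenval_up_top[OF assms(1)] ..

lemma val_phi_0:
  assumes "n \<ge> 1" "\<mu> n = 0"
  shows "val n (phi n f) \<mu> = 0"
  unfolding phi_def val_simps eigenval_last_zero[of n \<mu>, OF assms] by simp

definition down :: "nat \<Rightarrow> (nat \<Rightarrow> nat) \<Rightarrow> nat \<Rightarrow> nat" where
  "down n \<mu> j = (if j = 1 then \<mu> n - 1 else if j \<in> {2..n} then \<mu> (j - 1) else 0)"

lemma up_down: "n \<ge> 1 \<Longrightarrow> composition n \<mu> \<Longrightarrow> \<mu> n > 0 \<Longrightarrow> up n (down n \<mu>) = \<mu>"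
  by (rule ext) (auto simp: up_def down_def composition_def)

lemma composition_down: "n \<ge> 1 \<Longrightarrow> composition n (down n \<mu>)"
  by (auto simp: composition_def down_def)

lemma weight_down: "n \<ge> 1 \<Longrightarrow> composition n \<mu> \<Longrightarrow> \<mu> n > 0 \<Longrightarrow> weight n \<mu> = Suc (weight n (down n \<mu>))"
  using weight_up[of n "down n \<mu>"] up_down[of n \<mu>] by simp

lemma up_inj:
  assumes "composition n \<mu>" "composition n \<nu>" "n \<ge> 1" "up n \<mu> = up n \<nu>"
  shows "\<mu> = \<nu>"
proof
  fix j show "\<mu> j = \<nu> j"
  proof (cases "j \<in> {1..n}")
    case True
    then show ?thesis
      using fun_cong[OF assms(4), of "if j = 1 then n else j - 1"] by (auto simp: up_def split: if_splits)
  qed (use assms in \<open>auto simp: composition_def\<close>)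
qed

lemma composition_swap: "i \<in> {1..<n} \<Longrightarrow> composition n \<mu> \<Longrightarrow> composition n (\<mu> \<circ> transpose i (Suc i))"
  by (auto simp: composition_def transpose_def)

lemma weight_swap: "i \<in> {1..<n} \<Longrightarrow> weight n (\<mu> \<circ> transpose i (Suc i)) = weight n \<mu>"
  by (rule weight_spread[OF _ spread_swap])

text \<open>\<open>F\<close> is the interpolation polynomial and \<open>G\<close> its top component.
  \<open>G\<close> is carried along because the recursion transforms both in parallel, while the
  leading coefficient and triangularity concern \<open>G\<close> alone.\<close>

definition interp :: "nat \<Rightarrow> (nat \<Rightarrow> nat) \<Rightarrow> zpoly \<Rightarrow> zpoly \<Rightarrow> bool" where
  "interp n \<eta> F G \<longleftrightarrow> G \<in> graded n {weight n \<eta>} \<and> F - G \<in> graded n {..<weight n \<eta>} \<and>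
     (\<forall>\<mu>. composition n \<mu> \<longrightarrow> weight n \<mu> \<le> weight n \<eta> \<longrightarrow> val n F \<mu> = (if \<mu> = \<eta> then self_val n \<eta> else 0)) \<and>
     coef G (expo n \<eta>) = 1 \<and> (\<forall>m\<in>supp G. bruhat_le n (coef m) \<eta>)"

lemma interp_graded: "interp n \<eta> F G \<Longrightarrow> F \<in> graded n {..weight n \<eta>}"
  using graded_add[of "F - G" n "{..weight n \<eta>}" G]
    graded_mono[of "F - G" n "{..<weight n \<eta>}" "{..weight n \<eta>}"]
    graded_mono[of G n "{weight n \<eta>}" "{..weight n \<eta>}"]
  unfolding interp_def by (simp add: subset_iff)

lemma interp_zero: "interp n (\<lambda>_. 0) 1 1"
proof -
  have "\<mu> = (\<lambda>_. 0)" if "composition n \<mu>" "weight n \<mu> = 0" for \<mu>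
  proof
    fix i show "\<mu> i = 0"
      using that by (cases "i \<in> {1..n}") (auto simp: composition_def weight_def)
  qed
  moreover have "self_val n (\<lambda>_. 0) = 1" by (simp add: self_val_def d'_def)
  moreover have "expo n (\<lambda>_. 0) = 0" by (simp add: expo_def)
  moreover have "weight n (\<lambda>_. 0) = 0" by (simp add: weight_def)
  moreover have "(1 :: zpoly) \<in> graded n {0}" using graded_Const[of 1 n] by simp
  moreover have "supp (1 :: zpoly) = {0}" by simp
  moreover have "coef (0 :: nat \<Rightarrow>\<^sub>0 nat) = (\<lambda>_. 0)" by auto
  ultimately show ?thesis
    unfolding interp_def using val_simps(4)[of n 1] by (auto simp: lookup_one)
qed

lemma expo_inj: "composition n \<mu> \<Longrightarrow> composition n \<nu> \<Longrightarrow> expo n \<mu> = expo n \<nu> \<Longrightarrow> \<mu> = \<nu>"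
  by (metis coef_expo_composition)

lemma zvar_cyc_eq_sum:
  assumes "n \<ge> 1" "f \<in> graded n S"
  shows "zvar n * cyc n f = (\<Sum>m\<in>supp f. monom_z (expo n (up n (coef m))) (coef f m * inverse qq ^ coef m 1))"
proof -
  have "zvar n * cyc n f = (\<Sum>m\<in>supp f. zvar n * cyc n (monom_z m (coef f m)))"
    by (subst poly_mapping_sum_singles[of f]) (simp only: cyc_sum sum_distrib_left)
  also have "\<dots> = (\<Sum>m\<in>supp f. monom_z (expo n (up n (coef m))) (coef f m * inverse qq ^ coef m 1))"
    using assms by (intro sum.cong refl cyc_monom) (auto simp: graded_def)
  finally show ?thesis .
qed

lemma supp_zvar_cyc:
  assumes "n \<ge> 1" "f \<in> graded n S" "k \<in> supp (zvar n * cyc n f)"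
  obtains m where "m \<in> supp f" "coef k = up n (coef m)"
proof -
  obtain m where "m \<in> supp f" "k \<in> supp (monom_z (expo n (up n (coef m))) (coef f m * inverse qq ^ coef m 1))"
    using assms(3) keys_sum unfolding zvar_cyc_eq_sum[OF assms(1,2)] by fastforce
  then show thesis
    using that[of m] composition_up[OF assms(1)] by (auto split: if_splits)
qed

lemma coef_zvar_cyc:
  assumes n: "n \<ge> 1" and f: "f \<in> graded n S" and \<eta>: "composition n \<eta>"
  shows "coef (zvar n * cyc n f) (expo n (up n \<eta>)) = coef f (expo n \<eta>) * inverse qq ^ \<eta> 1"
proof -
  have "coef (zvar n * cyc n f) (expo n (up n \<eta>))
    = (\<Sum>m\<in>supp f. coef (monom_z (expo n (up n (coef m))) (coef f m * inverse qq ^ coef m 1)) (expo n (up n \<eta>)))"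
    unfolding zvar_cyc_eq_sum[OF n f] lookup_sum ..
  also have "\<dots> = (\<Sum>m\<in>supp f. if m = expo n \<eta> then coef f (expo n \<eta>) * inverse qq ^ \<eta> 1 else 0)"
  proof (rule sum.cong)
    fix m assume "m \<in> supp f"
    then have m: "supp m \<subseteq> {1..n}" using f by (auto simp: graded_def)
    then have c: "composition n (coef m)" by (rule composition_coef)
    show "coef (monom_z (expo n (up n (coef m))) (coef f m * inverse qq ^ coef m 1)) (expo n (up n \<eta>))
       = (if m = expo n \<eta> then coef f (expo n \<eta>) * inverse qq ^ \<eta> 1 else 0)"
    proof (cases "m = expo n \<eta>")
      case False
      then have "coef m \<noteq> \<eta>" using expo_coef[OF m] by auto
      then have "expo n (up n (coef m)) \<noteq> expo n (up n \<eta>)"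
        using expo_inj[OF composition_up[OF n] composition_up[OF n]] up_inj[OF c \<eta> n] by blast
      then show ?thesis using False by (simp add: lookup_single_not_eq)
    qed (use \<eta> in simp)
  qed simp
  also have "\<dots> = coef f (expo n \<eta>) * inverse qq ^ \<eta> 1" by (auto simp: in_keys_iff)
  finally show ?thesis .
qed

text \<open>A point of degree at most |\<eta>| + 1 either ends in 0, where \<open>phi\<close>
  vanishes, or is \<open>up\<close> of a point of degree at most |\<eta>|, where the values of
  \<open>F\<close> are known. The prefactor cancels the power of q from
  \<open>cyc_monom\<close>.\<close>

lemma interp_up:
  assumes n: "n \<ge> 1" and \<eta>: "composition n \<eta>" and I: "interp n \<eta> F G"
  shows "interp n (up n \<eta>) (Const (qq ^ \<eta> 1) * phi n F) (Const (qq ^ \<eta> 1) * (zvar n * cyc n G))"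
proof -
  let ?c = "Const (qq ^ \<eta> 1)" and ?d = "weight n \<eta>" and ?b = "tt powi (1 - int n)"
  have G: "G \<in> graded n {?d}" and FG: "F - G \<in> graded n {..<?d}" using I by (auto simp: interp_def)
  have F: "F \<in> graded n {..?d}" by (rule interp_graded[OF I])
  have zn: "zvar n \<in> graded n {1}" using n by (intro graded_zvar) auto
  have w: "weight n (up n \<eta>) = Suc ?d" using weight_up[OF n] by simp
  have 1: "?c * (zvar n * cyc n G) \<in> graded n {weight n (up n \<eta>)}"
    unfolding w by (intro graded_Const_mult graded_mult[OF zn graded_cyc[OF G n]]) auto
  have "?c * phi n F - ?c * (zvar n * cyc n G) = ?c * (zvar n * cyc n (F - G) - Const ?b * cyc n F)"
    unfolding phi_def cyc_diff by (simp add: algebra_simps)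
  moreover have "zvar n * cyc n (F - G) \<in> graded n {..<Suc ?d}"
    by (rule graded_mult[OF zn graded_cyc[OF FG n]]) auto
  moreover have "Const ?b * cyc n F \<in> graded n {..<Suc ?d}"
    using graded_Const_mult[OF graded_cyc[OF F n]] by (simp add: lessThan_Suc_atMost)
  ultimately have 2: "?c * phi n F - ?c * (zvar n * cyc n G) \<in> graded n {..<weight n (up n \<eta>)}"
    unfolding w by (simp only: graded_Const_mult graded_diff)
  have 3: "val n (?c * phi n F) \<mu> = (if \<mu> = up n \<eta> then self_val n (up n \<eta>) else 0)"
    if \<mu>: "composition n \<mu>" "weight n \<mu> \<le> weight n (up n \<eta>)" for \<mu>
  proof (cases "\<mu> n = 0")
    case True
    moreover have "up n \<eta> n \<noteq> 0" by (simp add: up_def)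
    ultimately show ?thesis using val_phi_0[OF n, of \<mu> F] by (auto simp: val_simps)
  next
    case False
    define \<kappa> where "\<kappa> = down n \<mu>"
    have \<mu>\<kappa>: "\<mu> = up n \<kappa>" using False up_down[OF n \<mu>(1)] by (simp add: \<kappa>_def)
    have \<kappa>: "composition n \<kappa>" "weight n \<kappa> \<le> ?d"
      using composition_down[OF n, of \<mu>] \<mu>(2) weight_up[OF n, of \<kappa>] w by (simp_all add: \<kappa>_def \<mu>\<kappa>[unfolded \<kappa>_def, symmetric])
    have eq: "\<mu> = up n \<eta> \<longleftrightarrow> \<kappa> = \<eta>" using up_inj[OF \<kappa>(1) \<eta> n] \<mu>\<kappa> by auto
    have "val n F \<kappa> = (if \<kappa> = \<eta> then self_val n \<eta> else 0)" using I \<kappa> by (simp add: interp_def)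
    then show ?thesis
      unfolding eq by (simp add: val_simps \<mu>\<kappa> val_phi_up[OF n F] self_val_up[OF n])
  qed
  have "qq ^ \<eta> 1 * inverse qq ^ \<eta> 1 = 1" by (simp flip: power_mult_distrib)
  then have 4: "coef (?c * (zvar n * cyc n G)) (expo n (up n \<eta>)) = 1"
    using I by (simp add: coef_Const_mult coef_zvar_cyc[OF n G \<eta>] interp_def)
  have 5: "bruhat_le n (coef m) (up n \<eta>)" if "m \<in> supp (?c * (zvar n * cyc n G))" for m
  proof -
    have "m \<in> supp (zvar n * cyc n G)" using that by (auto simp: in_keys_iff coef_Const_mult)
    then show ?thesis
      using I bruhat_le_up[OF n] by (elim supp_zvar_cyc[OF n G]) (auto simp: interp_def)
  qed
  show ?thesis unfolding interp_def using 1 2 3 4 5 by blast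
qed

text \<open>Subtracting \<open>a * F\<close> removes the value that \<open>hecke i F\<close> has at
  \<eta>. What remains sits at the swapped composition, with the factor \<open>bhat\<close> of
  \<open>self_val_swap\<close>. The ascent makes the swapped exponent the new leading one.\<close>

lemma interp_swap:
  assumes i: "i \<in> {1..<n}" and \<eta>: "composition n \<eta>" and asc: "\<eta> i < \<eta> (Suc i)" and I: "interp n \<eta> F G"
  defines "a \<equiv> Const (ahat (eigenval n \<eta> i) (eigenval n \<eta> (Suc i)))"
  shows "interp n (\<eta> \<circ> transpose i (Suc i)) (hecke i F - a * F) (hecke i G - a * G)"
proof -
  let ?t = "transpose i (Suc i)" and ?d = "weight n \<eta>"
  let ?\<eta> = "\<eta> \<circ> ?t"
  have G: "G \<in> graded n {?d}" and FG: "F - G \<in> graded n {..<?d}" using I by (auto simp: interp_def)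
  have w: "weight n ?\<eta> = ?d" by (rule weight_swap[OF i])
  have 1: "hecke i G - a * G \<in> graded n {weight n ?\<eta>}"
    unfolding w a_def by (intro graded_diff graded_hecke graded_Const_mult G i)
  have "(hecke i F - a * F) - (hecke i G - a * G) = hecke i (F - G) - a * (F - G)"
    unfolding hecke_diff by (simp add: algebra_simps)
  then have 2: "(hecke i F - a * F) - (hecke i G - a * G) \<in> graded n {..<weight n ?\<eta>}"
    unfolding w a_def by (simp only: graded_diff graded_hecke graded_Const_mult FG i)
  have ne: "?\<eta> \<noteq> \<eta>"
  proof
    assume "?\<eta> = \<eta>" from fun_cong[OF this, of i] show False using asc by simp
  qed
  have 3: "val n (hecke i F - a * F) \<mu> = (if \<mu> = ?\<eta> then self_val n ?\<eta> else 0)"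
    if \<mu>: "composition n \<mu>" "weight n \<mu> \<le> weight n ?\<eta>" for \<mu>
  proof -
    have v: "val n F \<nu> = (if \<nu> = \<eta> then self_val n \<eta> else 0)" if "composition n \<nu>" "weight n \<nu> \<le> ?d" for \<nu>
      using I that by (simp add: interp_def)
    have v1: "val n F \<mu> = (if \<mu> = \<eta> then self_val n \<eta> else 0)" using \<mu> w by (intro v) auto
    have v2: "val n F (\<mu> \<circ> ?t) = (if \<mu> \<circ> ?t = \<eta> then self_val n \<eta> else 0)"
      using \<mu> w composition_swap[OF i] weight_swap[OF i] by (intro v) auto
    have eq: "\<mu> \<circ> ?t = \<eta> \<longleftrightarrow> \<mu> = ?\<eta>" by (auto simp: comp_assoc)
    show ?thesis
    proof (cases "\<mu> = ?\<eta>")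
      case True
      have "eigenval n ?\<eta> i = eigenval n \<eta> (Suc i)" "eigenval n ?\<eta> (Suc i) = eigenval n \<eta> i"
        using eigenval_swap[OF i, of \<eta>] asc by simp_all
      then show ?thesis
        using True v1 v2 ne by (simp add: val_simps val_hecke[OF i] a_def self_val_swap[OF i asc] comp_assoc)
    next
      case False
      then show ?thesis
        using v1 v2 by (auto simp: val_simps val_hecke[OF i] a_def eq)
    qed
  qed
  have e: "expo n ?\<eta> = with_pair i (expo n \<eta>) (\<eta> (Suc i)) (\<eta> i)"
  proof (rule poly_mapping_eqI)
    fix k show "coef (expo n ?\<eta>) k = coef (with_pair i (expo n \<eta>) (\<eta> (Suc i)) (\<eta> i)) k"
      using i \<eta> composition_swap[OF i \<eta>] by (simp add: transpose_def)
  qed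
  \<comment> \<open>Hence the subtracted multiple of \<open>G\<close> does not touch the coefficient
    at the new leading exponent.\<close>
  have nle: "\<not> bruhat_le n ?\<eta> \<eta>"
  proof
    assume "bruhat_le n ?\<eta> \<eta>"
    moreover have "spread i ?\<eta> ?\<eta>" by (auto simp: spread_def)
    ultimately show False
      using bruhat_le_spread_eq[OF i _ asc _ composition_swap[OF i \<eta>] \<eta>] ne by blast
  qed
  have "coef G (expo n ?\<eta>) = 0"
  proof (rule ccontr)
    assume "coef G (expo n ?\<eta>) \<noteq> 0"
    then have "bruhat_le n (coef (expo n ?\<eta>)) \<eta>" using I by (simp add: interp_def in_keys_iff)
    then show False using nle composition_swap[OF i \<eta>] by simp
  qed
  moreover have "coef (hecke i G) (expo n ?\<eta>) = coef G (expo n \<eta>)"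
  proof -
    have c: "coef (expo n \<eta>) = \<eta>" using \<eta> by simp
    have "coef (hecke i G) (with_pair i (expo n \<eta>) (coef (expo n \<eta>) (Suc i)) (coef (expo n \<eta>) i)) = coef G (expo n \<eta>)"
    proof (rule coef_hecke_swap)
      show "coef (expo n \<eta>) i < coef (expo n \<eta>) (Suc i)" using asc by (simp add: c)
      fix k assume k: "k \<in> supp G"
        and sp: "spread i (coef k) ((coef (expo n \<eta>))(i := coef (expo n \<eta>) (Suc i), Suc i := coef (expo n \<eta>) i))"
      have "(coef (expo n \<eta>))(i := coef (expo n \<eta>) (Suc i), Suc i := coef (expo n \<eta>) i) = ?\<eta>"
        unfolding c by (auto simp: transpose_def)
      with sp have sp: "spread i (coef k) ?\<eta>" by (simp only:)
      have kn: "supp k \<subseteq> {1..n}" using k G by (auto simp: graded_def)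
      have "bruhat_le n (coef k) \<eta>" using k I by (auto simp: interp_def)
      then have "coef k = \<eta>"
        by (rule bruhat_le_spread_eq[OF i _ asc sp composition_coef[OF kn] \<eta>])
      then show "k = expo n \<eta>" using expo_coef[OF kn] by simp
    qed
    then show ?thesis unfolding e c .
  qed
  ultimately have 4: "coef (hecke i G - a * G) (expo n ?\<eta>) = 1"
    using I by (simp add: a_def lookup_minus coef_Const_mult interp_def)
  have 5: "bruhat_le n (coef m) ?\<eta>" if m: "m \<in> supp (hecke i G - a * G)" for m
  proof -
    have "m \<in> supp (hecke i G) \<or> m \<in> supp G"
      using m by (auto simp: in_keys_iff a_def lookup_minus coef_Const_mult)
    then obtain k where "k \<in> supp G" "spread i (coef k) (coef m)"
    proof
      assume "m \<in> supp G"
      then show thesis using that[of m] by (auto simp: spread_def)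
    qed (use that in \<open>blast elim: supp_hecke\<close>)
    then show ?thesis
      using bruhat_le_spread_swap[OF i, of "coef k" \<eta> "coef m"] I asc by (auto simp: interp_def)
  qed
  show ?thesis unfolding interp_def using 1 2 3 4 5 by blast
qed

text \<open>The last nonzero entry is brought to place n by swaps with the zeros behind it, and a
  composition with positive last entry is \<open>up\<close> of one of smaller weight. In
  \<open>last\<close>, k is the number of zeros behind that entry.\<close>

lemma interp_exists:
  assumes n: "n \<ge> 1" and "composition n \<eta>"
  shows "\<exists>F G. interp n \<eta> F G"
  using assms(2)
proof (induction "weight n \<eta>" arbitrary: \<eta> rule: less_induct)
  case less
  have IH: "\<exists>F G. interp n \<mu> F G" if "composition n \<mu>" "weight n \<mu> < weight n \<eta>" for \<mu>
    using less that by blast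
  have last: "\<exists>F G. interp n \<mu> F G" if "k < n" "composition n \<mu>" "weight n \<mu> = weight n \<eta>" "\<mu> (n - k) > 0" "\<forall>j>n - k. \<mu> j = 0" for k \<mu>
    using that
  proof (induction k arbitrary: \<mu>)
    case 0
    have "\<exists>F G. interp n (down n \<mu>) F G"
      using 0 weight_down[OF n] composition_down[OF n] by (intro IH) auto
    then show ?case using interp_up[OF n composition_down[OF n, of \<mu>]] up_down[OF n, of \<mu>] 0 by auto
  next
    case (Suc k)
    define i where "i = n - Suc k"
    have i: "i \<in> {1..<n}" "Suc i = n - k" using Suc.prems by (auto simp: i_def)
    let ?\<mu> = "\<mu> \<circ> transpose i (Suc i)"
    have z: "\<mu> (Suc i) = 0" "\<mu> i > 0" "\<forall>j>i. \<mu> j = 0" using Suc.prems i by (auto simp: i_def)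
    have "\<exists>F G. interp n ?\<mu> F G"
    proof (rule Suc.IH)
      show "\<forall>j>n - k. ?\<mu> j = 0" using z i(2) by (auto simp: transpose_def)
      show "?\<mu> (n - k) > 0" using z i(2)[symmetric] by simp
      show "composition n ?\<mu>" using Suc.prems by (intro composition_swap i)
      show "weight n ?\<mu> = weight n \<eta>" unfolding weight_swap[OF i(1)] by (rule Suc.prems)
    qed (use Suc.prems in auto)
    then obtain F G where "interp n ?\<mu> F G" by blast
    then have "interp n (?\<mu> \<circ> transpose i (Suc i)) (hecke i F - Const (ahat (eigenval n ?\<mu> i) (eigenval n ?\<mu> (Suc i))) * F)
      (hecke i G - Const (ahat (eigenval n ?\<mu> i) (eigenval n ?\<mu> (Suc i))) * G)"
      using z composition_swap[OF i(1)] Suc.prems by (intro interp_swap i) auto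
    then show ?case by (auto simp: comp_assoc)
  qed
  show ?case
  proof (cases "\<eta> = (\<lambda>_. 0)")
    case True
    then show ?thesis using interp_zero by blast
  next
    case False
    then obtain j0 where j0: "\<eta> j0 \<noteq> 0" by auto
    define A where "A = {j \<in> {1..n}. \<eta> j \<noteq> 0}"
    have fin: "finite A" and "j0 \<in> A" using j0 less.prems by (auto simp: A_def composition_def)
    then have M: "Max A \<in> A" using Max_in by blast
    have "\<eta> j = 0" if "j > Max A" for j
    proof (rule ccontr)
      assume "\<eta> j \<noteq> 0"
      then have "j \<in> A" using less.prems by (auto simp: A_def composition_def)
      then show False using Max_ge[OF fin] that by fastforce
    qed
    moreover have "n - (n - Max A) = Max A" "n - Max A < n" "\<eta> (Max A) > 0" using M by (auto simp: A_def)
    ultimately show ?thesis using last[of "n - Max A" \<eta>] less.prems by auto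
  qed
qed

definition star_pair :: "nat \<Rightarrow> (nat \<Rightarrow> nat) \<Rightarrow> zpoly \<times> zpoly" where
  "star_pair n \<eta> = (SOME P. interp n \<eta> (fst P) (snd P))"

abbreviation "E_star n \<eta> \<equiv> fst (star_pair n \<eta>)"
abbreviation "E_top n \<eta> \<equiv> snd (star_pair n \<eta>)"

lemma interp_E_star: "n \<ge> 1 \<Longrightarrow> composition n \<eta> \<Longrightarrow> interp n \<eta> (E_star n \<eta>) (E_top n \<eta>)"
  unfolding star_pair_def using interp_exists[of n \<eta>] by (intro someI_ex[of "\<lambda>P. interp n \<eta> (fst P) (snd P)"]) auto

definition comps :: "nat \<Rightarrow> nat \<Rightarrow> (nat \<Rightarrow> nat) set" where
  "comps n d = {\<nu>. composition n \<nu> \<and> weight n \<nu> \<le> d}"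

lemma finite_comps [simp]: "finite (comps n d)"
  unfolding comps_def by (rule finite_compositions)

text \<open>
  Leading monomials are triangular for the order on exponents that compares the degree first and
  then \<^const>\<open>bruhat_le\<close>; \<open>r\<close> below makes this order well-founded.
\<close>

lemma interp_span:
  assumes n: "n \<ge> 1" and "f \<in> graded n {..d}"
  shows "\<exists>c. f = (\<Sum>\<nu>\<in>comps n d. Const (c \<nu>) * E_star n \<nu>)"
proof -
  define V where "V = {f. \<exists>c. f = (\<Sum>\<nu>\<in>comps n d. Const (c \<nu>) * E_star n \<nu>)}"
  have Vadd: "f + g \<in> V" if fg: "f \<in> V" "g \<in> V" for f g
  proof -
    obtain c c' where "f = (\<Sum>\<nu>\<in>comps n d. Const (c \<nu>) * E_star n \<nu>)" "g = (\<Sum>\<nu>\<in>comps n d. Const (c' \<nu>) * E_star n \<nu>)"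
      using fg unfolding V_def by blast
    then have "f + g = (\<Sum>\<nu>\<in>comps n d. Const (c \<nu> + c' \<nu>) * E_star n \<nu>)"
      by (simp add: Const_add distrib_right sum.distrib)
    then show ?thesis by (auto simp: V_def)
  qed
  have Vmult: "Const a * f \<in> V" if f: "f \<in> V" for a f
  proof -
    obtain c where "f = (\<Sum>\<nu>\<in>comps n d. Const (c \<nu>) * E_star n \<nu>)"
      using f unfolding V_def by blast
    then have "Const a * f = (\<Sum>\<nu>\<in>comps n d. Const (a * c \<nu>) * E_star n \<nu>)"
      by (simp add: Const_mult sum_distrib_left mult.assoc)
    then show ?thesis by (auto simp: V_def)
  qed
  have V0: "0 \<in> V" unfolding V_def by (auto intro!: exI[of _ "\<lambda>_. 0"])
  have VF: "E_star n \<nu> \<in> V" if "\<nu> \<in> comps n d" for \<nu>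
  proof -
    have "E_star n \<nu> = (\<Sum>\<kappa>\<in>comps n d. if \<kappa> = \<nu> then E_star n \<nu> else 0)" using that by simp
    also have "\<dots> = (\<Sum>\<kappa>\<in>comps n d. Const (if \<kappa> = \<nu> then 1 else 0) * E_star n \<kappa>)"
      by (intro sum.cong) auto
    finally show ?thesis unfolding V_def by (intro CollectI exI)
  qed
  have Vsum: "f \<in> V" if "\<And>m. m \<in> supp f \<Longrightarrow> monom_z m 1 \<in> V" for f
  proof -
    have "monom_z m c = Const c * monom_z m 1" for m c by (simp add: Const_def mult_single)
    then have mV: "monom_z m (coef f m) \<in> V" if "m \<in> supp f" for m
      using Vmult that \<open>\<And>m. m \<in> supp f \<Longrightarrow> monom_z m 1 \<in> V\<close> by metis
    have "(\<Sum>m\<in>A. monom_z m (coef f m)) \<in> V" if "finite A" "A \<subseteq> supp f" for A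
      using that by (induction A rule: finite_induct) (auto intro: V0 Vadd mV)
    then show ?thesis by (subst poly_mapping_sum_singles) auto
  qed
  define r where "r m = card {\<kappa> \<in> comps n d. bruhat_le n \<kappa> (coef m)}" for m
  have mon: "monom_z m 1 \<in> V" if "supp m \<subseteq> {1..n}" "tdeg m \<le> d" for m
    using that
  proof (induction m rule: wf_induct_rule[OF wf_measures[of "[tdeg, r]"]])
    case (1 m)
    let ?\<eta> = "coef m"
    have c: "composition n ?\<eta>" and e: "expo n ?\<eta> = m" by (rule composition_coef expo_coef, rule 1)+
    have w: "weight n ?\<eta> = tdeg m" using tdeg_expo[of n ?\<eta>] e by simp
    note I = interp_E_star[OF n c]
    define R where "R = monom_z m 1 - E_star n ?\<eta>"
    have "R \<in> V"
    proof (rule Vsum)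
      fix k assume k: "k \<in> supp R"
      have "coef (E_top n ?\<eta>) m = 1" using I e by (simp add: interp_def)
      \<comment> \<open>A monomial of the remainder has lower degree or lies strictly below m, as
        the leading coefficient 1 cancels at m itself.\<close>
      have *: "k \<in> supp (E_star n ?\<eta> - E_top n ?\<eta>) \<or> k \<in> supp (E_top n ?\<eta>) \<and> k \<noteq> m"
      proof (rule ccontr)
        assume "\<not> ?thesis"
        then have "coef (E_star n ?\<eta>) k = coef (E_top n ?\<eta>) k" "coef (E_top n ?\<eta>) k = 0 \<or> k = m"
          by (auto simp: in_keys_iff lookup_minus)
        then have "coef R k = 0"
          using \<open>coef (E_top n ?\<eta>) m = 1\<close> by (auto simp: R_def lookup_minus lookup_single when_def)
        then show False using k by (simp add: in_keys_iff)
      qed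
      have kn: "supp k \<subseteq> {1..n}" and kd: "tdeg k \<le> tdeg m"
        using * I by (auto simp: interp_def graded_def w)
      have "(k, m) \<in> measures [tdeg, r]"
      proof (cases "tdeg k < tdeg m")
        case False
        then have km: "k \<noteq> m" "bruhat_le n (coef k) ?\<eta>" "tdeg k = tdeg m"
          using * I kd by (auto simp: interp_def graded_def w)
        have ck: "composition n (coef k)" by (rule composition_coef[OF kn])
        have "coef k \<noteq> ?\<eta>" using km(1) expo_coef[OF kn] e by auto
        then have nle: "\<not> bruhat_le n ?\<eta> (coef k)" using bruhat_le_antisym[OF ck c km(2)] by blast
        have "{\<kappa> \<in> comps n d. bruhat_le n \<kappa> (coef k)} \<subset> {\<kappa> \<in> comps n d. bruhat_le n \<kappa> ?\<eta>}"
        proof (rule psubsetI)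
          show "{\<kappa> \<in> comps n d. bruhat_le n \<kappa> (coef k)} \<subseteq> {\<kappa> \<in> comps n d. bruhat_le n \<kappa> ?\<eta>}"
            using km(2) bruhat_le_trans by blast
          have "?\<eta> \<in> {\<kappa> \<in> comps n d. bruhat_le n \<kappa> ?\<eta>}" using c w "1.prems" by (simp add: comps_def)
          then show "{\<kappa> \<in> comps n d. bruhat_le n \<kappa> (coef k)} \<noteq> {\<kappa> \<in> comps n d. bruhat_le n \<kappa> ?\<eta>}"
            using nle by blast
        qed
        then have "r k < r m" unfolding r_def by (intro psubset_card_mono) auto
        then show ?thesis using km by simp
      qed simp
      then show "monom_z k 1 \<in> V" using "1.IH" kn kd "1.prems" by simp
    qed
    then have "R + E_star n ?\<eta> \<in> V" using VF[of ?\<eta>] c w "1.prems" by (auto simp: comps_def intro: Vadd)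
    then show ?case by (simp add: R_def)
  qed
  have "f \<in> V"
  proof (rule Vsum)
    fix m assume "m \<in> supp f"
    with assms(2) have "supp m \<subseteq> {1..n}" "tdeg m \<in> {..d}" unfolding graded_def by blast+
    then show "monom_z m 1 \<in> V" by (intro mon) auto
  qed
  then show ?thesis by (simp add: V_def)
qed

text \<open>Evaluation is triangular in the weight: at \<nu> the other interpolation polynomials of
  the same or larger weight vanish, and those of smaller weight have coefficient 0 by
  induction.\<close>

lemma interp_coeff_zero:
  assumes n: "n \<ge> 1" and van: "\<And>\<mu>. \<mu> \<in> comps n d \<Longrightarrow> val n (\<Sum>\<nu>\<in>comps n d. Const (c \<nu>) * E_star n \<nu>) \<mu> = 0"
    and "\<nu> \<in> comps n d"
  shows "c \<nu> = 0"
  using assms(3)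
proof (induction "weight n \<nu>" arbitrary: \<nu> rule: less_induct)
  case less
  have "0 = (\<Sum>\<kappa>\<in>comps n d. c \<kappa> * val n (E_star n \<kappa>) \<nu>)"
    using van[OF less.prems] by (simp add: val_simps)
  also have "\<dots> = (\<Sum>\<kappa>\<in>comps n d. if \<kappa> = \<nu> then c \<nu> * self_val n \<nu> else 0)"
  proof (rule sum.cong)
    fix \<kappa> assume \<kappa>: "\<kappa> \<in> comps n d"
    show "c \<kappa> * val n (E_star n \<kappa>) \<nu> = (if \<kappa> = \<nu> then c \<nu> * self_val n \<nu> else 0)"
    proof (cases "weight n \<kappa> < weight n \<nu>")
      case True
      then show ?thesis using less.hyps[OF True \<kappa>] by auto
    next
      case False
      then show ?thesis
        using interp_E_star[OF n, of \<kappa>] \<kappa> less.prems by (auto simp: interp_def comps_def)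
    qed
  qed simp
  also have "\<dots> = c \<nu> * self_val n \<nu>" using less.prems by simp
  finally show ?case using self_val_nonzero by simp
qed

text \<open>The spectral points of degree at most d determine a polynomial of degree at most d. The
  identities between interpolation polynomials below rest on this.\<close>

lemma vanishing_imp_zero:
  assumes "n \<ge> 1" "f \<in> graded n {..d}" "\<And>\<mu>. \<mu> \<in> comps n d \<Longrightarrow> val n f \<mu> = 0"
  shows "f = 0"
proof -
  obtain c where "f = (\<Sum>\<nu>\<in>comps n d. Const (c \<nu>) * E_star n \<nu>)"
    using interp_span[OF assms(1,2)] by blast
  then show ?thesis
    using interp_coeff_zero[OF assms(1), of d c] assms(3) by simp
qed

section \<open>Eigenvalue equations\<close>

definition chain :: "nat \<Rightarrow> nat \<Rightarrow> zpoly \<Rightarrow> zpoly" where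
  "chain k m = compose_ops (map hecke [k..<m])"

lemma compose_ops_Nil [simp]: "compose_ops [] = id"
  and compose_ops_Cons [simp]: "compose_ops (F # Fs) = F \<circ> compose_ops Fs"
  by (simp_all add: compose_ops_def)

lemma chain_same [simp]: "chain k k f = f"
  by (simp add: chain_def)

lemma chain_less: "k < m \<Longrightarrow> chain k m f = hecke k (chain (Suc k) m f)"
  by (simp add: chain_def upt_conv_Cons)

lemma chain_induct:
  assumes "k \<le> m" "P f" "\<And>i g. i \<in> {k..<m} \<Longrightarrow> P g \<Longrightarrow> P (hecke i g)"
  shows "P (chain k m f)"
  using assms(1,3)
proof (induction "m - k" arbitrary: k)
  case (Suc j)
  then have "P (chain (Suc k) m f)" by (intro Suc.hyps(1)) auto
  then show ?case using Suc.prems Suc.hyps(2) by (subst chain_less) auto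
qed (use assms(2) in auto)

lemma chain_additive:
  "k \<le> m \<Longrightarrow> chain k m (f + g) = chain k m f + chain k m g"
  "k \<le> m \<Longrightarrow> chain k m (f - g) = chain k m f - chain k m g"
  "k \<le> m \<Longrightarrow> chain k m (Const c * f) = Const c * chain k m f"
  by (induction "m - k" arbitrary: k)
    (auto simp: chain_less hecke_add hecke_diff hecke_Const_mult)

lemma graded_chain: "f \<in> graded n S \<Longrightarrow> 1 \<le> k \<Longrightarrow> k \<le> m \<Longrightarrow> m \<le> n \<Longrightarrow> chain k m f \<in> graded n S"
  by (rule chain_induct) (auto intro!: graded_hecke)

text \<open>The bound is strict, so that the interpolation polynomial of \<eta> satisfies it with
  \<open>e\<close> = |\<eta>| and \<open>phi\<close> raises \<open>e\<close> by one.\<close>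

definition vanish :: "nat \<Rightarrow> nat \<Rightarrow> zpoly \<Rightarrow> bool" where
  "vanish n e f \<longleftrightarrow> (\<forall>\<mu>. composition n \<mu> \<longrightarrow> weight n \<mu> < e \<longrightarrow> val n f \<mu> = 0)"

lemma vanish_hecke: "i \<in> {1..<n} \<Longrightarrow> vanish n e f \<Longrightarrow> vanish n e (hecke i f)"
  by (auto simp: vanish_def val_hecke weight_swap composition_swap simp del: o_apply)

lemma vanish_chain: "vanish n e f \<Longrightarrow> 1 \<le> k \<Longrightarrow> k \<le> m \<Longrightarrow> m \<le> n \<Longrightarrow> vanish n e (chain k m f)"
  by (rule chain_induct) (auto intro!: vanish_hecke)

lemma vanish_phi:
  assumes n: "n \<ge> 1" and f: "f \<in> graded n S" "vanish n e f"
  shows "vanish n (Suc e) (phi n f)"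
  unfolding vanish_def
proof (intro allI impI)
  fix \<mu> assume \<mu>: "composition n \<mu>" "weight n \<mu> < Suc e"
  show "val n (phi n f) \<mu> = 0"
  proof (cases "\<mu> n = 0")
    case False
    then have "val n f (down n \<mu>) = 0"
      using f(2) \<mu> weight_down[OF n \<mu>(1)] composition_down[OF n] by (auto simp: vanish_def)
    then show ?thesis using val_phi_up[OF n f(1), of "down n \<mu>"] up_down[OF n \<mu>(1)] False by simp
  qed (rule val_phi_0[OF n])
qed

lemma vanish_imp_zero:
  assumes "n \<ge> 1" "f \<in> graded n {..<d}" "vanish n d f"
  shows "f = 0"
proof (cases d)
  case 0
  then show ?thesis using graded_disjoint[of f n "{}" "{}"] assms(2) by simp
next
  case (Suc e)
  then show ?thesis
    using assms by (intro vanishing_imp_zero[of n f e]) (auto simp: lessThan_Suc_atMost vanish_def comps_def)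
qed

text \<open>In terms of Knop's inhomogeneous Cherednik operators Xi_i this is z_i Xi_i - 1; the
  division by z_i is avoided.\<close>

definition W_op :: "nat \<Rightarrow> nat \<Rightarrow> zpoly \<Rightarrow> zpoly" where
  "W_op n i f = chain i n (phi n (chain 1 i f))"

text \<open>Top-degree part of \<open>W_op\<close>. By \<open>zvar_bar_Y_op\<close> it is z_i times
  the Cherednik operator with inverted parameters.\<close>

definition W_top :: "nat \<Rightarrow> nat \<Rightarrow> zpoly \<Rightarrow> zpoly" where
  "W_top n i f = chain i n (zvar n * cyc n (chain 1 i f))"

text \<open>At a zero coordinate x_k the rule \<open>ev_hecke\<close> loses its first term, and
  cancelling the coordinate at Suc k leaves t times the swap. So the zero is handed on as far as
  place m, at the price of one t per factor; the other coordinates are assumed nonzero for the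
  cancellation.\<close>

lemma ev_chain_zero:
  assumes "k \<le> m" "x k = 0" "\<And>j. j \<in> {k<..m} \<Longrightarrow> x j \<noteq> 0"
  shows "C.ev x (chain k m f) = Const (tt ^ (m - k)) *
    C.ev (\<lambda>j. if j \<in> {k..<m} then x (Suc j) else if j = m then 0 else x j) f"
  using assms
proof (induction "m - k" arbitrary: k x)
  case 0
  then have "(\<lambda>j. if j \<in> {k..<m} then x (Suc j) else if j = m then 0 else x j) = x" by auto
  then show ?case using 0 by simp
next
  case (Suc l)
  then have km: "k < m" by simp
  let ?x = "x \<circ> transpose k (Suc k)" and ?f = "chain (Suc k) m f"
  have "x (Suc k) * C.ev x (hecke k ?f) = x (Suc k) * (Const tt * C.ev ?x ?f)"
    using C.ev_hecke[of x k ?f] Suc.prems(2) by (simp add: mult_ac)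
  then have 1: "C.ev x (hecke k ?f) = Const tt * C.ev ?x ?f"
    using Suc.prems(3)[of "Suc k"] km by simp
  have "C.ev ?x ?f = Const (tt ^ (m - Suc k)) *
     C.ev (\<lambda>j. if j \<in> {Suc k..<m} then ?x (Suc j) else if j = m then 0 else ?x j) f"
  proof (rule Suc.hyps(1))
    show "?x (Suc k) = 0" using Suc.prems by simp
    show "?x j \<noteq> 0" if "j \<in> {Suc k<..m}" for j
      using that Suc.prems(3)[of j] by (simp add: transpose_def)
  qed (use Suc in auto)
  also have "(\<lambda>j. if j \<in> {Suc k..<m} then ?x (Suc j) else if j = m then 0 else ?x j)
     = (\<lambda>j. if j \<in> {k..<m} then x (Suc j) else if j = m then 0 else x j)"
    using km by (intro ext) (auto simp: transpose_def not_less_eq_eq dest: le_antisym)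
  finally have 2: "C.ev ?x ?f = Const (tt ^ (m - Suc k)) *
    C.ev (\<lambda>j. if j \<in> {k..<m} then x (Suc j) else if j = m then 0 else x j) f" .
  have mk: "m - k = Suc (m - Suc k)" using km by simp
  show ?case unfolding chain_less[OF km] 1 2 mk power_Suc Const_mult mult.assoc ..
qed

text \<open>
  At \<open>z\<^sub>i = 0\<close> the coefficient of the identity in \<open>hecke i\<close> vanishes, so each factor of \<^const>\<open>W_op\<close>
  merely moves the zero coordinate, which returns to place \<open>i\<close>. Hence the two sides of \<open>interp_eigen\<close>
  differ by a multiple of \<open>z\<^sub>i\<close>, and the quotient vanishes at enough spectral points to be 0.
\<close>

lemma ev_W_op_zero:
  assumes i: "i \<in> {1..n}"
  shows "C.ev (zvar(i := 0)) (W_op n i f) = - C.ev (zvar(i := 0)) f"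
proof -
  let ?x = "zvar(i := 0 :: zpoly)"
  define y where "y = (\<lambda>j. if j \<in> {i..<n} then ?x (Suc j) else if j = n then 0 else ?x j)"
  define w where "w = (\<lambda>j. if j = 1 then Const (inverse qq) * y n else if j \<in> {2..n} then y (j - 1) else y j)"
  have n: "n \<ge> 1" using i by auto
  have "C.ev ?x (W_op n i f) = Const (tt ^ (n - i)) * C.ev y (phi n (chain 1 i f))"
    unfolding W_op_def y_def using i by (intro ev_chain_zero) auto
  \<comment> \<open>The zero now stands at place n, so only the constant in the first factor of
    \<open>phi\<close> survives; this gives the sign.\<close>
  also have "C.ev y (phi n (chain 1 i f)) = - Const (tt powi (1 - int n)) * C.ev w (chain 1 i f)"
  proof -
    have "y n = 0" by (simp add: y_def)
    then show ?thesis by (simp add: phi_def C.ev_mult C.ev_diff C.ev_cyc w_def)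
  qed
  also have "C.ev w (chain 1 i f) = Const (tt ^ (i - 1)) *
      C.ev (\<lambda>j. if j \<in> {1..<i} then w (Suc j) else if j = i then 0 else w j) f"
  proof (rule ev_chain_zero)
    show "w 1 = 0" by (simp add: w_def y_def)
    show "w j \<noteq> 0" if "j \<in> {1<..i}" for j
      using that i by (auto simp: w_def y_def)
  qed (use i in auto)
  also have "(\<lambda>j. if j \<in> {1..<i} then w (Suc j) else if j = i then 0 else w j) = ?x"
    using i by (auto simp: w_def y_def fun_eq_iff)
  finally have "C.ev ?x (W_op n i f) = - Const (tt ^ (n - i) * tt powi (1 - int n) * tt ^ (i - 1)) * C.ev ?x f"
    by (simp only: Const_mult mult_minus_left mult_minus_right mult_ac)
  \<comment> \<open>The exponents n - i, 1 - n and i - 1 add up to 0.\<close>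
  also have "tt ^ (n - i) * tt powi (1 - int n) * tt ^ (i - 1) = 1"
  proof -
    have "tt ^ (n - i) * tt ^ (i - 1) = tt powi (int n - 1)"
      using i by (simp add: power_int_def nat_diff_distrib flip: power_add)
    moreover have "tt powi (int n - 1) * tt powi (1 - int n) = 1"
      by (simp flip: power_int_add)
    ultimately have "(tt ^ (n - i) * tt ^ (i - 1)) * tt powi (1 - int n) = 1" by (simp only:)
    then show ?thesis by (simp only: mult_ac)
  qed
  finally show ?thesis by (simp only: Const_1 mult_minus_left mult_1_left)
qed

lemma zvar_dvd_decompose: "\<exists>h. f = C.ev (zvar(i := 0)) f + zvar i * h"
proof (induction f rule: zpoly_gen_induct)
  case (2 j)
  show ?case by (rule exI[of _ "if j = i then 1 else 0"]) simp
next
  case (3 f g)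
  then obtain a b where "f = C.ev (zvar(i := 0)) f + zvar i * a" "g = C.ev (zvar(i := 0)) g + zvar i * b" by blast
  then have "f + g = C.ev (zvar(i := 0)) (f + g) + zvar i * (a + b)"
    by (metis (no_types, lifting) C.ev_add add.assoc add.left_commute distrib_left)
  then show ?case by blast
next
  case (4 f g)
  then obtain a b where ab: "f = C.ev (zvar(i := 0)) f + zvar i * a" "g = C.ev (zvar(i := 0)) g + zvar i * b" by blast
  define f0 g0 where "f0 = C.ev (zvar(i := 0)) f" and "g0 = C.ev (zvar(i := 0)) g"
  have "f * g = f0 * g0 + zvar i * (a * g0 + f0 * b + zvar i * a * b)"
    unfolding ab(1)[folded f0_def] ab(2)[folded g0_def] by (simp add: algebra_simps)
  then show ?case unfolding C.ev_mult f0_def g0_def by blast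
qed (auto intro: exI[of _ 0])

lemma coef_zvar_mult: "coef (zvar i * h) (Poly_Mapping.single i 1 + m) = coef h m"
  by (induction h rule: zpoly_add_induct)
    (simp_all add: zvar_def mult_single lookup_single when_def distrib_left lookup_add)

lemma graded_zvar_mult_imp:
  assumes "zvar i * h \<in> graded n {..Suc d}"
  shows "h \<in> graded n {..d}"
  unfolding graded_def
proof (intro CollectI ballI)
  fix m assume "m \<in> supp h"
  then have "Poly_Mapping.single i 1 + m \<in> supp (zvar i * h)"
    using coef_zvar_mult[of i h m] by (simp add: in_keys_iff)
  then have *: "supp (Poly_Mapping.single i 1 + m) \<subseteq> {1..n}" "tdeg (Poly_Mapping.single i 1 + m) \<le> Suc d"
    using assms by (auto simp: graded_def)
  have "supp m \<subseteq> supp (Poly_Mapping.single i 1 + m)" by (auto simp: in_keys_iff lookup_add)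
  with * show "supp m \<subseteq> {1..n} \<and> tdeg m \<in> {..d}" by (auto simp: tdeg_add)
qed

lemma interp_eigen:
  assumes n: "n \<ge> 1" and \<eta>: "composition n \<eta>" and I: "interp n \<eta> F G" and i: "i \<in> {1..n}"
  shows "W_op n i F = (Const (inverse (eigenval n \<eta> i)) * zvar i - 1) * F"
proof -
  let ?d = "weight n \<eta>" and ?c = "Const (inverse (eigenval n \<eta> i))"
  define g where "g = W_op n i F - (?c * zvar i - 1) * F"
  have F: "F \<in> graded n {..?d}" by (rule interp_graded[OF I])
  have zn: "zvar n \<in> graded n {1}" using graded_zvar[of n n] n by simp
  have phi: "phi n f \<in> graded n {..Suc ?d}" if "f \<in> graded n {..?d}" for f
  proof -
    have "phi n f = zvar n * cyc n f - Const (tt powi (1 - int n)) * cyc n f"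
      by (simp add: phi_def left_diff_distrib)
    moreover have "zvar n * cyc n f \<in> graded n {..Suc ?d}"
      by (rule graded_mult[OF zn graded_cyc[OF that n]]) auto
    moreover have "Const (tt powi (1 - int n)) * cyc n f \<in> graded n {..Suc ?d}"
      by (rule graded_mono[OF graded_Const_mult[OF graded_cyc[OF that n]]]) auto
    ultimately show ?thesis by (simp add: graded_diff)
  qed
  have gW: "W_op n i F \<in> graded n {..Suc ?d}"
    unfolding W_op_def using i by (intro graded_chain phi F) auto
  have "(?c * zvar i - 1) * F = ?c * (zvar i * F) - F" by (simp add: algebra_simps)
  moreover have "zvar i * F \<in> graded n {..Suc ?d}"
    by (rule graded_mult[OF graded_zvar[OF i] F]) auto
  ultimately have gg: "g \<in> graded n {..Suc ?d}"
    unfolding g_def using graded_mono[OF F, of "{..Suc ?d}"]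
    by (auto intro!: graded_diff gW graded_Const_mult)
  have vF: "vanish n ?d F" using I by (auto simp: vanish_def interp_def)
  have vW: "vanish n (Suc ?d) (W_op n i F)"
    unfolding W_op_def using i
    by (intro vanish_chain vanish_phi[OF n graded_chain[OF F]] vF) auto
  \<comment> \<open>Away from \<eta> the second term vanishes with \<open>F\<close>; at \<eta> its
    linear factor does, which fixes the eigenvalue.\<close>
  have vg: "vanish n (Suc ?d) g"
    using vW I unfolding vanish_def g_def interp_def val_simps
    by (auto simp: val_simps val_def[of n 1] less_Suc_eq_le)
  have "C.ev (zvar(i := 0)) g = 0"
    unfolding g_def by (simp add: C.ev_diff C.ev_mult ev_W_op_zero[OF i])
  then obtain h where h: "g = zvar i * h" using zvar_dvd_decompose[of g i] by auto
  have "h \<in> graded n {..?d}" using gg unfolding h by (rule graded_zvar_mult_imp)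
  moreover have "val n h \<mu> = 0" if "\<mu> \<in> comps n ?d" for \<mu>
  proof -
    have "val n g \<mu> = 0" using vg that by (auto simp: vanish_def comps_def)
    then show ?thesis by (simp add: h val_simps)
  qed
  ultimately have "h = 0" by (intro vanishing_imp_zero[OF n])
  then show ?thesis using h by (simp add: g_def)
qed

text \<open>Both sides are homogeneous of degree |\<eta>| + 1, and each differs from
  \<open>W_op n i F\<close> only in lower degree.\<close>

lemma interp_eigen_top:
  assumes n: "n \<ge> 1" and \<eta>: "composition n \<eta>" and I: "interp n \<eta> F G" and i: "i \<in> {1..n}"
  shows "W_top n i G = Const (inverse (eigenval n \<eta> i)) * zvar i * G"
proof -
  let ?d = "weight n \<eta>" and ?c = "Const (inverse (eigenval n \<eta> i))" and ?b = "Const (tt powi (1 - int n))"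
  have F: "F \<in> graded n {..?d}" by (rule interp_graded[OF I])
  have G: "G \<in> graded n {?d}" and FG: "F - G \<in> graded n {..<?d}" using I by (auto simp: interp_def)
  have zn: "zvar n \<in> graded n {1}" using graded_zvar[of n n] n by simp
  have i1: "1 \<le> i" "i \<le> n" using i by auto
  have A: "W_op n i F - W_top n i G \<in> graded n {..<Suc ?d}"
  proof -
    have "W_op n i F - W_top n i G = chain i n (zvar n * cyc n (chain 1 i (F - G)) - ?b * cyc n (chain 1 i F))"
      unfolding W_op_def W_top_def chain_additive(2)[OF i1(2), symmetric] phi_def chain_additive(2)[OF i1(1)]
      by (simp add: cyc_diff algebra_simps)
    moreover have "zvar n * cyc n (chain 1 i (F - G)) \<in> graded n {..<Suc ?d}"
      by (rule graded_mult[OF zn graded_cyc[OF graded_chain[OF FG]]]) (use i1 n in auto)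
    moreover have "?b * cyc n (chain 1 i F) \<in> graded n {..<Suc ?d}"
      using i1 n unfolding lessThan_Suc_atMost by (intro graded_Const_mult graded_cyc graded_chain F) auto
    ultimately show ?thesis using i1 by (simp add: graded_chain graded_diff)
  qed
  have B: "W_op n i F - ?c * zvar i * G \<in> graded n {..<Suc ?d}"
  proof -
    have "W_op n i F - ?c * zvar i * G = ?c * (zvar i * (F - G)) - F"
      unfolding interp_eigen[OF n \<eta> I i] by (simp add: algebra_simps)
    moreover have "zvar i * (F - G) \<in> graded n {..<Suc ?d}"
      by (rule graded_mult[OF graded_zvar[OF i] FG]) auto
    ultimately show ?thesis using F by (simp add: graded_diff graded_Const_mult lessThan_Suc_atMost)
  qed
  have "?c * zvar i * G - W_top n i G = (W_op n i F - W_top n i G) - (W_op n i F - ?c * zvar i * G)"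
    by simp
  then have 1: "?c * zvar i * G - W_top n i G \<in> graded n {..<Suc ?d}"
    using graded_diff[OF A B] by simp
  have zG: "zvar i * G \<in> graded n {Suc ?d}"
    by (rule graded_mult[OF graded_zvar[OF i] G]) auto
  have "zvar n * cyc n (chain 1 i G) \<in> graded n {Suc ?d}"
    by (rule graded_mult[OF zn graded_cyc[OF graded_chain[OF G]]]) (use i1 n in auto)
  then have "W_top n i G \<in> graded n {Suc ?d}"
    unfolding W_top_def using i1 by (intro graded_chain) auto
  then have "?c * zvar i * G - W_top n i G \<in> graded n {Suc ?d}"
    using graded_Const_mult[OF zG] by (intro graded_diff) (auto simp: mult.assoc)
  from graded_disjoint[OF 1 this] show ?thesis by auto
qed

section \<open>Comparison with the Cherednik operators\<close>

lemma eval_q_1: "eval_q x 1 = 1" and eval_qt_1: "eval_qt x y 1 = 1"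
  by (simp_all add: eval_q_def eval_qt_def map_poly_1')

lemma eval_qt_add: "eval_qt x y (p + r) = eval_qt x y p + eval_qt x y r"
  by (simp add: eval_qt_def map_poly_hom_add eval_q_add)

lemma eval_qt_pCons: "eval_qt x y (pCons a p) = eval_q x a + y * eval_qt x y p"
  by (simp add: eval_qt_def map_poly_pCons)

lemma eval_q_pCons: "eval_q x (pCons a p) = of_rat a + x * eval_q x p"
  by (simp add: eval_q_def map_poly_pCons)

lemma invert_to_fract: "invert_qt (to_fract p) = eval_qt (inverse qq) (inverse tt) p"
  unfolding to_fract_def by (simp add: invert_qt_Fract eval_qt_1)

lemma invert_add: "invert_qt (x + y) = invert_qt x + invert_qt y"
proof -
  obtain a b c d where "x = Fract a b" "b \<noteq> 0" "y = Fract c d" "d \<noteq> 0"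
    by (metis Fract_cases)
  then show ?thesis
    by (simp add: invert_qt_Fract eval_qt_add eval_qt_mult eval_qt_inverse_nonzero add_frac_eq)
qed

lemma invert_mult: "invert_qt (x * y) = invert_qt x * invert_qt y"
proof -
  obtain a b c d where "x = Fract a b" "b \<noteq> 0" "y = Fract c d" "d \<noteq> 0"
    by (metis Fract_cases)
  then show ?thesis by (simp add: invert_qt_Fract eval_qt_mult)
qed

lemma invert_1 [simp]: "invert_qt 1 = 1" and invert_0 [simp]: "invert_qt 0 = 0"
  using invert_to_fract[of 1] invert_to_fract[of 0] by (simp_all add: eval_qt_1) (simp add: eval_qt_def)

lemma invert_qq [simp]: "invert_qt qq = inverse qq" and invert_tt [simp]: "invert_qt tt = inverse tt"
  unfolding qq_def tt_def invert_to_fract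
  by (simp_all add: eval_qt_pCons eval_q_pCons eval_q_1 eval_qt_def[of _ _ 0] flip: qq_def tt_def)

lemma invert_inverse: "invert_qt (inverse x) = inverse (invert_qt x)"
proof (cases "x = 0")
  case False
  then have "invert_qt x * invert_qt (inverse x) = 1" by (simp flip: invert_mult)
  then show ?thesis by (metis inverse_unique)
qed simp

lemma invert_power: "invert_qt (x ^ k) = invert_qt x ^ k"
  by (induction k) (simp_all add: invert_mult)

lemma invert_powi: "invert_qt (x powi k) = invert_qt x powi k"
  by (simp add: power_int_def invert_power invert_inverse)

lemma invert_of_rat: "invert_qt (of_rat r) = of_rat r"
  unfolding of_rat_qtfield invert_to_fract
  by (simp add: eval_qt_pCons eval_q_pCons eval_qt_def[of _ _ 0] of_rat_qtfield)

text \<open>Inverting twice evaluates a polynomial at q and t themselves, which is the identity by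
  \<open>eval_qt_qq_tt\<close>; fractions follow by multiplicativity.\<close>

lemma invert_invert [simp]: "invert_qt (invert_qt x) = x"
proof -
  have q: "invert_qt (eval_q (inverse qq) c) = eval_q qq c" for c
    by (induction c) (simp_all add: eval_q_pCons invert_add invert_mult invert_of_rat invert_inverse)
  have t: "invert_qt (eval_qt (inverse qq) (inverse tt) p) = eval_qt qq tt p" for p
    by (induction p) (simp_all add: eval_qt_pCons invert_add invert_mult q invert_inverse eval_qt_def[of _ _ 0])
  have p: "invert_qt (invert_qt (to_fract p)) = to_fract p" for p
    unfolding invert_to_fract t eval_qt_qq_tt ..
  obtain a b where ab: "x = Fract a b" "b \<noteq> 0" by (metis Fract_cases)
  then have "x = to_fract a * inverse (to_fract b)"
    by (simp add: to_fract_def)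
  then show ?thesis by (simp add: invert_mult invert_inverse p)
qed

abbreviation "bar \<equiv> Poly_Mapping.map invert_qt :: zpoly \<Rightarrow> zpoly"

global_interpretation JH: coeff_hom "\<lambda>c. Const (invert_qt c)"
  by unfold_locales (simp_all add: Const_add Const_mult invert_add invert_mult)

lemma coef_bar [simp]: "coef (bar f) m = invert_qt (coef f m)"
  by (simp add: Poly_Mapping.map.rep_eq when_def)

lemma bar_eq: "bar f = JH.ev zvar f"
proof (induction f rule: zpoly_add_induct)
  case (1 m c)
  have "bar (monom_z m c) = monom_z m (invert_qt c)"
    by (rule poly_mapping_eqI) (simp add: lookup_single when_def)
  then show ?case by (simp only: JH.ev_single monom_z_eq[of m "invert_qt c"])
next
  case (2 f g)
  have "bar (f + g) = bar f + bar g"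
    by (rule poly_mapping_eqI) (simp add: lookup_add invert_add)
  with 2 show ?case by (simp add: JH.ev_add)
qed

lemma bar_bar [simp]: "bar (bar f) = f"
  by (rule poly_mapping_eqI) simp

lemma bar_inj: "bar f = bar g \<Longrightarrow> f = g"
  by (metis bar_bar)

lemmas bar_simps = JH.ev_add[of zvar, folded bar_eq] JH.ev_mult[of zvar, folded bar_eq]
  JH.ev_diff[of zvar, folded bar_eq] JH.ev_Const[of zvar, folded bar_eq] JH.ev_zvar[of zvar, folded bar_eq]

lemma C_ev_bar: "C.ev \<sigma> (bar f) = JH.ev \<sigma> f"
  by (induction f rule: zpoly_gen_induct)
    (simp_all add: bar_simps C.ev_add C.ev_mult JH.ev_add JH.ev_mult)

section \<open>Conjugation of the operators by inverting the parameters\<close>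

lemma bar_s_op: "bar (s_op i f) = s_op i (bar f)"
  unfolding bar_eq[of "s_op i f"] JH.ev_s_op
  by (simp add: s_op_def subst_z_eq C_ev_bar comp_def)

lemma bar_div_diff: "bar (div_diff i f) = div_diff i (bar f)"
  by (rule div_diff_unique[symmetric]) (metis bar_s_op bar_simps(2,3,5) div_diff_mult)

lemma s_op_comp:
  assumes "n \<ge> 1"
  shows "compose_ops (map s_op (rev [1..<n])) f
    = C.ev (\<lambda>j. if j = 1 then zvar n else if j \<in> {2..n} then zvar (j - 1) else zvar j) f"
  using assms
proof (induction n rule: dec_induct)
  case base
  have "(\<lambda>j. if j = 1 then zvar 1 else if j \<in> {2..1::nat} then zvar (j - 1) else zvar j) = zvar" by auto
  then show ?case using subst_id[of f] by (simp add: subst_z_eq)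
next
  case (step n)
  have "compose_ops (map s_op (rev [1..<Suc n])) f = s_op n (compose_ops (map s_op (rev [1..<n])) f)"
    using step by simp
  also have "\<dots> = C.ev (\<lambda>j. C.ev (\<lambda>j. zvar (transpose n (Suc n) j))
     (if j = 1 then zvar n else if j \<in> {2..n} then zvar (j - 1) else zvar j)) f"
    unfolding step.IH by (simp add: s_op_def subst_z_eq C.ev_subst[unfolded subst_z_eq])
  also have "(\<lambda>j. C.ev (\<lambda>j. zvar (transpose n (Suc n) j))
     (if j = 1 then zvar n else if j \<in> {2..n} then zvar (j - 1) else zvar j))
     = (\<lambda>j. if j = 1 then zvar (Suc n) else if j \<in> {2..Suc n} then zvar (j - 1) else zvar j)"
    using step by (intro ext) (auto simp: transpose_def)
  finally show ?case .
qed

lemma bar_omega: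
  assumes "n \<ge> 1"
  shows "bar (omega n f) = cyc n (bar f)"
proof -
  let ?\<sigma> = "\<lambda>j. if j = 1 then zvar n else if j \<in> {2..n} then zvar (j - 1) else zvar j"
  have "bar (omega n f) = JH.ev ?\<sigma> (tau1 f)"
    unfolding omega_def o_apply s_op_comp[OF assms] subst_z_eq[symmetric] bar_eq JH.ev_subst
    by (intro arg_cong[where f = "\<lambda>s. JH.ev s _"]) auto
  also have "\<dots> = JH.ev (\<lambda>j. JH.ev ?\<sigma> (if j = 1 then Const qq * zvar 1 else zvar j)) f"
    unfolding tau1_def JH.ev_subst ..
  also have "(\<lambda>j. JH.ev ?\<sigma> (if j = 1 then Const qq * zvar 1 else zvar j))
     = (\<lambda>j. if j = 1 then Const (inverse qq) * zvar n else if j \<in> {2..n} then zvar (j - 1) else zvar j)"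
    by (intro ext) (simp add: JH.ev_mult)
  finally show ?thesis by (simp add: cyc_def subst_z_eq C_ev_bar)
qed

lemma div_diff_product: "div_diff i (f * g) = div_diff i f * s_op i g + f * div_diff i g"
proof (rule div_diff_unique)
  have "(zvar i - zvar (Suc i)) * (div_diff i f * s_op i g + f * div_diff i g)
     = ((zvar i - zvar (Suc i)) * div_diff i f) * s_op i g + f * ((zvar i - zvar (Suc i)) * div_diff i g)"
    by (simp add: algebra_simps)
  then show "(zvar i - zvar (Suc i)) * (div_diff i f * s_op i g + f * div_diff i g) = s_op i (f * g) - f * g"
    unfolding div_diff_mult by (simp add: s_op_simps algebra_simps)
qed

lemma div_diff_zvar: "div_diff i (zvar i) = - 1" "div_diff i (zvar (Suc i)) = 1"
  by (rule div_diff_unique, simp add: s_op_simps)+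

lemma s_op_div_diff [simp]: "s_op i (div_diff i f) = div_diff i f"
proof -
  have "s_op i ((zvar i - zvar (Suc i)) * div_diff i f) = s_op i (s_op i f - f)"
    unfolding div_diff_mult ..
  then have "(zvar i - zvar (Suc i)) * s_op i (div_diff i f) = s_op i f - f"
    by (simp add: s_op_simps algebra_simps)
  then show ?thesis by (metis div_diff_unique div_diff_mult)
qed

lemma div_diff_div_diff [simp]: "div_diff i (div_diff i f) = 0"
  by (rule div_diff_unique) simp

lemma div_diff_diff: "div_diff i (f - g) = div_diff i f - div_diff i g"
  using div_diff_add[of i "f - g" g] by simp

text \<open>This is (T - t + 1) / t, as given by the quadratic relation (T - t)(T + 1) = 0.
  Inverting t in it yields \<open>hecke\<close>.\<close>

definition T_inv :: "nat \<Rightarrow> zpoly \<Rightarrow> zpoly" where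
  "T_inv i f = Const (inverse tt) * f + (zvar i - Const (inverse tt) * zvar (Suc i)) * div_diff i f"

text \<open>For \<open>T_op\<close> the linear coefficient has divided difference -(t + 1), and a
  second divided difference is 0; together with the term t f this gives t - (t + 1) = -1.
  \<open>T_inv\<close> is the same with 1/t.\<close>

lemma div_diff_T: "div_diff i (T_op i f) = - div_diff i f" "div_diff i (T_inv i f) = - div_diff i f"
  unfolding T_op_def T_inv_def Suc_eq_plus1[symmetric] div_diff_add div_diff_Const_mult
    div_diff_product[of i "_ - _"] div_diff_diff div_diff_div_diff div_diff_zvar s_op_div_diff
  by (simp_all add: algebra_simps)

lemma T_op_T_inv: "T_op i (T_inv i f) = f" and T_inv_T_op: "T_inv i (T_op i f) = f"
proof -
  have c: "Const tt * Const (inverse tt) = 1" by (simp flip: Const_mult)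
  have c': "Const tt * (Const (inverse tt) * g) = g" for g
    unfolding mult.assoc[symmetric] c by simp
  have c'': "Const (inverse tt) * (Const tt * g) = g" for g
    using c' by (simp add: mult.left_commute)
  show "T_op i (T_inv i f) = f"
    unfolding T_op_def[of i "T_inv i f"] div_diff_T Suc_eq_plus1[symmetric]
    unfolding T_inv_def by (simp add: algebra_simps c c')
  show "T_inv i (T_op i f) = f"
    unfolding T_inv_def[of i "T_op i f"] div_diff_T
    unfolding T_op_def Suc_eq_plus1[symmetric] by (simp add: algebra_simps c c'')
qed

lemma inv_T_op: "inv (T_op i) = T_inv i"
  by (rule inv_equality) (simp_all add: T_op_T_inv T_inv_T_op)

lemma bar_T_inv: "bar (T_inv i f) = hecke i (bar f)"
  by (simp add: T_inv_def hecke_def bar_simps bar_div_diff invert_inverse)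

lemma bar_T_inv_chain: "bar (compose_ops (map (\<lambda>j. inv (T_op j)) [k..<m]) f) = chain k m (bar f)"
proof (induction "m - k" arbitrary: k)
  case (Suc l)
  then have km: "k < m" by simp
  then have "[k..<m] = k # [Suc k..<m]" by (rule upt_conv_Cons)
  then show ?case
    using Suc.hyps(1)[of "Suc k"] Suc.hyps(2) by (simp add: inv_T_op bar_T_inv chain_less[OF km])
qed (simp add: chain_def)

text \<open>Moving a variable through the operator turns \<open>T_op\<close>, with inverted
  parameter, into \<open>hecke\<close>, that is, into the kind to which inverses of
  \<open>T_op\<close> are sent. The factors on both sides of \<open>omega\<close> thus become
  alike.\<close>

lemma zvar_bar_T_op: "zvar i * bar (T_op i f) = Const (inverse tt) * hecke i (zvar (Suc i) * bar f)"
proof -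
  let ?g = "bar f"
  \<comment> \<open>Ring identity for u = 1/t and v = t, with z, z' the variables at i and Suc i and
    d the divided difference of g.\<close>
  have *: "z * (u * g + (u * z - z') * d) = u * (v * (z' * g) + (z - v * z') * (g + z * d))"
    if "u * v = 1" for u v z z' g d :: zpoly
    using that by algebra
  have d: "div_diff i (zvar (Suc i) * ?g) = ?g + zvar i * div_diff i ?g"
  proof -
    have "s_op i ?g = ?g + (zvar i - zvar (Suc i)) * div_diff i ?g"
      unfolding div_diff_mult by simp
    then show ?thesis unfolding div_diff_product div_diff_zvar by (simp add: algebra_simps)
  qed
  have "bar (T_op i f) = Const (inverse tt) * ?g + (Const (inverse tt) * zvar i - zvar (Suc i)) * div_diff i ?g"
    by (simp add: T_op_def bar_simps bar_div_diff)
  then show ?thesis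
    unfolding hecke_def d by (simp only:) (rule *, simp flip: Const_mult)
qed

lemma zvar_bar_T_chain:
  assumes "k \<le> n"
  shows "zvar k * bar (compose_ops (map T_op [k..<n]) f)
    = Const (inverse tt ^ (n - k)) * chain k n (zvar n * bar f)"
  using assms
proof (induction "n - k" arbitrary: k)
  case (Suc l)
  then have km: "k < n" by simp
  then have "[k..<n] = k # [Suc k..<n]" by (rule upt_conv_Cons)
  then have "zvar k * bar (compose_ops (map T_op [k..<n]) f)
     = Const (inverse tt) * hecke k (zvar (Suc k) * bar (compose_ops (map T_op [Suc k..<n]) f))"
    by (simp add: zvar_bar_T_op)
  also have "zvar (Suc k) * bar (compose_ops (map T_op [Suc k..<n]) f)
     = Const (inverse tt ^ (n - Suc k)) * chain (Suc k) n (zvar n * bar f)"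
    using Suc by (intro Suc.hyps(1)) auto
  finally show ?case
    using km by (simp add: hecke_Const_mult chain_less Suc_diff_Suc[symmetric] Const_mult mult.assoc)
qed simp

text \<open>The variable at i travels through the factors on the left and arrives at the cyclic
  shift as the variable at n. Each factor costs 1/t, and the prefactor of \<open>Y_op\<close>
  compensates this.\<close>

lemma zvar_bar_Y_op:
  assumes i: "i \<in> {1..n}"
  shows "zvar i * bar (Y_op n i f) = W_top n i (bar f)"
proof -
  have n: "n \<ge> 1" and i1: "i \<le> n" using i by auto
  have t: "invert_qt (tt powi (int i - int n)) * inverse tt ^ (n - i) = 1"
  proof -
    have "inverse tt ^ (n - i) = tt powi (int i - int n)"
      using i1 by (simp add: power_int_def power_inverse nat_diff_distrib)
    then show ?thesis by (simp add: invert_powi power_int_inverse)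
  qed
  define g where "g = omega n (compose_ops (map (\<lambda>j. inv (T_op j)) [1..<i]) f)"
  have "zvar i * bar (Y_op n i f) = Const (invert_qt (tt powi (int i - int n))) *
     (zvar i * bar (compose_ops (map T_op [i..<n]) g))"
    by (simp add: Y_op_def g_def bar_simps mult.left_commute)
  also have "\<dots> = Const (invert_qt (tt powi (int i - int n)) * inverse tt ^ (n - i)) * chain i n (zvar n * bar g)"
    unfolding zvar_bar_T_chain[OF i1] Const_mult by (simp only: mult.assoc)
  also have "bar g = cyc n (chain 1 i (bar f))"
    unfolding g_def bar_omega[OF n] bar_T_inv_chain ..
  finally show ?thesis unfolding t W_top_def by simp
qed

section \<open>Identification with the nonsymmetric Macdonald polynomials\<close>

definition comps_eq :: "nat \<Rightarrow> nat \<Rightarrow> (nat \<Rightarrow> nat) set" where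
  "comps_eq n d = {\<nu>. composition n \<nu> \<and> weight n \<nu> = d}"

lemma finite_comps_eq [simp]: "finite (comps_eq n d)"
  by (rule finite_subset[OF _ finite_comps[of n d]]) (auto simp: comps_eq_def comps_def)

lemma interp_comps: "n \<ge> 1 \<Longrightarrow> \<nu> \<in> comps_eq n d \<Longrightarrow> interp n \<nu> (E_star n \<nu>) (E_top n \<nu>)"
  by (rule interp_E_star) (auto simp: comps_eq_def)

lemma comps_split: "comps n d = comps_eq n d \<union> (comps n d - comps_eq n d)" "comps_eq n d \<subseteq> comps n d"
  by (auto simp: comps_eq_def comps_def)

text \<open>In the expansion of g by interpolation polynomials only the degree d part matters: those
  of smaller weight drop out, the others leave their top components.\<close>

lemma top_span:
  assumes n: "n \<ge> 1" and g: "g \<in> graded n {d}"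
  shows "\<exists>c. g = (\<Sum>\<nu>\<in>comps_eq n d. Const (c \<nu>) * E_top n \<nu>)"
proof -
  have "g \<in> graded n {..d}" by (rule graded_mono[OF g]) auto
  then obtain c where c: "g = (\<Sum>\<nu>\<in>comps n d. Const (c \<nu>) * E_star n \<nu>)"
    using interp_span[OF n] by blast
  let ?S = "\<Sum>\<nu>\<in>comps_eq n d. Const (c \<nu>) * E_top n \<nu>"
  have "g = (\<Sum>\<nu>\<in>comps_eq n d. Const (c \<nu>) * E_star n \<nu>) + (\<Sum>\<nu>\<in>comps n d - comps_eq n d. Const (c \<nu>) * E_star n \<nu>)"
    unfolding c by (subst sum.subset_diff[OF comps_split(2)]) (auto simp: add.commute)
  then have "g - ?S = (\<Sum>\<nu>\<in>comps_eq n d. Const (c \<nu>) * (E_star n \<nu> - E_top n \<nu>)) + (\<Sum>\<nu>\<in>comps n d - comps_eq n d. Const (c \<nu>) * E_star n \<nu>)"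
    by (simp add: right_diff_distrib sum_subtractf)
  also have "\<dots> \<in> graded n {..<d}"
  proof (intro graded_add graded_sum graded_Const_mult)
    fix \<nu> assume "\<nu> \<in> comps_eq n d"
    then show "E_star n \<nu> - E_top n \<nu> \<in> graded n {..<d}"
      using interp_comps[OF n, of \<nu> d] by (auto simp: interp_def comps_eq_def)
  next
    fix \<nu> assume "\<nu> \<in> comps n d - comps_eq n d"
    then have "composition n \<nu>" "weight n \<nu> < d" by (auto simp: comps_def comps_eq_def)
    then show "E_star n \<nu> \<in> graded n {..<d}"
      using graded_mono[OF interp_graded[OF interp_E_star[OF n]], of \<nu> "{..<d}"] by (simp add: subset_iff)
  qed
  finally have 1: "g - ?S \<in> graded n {..<d}" .
  have "?S \<in> graded n {d}"
  proof (intro graded_sum graded_Const_mult)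
    fix \<nu> assume "\<nu> \<in> comps_eq n d"
    then show "E_top n \<nu> \<in> graded n {d}"
      using interp_comps[OF n, of \<nu> d] by (auto simp: interp_def comps_eq_def)
  qed
  then have "g - ?S = 0" by (intro graded_disjoint[OF 1 graded_diff[OF g]]) auto
  then show ?thesis by auto
qed

text \<open>If the top components cancel, the same combination of interpolation polynomials has
  degree below d and vanishes at all points of degree below d. So it is zero, and its value at \<nu>
  is \<open>c \<nu>\<close> times a nonzero self-value.\<close>

lemma top_independent:
  assumes n: "n \<ge> 1" and eq: "(\<Sum>\<nu>\<in>comps_eq n d. Const (c \<nu>) * E_top n \<nu>) = 0" and \<nu>: "\<nu> \<in> comps_eq n d"
  shows "c \<nu> = 0"
proof -
  let ?F = "\<Sum>\<nu>\<in>comps_eq n d. Const (c \<nu>) * E_star n \<nu>"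
  have v: "val n (E_star n \<kappa>) \<mu> = (if \<mu> = \<kappa> then self_val n \<kappa> else 0)"
    if "\<kappa> \<in> comps_eq n d" "composition n \<mu>" "weight n \<mu> \<le> d" for \<kappa> \<mu>
    using interp_comps[OF n, of \<kappa> d] that by (auto simp: interp_def comps_eq_def)
  have "?F = (\<Sum>\<nu>\<in>comps_eq n d. Const (c \<nu>) * (E_star n \<nu> - E_top n \<nu>))"
    using eq by (simp add: right_diff_distrib sum_subtractf)
  also have "\<dots> \<in> graded n {..<d}"
  proof (intro graded_sum graded_Const_mult)
    fix \<nu> assume "\<nu> \<in> comps_eq n d"
    then show "E_star n \<nu> - E_top n \<nu> \<in> graded n {..<d}"
      using interp_comps[OF n, of \<nu> d] by (auto simp: interp_def comps_eq_def)
  qed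
  finally have "?F = 0"
  proof (rule vanish_imp_zero[OF n])
    show "vanish n d ?F"
      unfolding vanish_def
    proof (intro allI impI)
      fix \<mu> assume "composition n \<mu>" "weight n \<mu> < d"
      then show "val n ?F \<mu> = 0"
        unfolding val_simps by (intro sum.neutral ballI) (auto simp: v comps_eq_def)
    qed
  qed
  then have "0 = val n ?F \<nu>" by (simp add: val_def)
  also have "\<dots> = (\<Sum>\<kappa>\<in>comps_eq n d. if \<kappa> = \<nu> then c \<nu> * self_val n \<nu> else 0)"
    unfolding val_simps using \<nu> by (intro sum.cong) (auto simp: v comps_eq_def)
  also have "\<dots> = c \<nu> * self_val n \<nu>" using \<nu> by simp
  finally show ?thesis using self_val_nonzero by simp
qed

lemma W_top_sum:
  assumes i: "i \<in> {1..n}"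
  shows "W_top n i (\<Sum>a\<in>A. Const (c a) * f a) = (\<Sum>a\<in>A. Const (c a) * W_top n i (f a))"
proof -
  have i1: "1 \<le> i" "i \<le> n" using i by auto
  have add: "W_top n i (f + g) = W_top n i f + W_top n i g" for f g
    unfolding W_top_def chain_additive(1)[OF i1(1)] cyc_add distrib_left chain_additive(1)[OF i1(2)] ..
  have mult: "W_top n i (Const c * f) = Const c * W_top n i f" for f c
    unfolding W_top_def chain_additive(3)[OF i1(1)] cyc_mult cyc_Const
    by (simp only: mult.left_commute[of "zvar n"] chain_additive(3)[OF i1(2)])
  have "W_top n i 0 = 0" using mult[of 0 0] by simp
  then show ?thesis
    by (induction A rule: infinite_finite_induct) (simp_all add: add mult)
qed

lemma invert_eigenval: "invert_qt (eigenval n \<eta> i) = inverse (eigenval n \<eta> i)"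
  by (simp add: eigenval_def invert_mult invert_power invert_powi power_inverse power_int_inverse)

lemma comp_prec_irrefl: "\<not> comp_prec n \<eta> \<eta>"
  by (simp add: comp_prec_def dominated_def)

lemma coef_zpower_sum:
  assumes "finite A" "\<And>\<nu>. \<nu> \<in> A \<Longrightarrow> composition n \<nu>" "supp m \<subseteq> {1..n}"
  shows "coef (\<Sum>\<nu>\<in>A. Const (b \<nu>) * zpower n \<nu>) m = (if coef m \<in> A then b (coef m) else 0)"
proof -
  have "coef (\<Sum>\<nu>\<in>A. Const (b \<nu>) * zpower n \<nu>) m = (\<Sum>\<nu>\<in>A. if \<nu> = coef m then b (coef m) else 0)"
    unfolding lookup_sum
  proof (rule sum.cong)
    fix \<nu> assume "\<nu> \<in> A"
    then have "expo n \<nu> = m \<longleftrightarrow> \<nu> = coef m"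
      using assms by (metis coef_expo_composition expo_coef)
    then show "coef (Const (b \<nu>) * zpower n \<nu>) m = (if \<nu> = coef m then b (coef m) else 0)"
      by (auto simp: coef_Const_mult zpower_eq lookup_single when_def)
  qed simp
  then show ?thesis using assms by simp
qed

lemma finite_prec: "finite {\<nu>. composition n \<nu> \<and> comp_prec n \<nu> \<eta>}"
  by (rule finite_subset[OF _ finite_comps_eq[of n "weight n \<eta>"]]) (auto simp: comps_eq_def comp_prec_def)

text \<open>
  Uniqueness: the top components \<open>E_top n \<nu>\<close> form a basis on which the joint eigenvalues are
  pairwise distinct.
\<close>

lemma macdonald_E_eq:
  assumes n: "n \<ge> 1" and \<eta>: "composition n \<eta>"
  shows "macdonald_E n \<eta> = bar (E_top n \<eta>)"
  unfolding macdonald_E_def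
proof (rule the_equality)
  let ?G = "E_top n \<eta>" and ?A = "{\<nu>. composition n \<nu> \<and> comp_prec n \<nu> \<eta>}" and ?d = "weight n \<eta>"
  note I = interp_E_star[OF n \<eta>]
  have G: "?G \<in> graded n {?d}" and G1: "coef ?G (expo n \<eta>) = 1" and Gle: "\<And>m. m \<in> supp ?G \<Longrightarrow> bruhat_le n (coef m) \<eta>"
    using I by (auto simp: interp_def)
  show "(\<forall>i\<in>{1..n}. Y_op n i (bar ?G) = Const (eigenval n \<eta> i) * bar ?G) \<and>
    (\<exists>b. bar ?G = zpower n \<eta> + (\<Sum>\<nu>\<in>?A. Const (b \<nu>) * zpower n \<nu>))"
  proof (intro conjI ballI exI)
    fix i assume i: "i \<in> {1..n}"
    have "zvar i * bar (Y_op n i (bar ?G)) = zvar i * (Const (inverse (eigenval n \<eta> i)) * ?G)"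
      unfolding zvar_bar_Y_op[OF i] bar_bar interp_eigen_top[OF n \<eta> I i] by (simp only: mult_ac)
    then have "bar (Y_op n i (bar ?G)) = bar (Const (eigenval n \<eta> i) * bar ?G)"
      by (simp add: bar_simps invert_eigenval)
    then show "Y_op n i (bar ?G) = Const (eigenval n \<eta> i) * bar ?G" by (rule bar_inj)
  next
    show "bar ?G = zpower n \<eta> + (\<Sum>\<nu>\<in>?A. Const (coef (bar ?G) (expo n \<nu>)) * zpower n \<nu>)"
    proof (rule poly_mapping_eqI)
      fix m
      show "coef (bar ?G) m = coef (zpower n \<eta> + (\<Sum>\<nu>\<in>?A. Const (coef (bar ?G) (expo n \<nu>)) * zpower n \<nu>)) m"
      proof (cases "supp m \<subseteq> {1..n}")
        case True
        have c: "composition n (coef m)" and e: "expo n (coef m) = m"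
          using composition_coef[OF True] expo_coef[OF True] by auto
        have "coef (bar ?G) m = 0" if "\<not> comp_prec n (coef m) \<eta>" "coef m \<noteq> \<eta>"
        proof (rule ccontr)
          assume "coef (bar ?G) m \<noteq> 0"
          then have "m \<in> supp ?G" by (auto simp: in_keys_iff)
          then show False using bruhat_le_imp_prec[OF c \<eta> Gle] that by blast
        qed
        moreover have "expo n \<eta> = m \<longleftrightarrow> coef m = \<eta>" using e \<eta> by auto
        moreover have "coef (\<Sum>\<nu>\<in>?A. Const (coef (bar ?G) (expo n \<nu>)) * zpower n \<nu>) m
            = (if coef m \<in> ?A then coef (bar ?G) (expo n (coef m)) else 0)"
          by (rule coef_zpower_sum[OF finite_prec _ True]) simp
        ultimately show ?thesis
          using c e G1 comp_prec_irrefl[of n \<eta>]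
          by (auto simp only: lookup_add zpower_eq[of n \<eta>] lookup_single when_def coef_bar invert_1
            mem_Collect_eq split: if_splits)
      next
        case False
        have "coef (zpower n \<nu>) m = 0" for \<nu>
          using False supp_expo[of n \<nu>] by (auto simp: zpower_eq lookup_single when_def)
        moreover have "coef ?G m = 0" using False G by (auto simp: graded_def in_keys_iff)
        ultimately show ?thesis by (simp add: lookup_add lookup_sum coef_Const_mult)
      qed
    qed
  qed
next
  let ?G = "E_top n \<eta>" and ?A = "{\<nu>. composition n \<nu> \<and> comp_prec n \<nu> \<eta>}" and ?d = "weight n \<eta>"
  fix f
  assume f: "(\<forall>i\<in>{1..n}. Y_op n i f = Const (eigenval n \<eta> i) * f) \<and>
    (\<exists>b. f = zpower n \<eta> + (\<Sum>\<nu>\<in>?A. Const (b \<nu>) * zpower n \<nu>))"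
  then obtain b where b: "f = zpower n \<eta> + (\<Sum>\<nu>\<in>?A. Const (b \<nu>) * zpower n \<nu>)" by blast
  have zp: "zpower n \<nu> \<in> graded n {weight n \<nu>}" for \<nu>
    using supp_expo[of n \<nu>] by (auto simp: graded_def zpower_eq tdeg_expo)
  have "f \<in> graded n {?d}"
    unfolding b
  proof (intro graded_add graded_sum graded_Const_mult zp)
    fix \<nu> assume "\<nu> \<in> ?A"
    then show "zpower n \<nu> \<in> graded n {?d}" using zp[of \<nu>] by (simp add: comp_prec_def)
  qed
  then have g: "bar f \<in> graded n {?d}" by (auto simp: graded_def in_keys_iff)
  obtain c where c: "bar f = (\<Sum>\<nu>\<in>comps_eq n ?d. Const (c \<nu>) * E_top n \<nu>)"
    using top_span[OF n g] by blast
  \<comment> \<open>Some coordinate i separates \<nu> from \<eta>. Comparing the equation for f at i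
    with those of the top components gives \<open>c \<nu>\<close> times a nonzero difference of
    inverse eigenvalues equal to 0.\<close>
  have c0: "c \<nu> = 0" if \<nu>: "\<nu> \<in> comps_eq n ?d" "\<nu> \<noteq> \<eta>" for \<nu>
  proof -
    have "composition n \<nu>" using \<nu> by (simp add: comps_eq_def)
    then obtain i where i: "i \<in> {1..n}" "eigenval n \<nu> i \<noteq> eigenval n \<eta> i"
      using composition_eqI[OF _ \<eta>] \<nu> by blast
    have "zvar i * bar (Y_op n i f) = zvar i * (Const (inverse (eigenval n \<eta> i)) * bar f)"
      using f i(1) by (simp add: bar_simps invert_eigenval)
    then have "(\<Sum>\<nu>\<in>comps_eq n ?d. Const (c \<nu>) * W_top n i (E_top n \<nu>)) = zvar i * (Const (inverse (eigenval n \<eta> i)) * bar f)"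
      unfolding zvar_bar_Y_op[OF i(1)] c W_top_sum[OF i(1)] .
    moreover have "Const (c \<nu>) * W_top n i (E_top n \<nu>) = zvar i * (Const (c \<nu> * inverse (eigenval n \<nu> i)) * E_top n \<nu>)"
      if "\<nu> \<in> comps_eq n ?d" for \<nu>
      using interp_eigen_top[OF n _ interp_comps[OF n that] i(1)] that
      by (simp add: comps_eq_def Const_mult mult_ac)
    ultimately have "zvar i * (\<Sum>\<nu>\<in>comps_eq n ?d. Const (c \<nu> * inverse (eigenval n \<nu> i)) * E_top n \<nu>)
      = zvar i * (Const (inverse (eigenval n \<eta> i)) * bar f)"
      by (simp add: sum_distrib_left)
    then have "(\<Sum>\<nu>\<in>comps_eq n ?d. Const (c \<nu> * inverse (eigenval n \<nu> i)) * E_top n \<nu>)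
      = Const (inverse (eigenval n \<eta> i)) * bar f"
      by (simp only: mult_left_cancel[OF zvar_neq_0])
    also have "\<dots> = (\<Sum>\<nu>\<in>comps_eq n ?d. Const (c \<nu> * inverse (eigenval n \<eta> i)) * E_top n \<nu>)"
      unfolding c by (simp add: sum_distrib_left Const_mult mult_ac)
    finally have "(\<Sum>\<nu>\<in>comps_eq n ?d. Const (c \<nu> * inverse (eigenval n \<nu> i)) * E_top n \<nu>)
      = (\<Sum>\<nu>\<in>comps_eq n ?d. Const (c \<nu> * inverse (eigenval n \<eta> i)) * E_top n \<nu>)" .
    then have "(\<Sum>\<nu>\<in>comps_eq n ?d. Const (c \<nu> * (inverse (eigenval n \<nu> i) - inverse (eigenval n \<eta> i))) * E_top n \<nu>) = 0"
      by (simp add: right_diff_distrib Const_diff left_diff_distrib sum_subtractf)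
    from top_independent[OF n this \<nu>(1)] i(2) show ?thesis by simp
  qed
  have "bar f = (\<Sum>\<nu>\<in>comps_eq n ?d. if \<nu> = \<eta> then Const (c \<eta>) * E_top n \<eta> else 0)"
    unfolding c by (intro sum.cong) (auto simp: c0)
  also have "\<dots> = Const (c \<eta>) * E_top n \<eta>"
  proof -
    have "\<eta> \<in> comps_eq n ?d" using \<eta> by (simp add: comps_eq_def)
    then show ?thesis by simp
  qed
  finally have J: "bar f = Const (c \<eta>) * E_top n \<eta>" .
  \<comment> \<open>The eigenvalues leave a scalar free; the leading coefficient fixes it.\<close>
  have "coef f (expo n \<eta>) = 1"
  proof -
    have "coef (\<Sum>\<nu>\<in>?A. Const (b \<nu>) * zpower n \<nu>) (expo n \<eta>)
        = (if coef (expo n \<eta>) \<in> ?A then b (coef (expo n \<eta>)) else 0)"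
      by (rule coef_zpower_sum[OF finite_prec _ supp_expo]) simp
    then show ?thesis
      unfolding b using \<eta> comp_prec_irrefl[of n \<eta>] by (simp add: lookup_add zpower_eq[of n \<eta>])
  qed
  then have "coef (bar f) (expo n \<eta>) = 1" by simp
  then have "c \<eta> = 1" using interp_E_star[OF n \<eta>] by (simp add: J coef_Const_mult interp_def)
  then have "bar f = E_top n \<eta>" using J by simp
  then show "f = bar (E_top n \<eta>)" by (metis bar_bar)
qed

lemma macdonald_E_inv_eq: "n \<ge> 1 \<Longrightarrow> composition n \<eta> \<Longrightarrow> macdonald_E_inv n \<eta> = E_top n \<eta>"
  by (simp add: macdonald_E_inv_def macdonald_E_eq)

lemma pieri_interp:
  assumes n: "n \<ge> 1" and \<eta>: "composition n \<eta>"
  shows "e1 n * E_top n \<eta> = (\<Sum>\<nu>\<in>comps_eq n (Suc (weight n \<eta>)).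
    Const (((\<Sum>i=1..n. eigenval n \<nu> i) - (\<Sum>i=1..n. eigenval n \<eta> i)) * val n (E_star n \<eta>) \<nu> / self_val n \<nu>) * E_top n \<nu>)"
proof -
  let ?d = "weight n \<eta>" and ?S = "comps_eq n (Suc (weight n \<eta>))"
  define a where "a \<nu> = ((\<Sum>i=1..n. eigenval n \<nu> i) - (\<Sum>i=1..n. eigenval n \<eta> i)) * val n (E_star n \<eta>) \<nu> / self_val n \<nu>" for \<nu>
  define h where "h = (e1 n - Const (\<Sum>i=1..n. eigenval n \<eta> i)) * E_star n \<eta>"
  note I = interp_E_star[OF n \<eta>]
  have F: "E_star n \<eta> \<in> graded n {..?d}" by (rule interp_graded[OF I])
  have e: "e1 n \<in> graded n {1}" unfolding e1_def by (intro graded_sum graded_zvar) auto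
  have he: "h = e1 n * E_star n \<eta> - Const (\<Sum>i=1..n. eigenval n \<eta> i) * E_star n \<eta>"
    by (simp add: h_def left_diff_distrib)
  have eF: "e1 n * E_star n \<eta> \<in> graded n {..Suc ?d}"
    by (rule graded_mult[OF e F]) auto
  have cF: "Const c * E_star n \<eta> \<in> graded n {..<Suc ?d}" for c
    unfolding lessThan_Suc_atMost by (rule graded_Const_mult[OF F])
  have hg: "h \<in> graded n {..Suc ?d}"
    unfolding he by (intro graded_diff eF graded_mono[OF cF]) auto
  have FS: "E_star n \<nu> \<in> graded n {..Suc ?d}" "E_top n \<nu> \<in> graded n {Suc ?d}" "E_star n \<nu> - E_top n \<nu> \<in> graded n {..<Suc ?d}"
    "\<And>\<mu>. composition n \<mu> \<Longrightarrow> weight n \<mu> \<le> Suc ?d \<Longrightarrow> val n (E_star n \<nu>) \<mu> = (if \<mu> = \<nu> then self_val n \<nu> else 0)"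
    if "\<nu> \<in> ?S" for \<nu>
    using interp_comps[OF n that] interp_graded[OF interp_comps[OF n that]] that
    by (auto simp: interp_def comps_eq_def)
  define r where "r = h - (\<Sum>\<nu>\<in>?S. Const (a \<nu>) * E_star n \<nu>)"
  have vh: "val n h \<mu> = ((\<Sum>i=1..n. eigenval n \<mu> i) - (\<Sum>i=1..n. eigenval n \<eta> i)) * val n (E_star n \<eta>) \<mu>" for \<mu>
    by (simp add: h_def val_simps e1_def)
  have "r = 0"
  proof (rule vanishing_imp_zero[OF n])
    show "r \<in> graded n {..Suc ?d}"
      unfolding r_def by (intro graded_diff hg graded_sum graded_Const_mult FS)
    fix \<mu> assume "\<mu> \<in> comps n (Suc ?d)"
    then have \<mu>: "composition n \<mu>" "weight n \<mu> \<le> Suc ?d" by (auto simp: comps_def)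
    have "val n r \<mu> = val n h \<mu> - (\<Sum>\<nu>\<in>?S. if \<nu> = \<mu> then a \<mu> * self_val n \<mu> else 0)"
      unfolding r_def val_simps using FS(4)[OF _ \<mu>] by (intro arg_cong2[where f = minus] refl sum.cong) auto
    also have "\<dots> = 0"
    proof (cases "\<mu> \<in> ?S")
      case True
      then show ?thesis using self_val_nonzero[of n \<mu>] by (simp add: vh a_def)
    next
      \<comment> \<open>Only \<eta> could contribute here, and there the difference of coordinate
        sums is 0; this is why the sum is subtracted in \<open>h\<close>.\<close>
      case False
      then have "weight n \<mu> \<le> ?d" using \<mu> by (auto simp: comps_eq_def)
      then have "val n (E_star n \<eta>) \<mu> = (if \<mu> = \<eta> then self_val n \<eta> else 0)" using I \<mu> by (simp add: interp_def)
      then show ?thesis using False by (simp add: vh)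
    qed
    finally show "val n r \<mu> = 0" .
  qed
  then have hs: "h = (\<Sum>\<nu>\<in>?S. Const (a \<nu>) * E_star n \<nu>)" by (simp add: r_def)
  \<comment> \<open>The subtracted constant and all differences between \<open>E_star\<close> and
    \<open>E_top\<close> contribute only in lower degree.\<close>
  have "e1 n * E_top n \<eta> - (\<Sum>\<nu>\<in>?S. Const (a \<nu>) * E_top n \<nu>)
    = (h - (\<Sum>\<nu>\<in>?S. Const (a \<nu>) * E_top n \<nu>)) + Const (\<Sum>i=1..n. eigenval n \<eta> i) * E_star n \<eta> - e1 n * (E_star n \<eta> - E_top n \<eta>)"
    by (simp add: he algebra_simps)
  also have "h - (\<Sum>\<nu>\<in>?S. Const (a \<nu>) * E_top n \<nu>) = (\<Sum>\<nu>\<in>?S. Const (a \<nu>) * (E_star n \<nu> - E_top n \<nu>))"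
    unfolding hs by (simp add: right_diff_distrib sum_subtractf)
  also have "(\<Sum>\<nu>\<in>?S. Const (a \<nu>) * (E_star n \<nu> - E_top n \<nu>)) + Const (\<Sum>i=1..n. eigenval n \<eta> i) * E_star n \<eta> - e1 n * (E_star n \<eta> - E_top n \<eta>)
     \<in> graded n {..<Suc ?d}"
  proof -
    have "E_star n \<eta> - E_top n \<eta> \<in> graded n {..<?d}" using I by (simp add: interp_def)
    from graded_mult[OF e this] have "e1 n * (E_star n \<eta> - E_top n \<eta>) \<in> graded n {..<Suc ?d}" by auto
    moreover have "(\<Sum>\<nu>\<in>?S. Const (a \<nu>) * (E_star n \<nu> - E_top n \<nu>)) \<in> graded n {..<Suc ?d}"
      by (intro graded_sum graded_Const_mult FS(3))
    ultimately show ?thesis by (intro graded_diff[OF graded_add[OF _ cF]])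
  qed
  finally have 1: "e1 n * E_top n \<eta> - (\<Sum>\<nu>\<in>?S. Const (a \<nu>) * E_top n \<nu>) \<in> graded n {..<Suc ?d}" .
  have 2: "e1 n * E_top n \<eta> - (\<Sum>\<nu>\<in>?S. Const (a \<nu>) * E_top n \<nu>) \<in> graded n {Suc ?d}"
  proof (intro graded_diff graded_sum graded_Const_mult FS(2))
    have "E_top n \<eta> \<in> graded n {?d}" using I by (simp add: interp_def)
    from graded_mult[OF e this] show "e1 n * E_top n \<eta> \<in> graded n {Suc ?d}" by auto
  qed
  have "e1 n * E_top n \<eta> - (\<Sum>\<nu>\<in>?S. Const (a \<nu>) * E_top n \<nu>) = 0"
    by (rule graded_disjoint[OF 1 2]) auto
  then show ?thesis by (simp add: a_def)
qed

section \<open>Maximal sets\<close>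

text \<open>One formula for both maximality conditions and, at \<open>Suc j\<close>, for the new
  entries in \<open>shift_comp\<close>. The default \<open>z\<close> is the wrapped-around value:
  \<open>\<eta> (Min I) + 1\<close> for entries, q times the coordinate at \<open>Min I\<close> for
  spectral points.\<close>

definition nxt :: "nat set \<Rightarrow> (nat \<Rightarrow> 'a) \<Rightarrow> 'a \<Rightarrow> nat \<Rightarrow> 'a" where
  "nxt I g z j = (if \<exists>i\<in>I. j \<le> i then g (LEAST i. i \<in> I \<and> j \<le> i) else z)"

lemma nxt_mem: "j \<in> I \<Longrightarrow> nxt I g z j = g j"
proof -
  assume j: "j \<in> I"
  then have "(LEAST i. i \<in> I \<and> j \<le> i) = j" by (intro Least_equality) auto
  then show ?thesis using j by (auto simp: nxt_def)
qed

lemma nxt_notmem: "j \<notin> I \<Longrightarrow> nxt I g z j = nxt I g z (Suc j)"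
proof -
  assume "j \<notin> I"
  then have "i \<in> I \<and> j \<le> i \<longleftrightarrow> i \<in> I \<and> Suc j \<le> i" for i
    by (metis Suc_leI le_eq_less_or_eq Suc_leD)
  then show ?thesis by (simp only: nxt_def Bex_def)
qed

lemma nxt_beyond: "(\<And>i. i \<in> I \<Longrightarrow> i < j) \<Longrightarrow> nxt I g z j = z"
  unfolding nxt_def by (meson leD)

lemma nxt_first: "finite I \<Longrightarrow> I \<noteq> {} \<Longrightarrow> j \<le> Min I \<Longrightarrow> nxt I g z j = g (Min I)"
proof -
  assume I: "finite I" "I \<noteq> {}" and j: "j \<le> Min I"
  have "(LEAST i. i \<in> I \<and> j \<le> i) = Min I"
    using I j by (intro Least_equality) auto
  then show ?thesis using I j Min_in[OF I] by (auto simp: nxt_def)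
qed

lemma nxt_map: "f (nxt I g z j) = nxt I (\<lambda>i. f (g i)) (f z) j"
  by (simp add: nxt_def)

text \<open>Polymorphic form of \<open>shift_comp\<close>, so that compositions, spectral points and
  pairs of both are shifted by the same operation.\<close>

definition shifted :: "nat set \<Rightarrow> (nat \<Rightarrow> 'a) \<Rightarrow> 'a \<Rightarrow> nat \<Rightarrow> 'a" where
  "shifted I g z j = (if j \<in> I then nxt I g z (Suc j) else g j)"

text \<open>Along I the values are permuted, except that the one at \<open>Min I\<close> leaves and
  \<open>w\<close> enters. The induction starts at the right end, with \<open>nxt\<close> holding
  the value still to be placed.\<close>

lemma (in comm_monoid_set) shifted:
  assumes I: "I \<noteq> {}" "I \<subseteq> {1..n}"
  shows "F (\<lambda>j. h (shifted I g w j)) {1..n} \<^bold>* h (g (Min I)) = F (\<lambda>j. h (g j)) {1..n} \<^bold>* h w"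
proof -
  have fin: "finite I" using I finite_subset by blast
  have "F (\<lambda>j. h (shifted I g w j)) {k..n} \<^bold>* h (nxt I g w k) = F (\<lambda>j. h (g j)) {k..n} \<^bold>* h w"
    if "k \<le> Suc n" for k
    using that
  proof (induction "Suc n - k" arbitrary: k)
    case 0
    then have "nxt I g w k = w" using I by (intro nxt_beyond) auto
    then show ?case using 0 by simp
  next
    case (Suc l)
    then have k: "{k..n} = insert k {Suc k..n}" by auto
    have IH: "F (\<lambda>j. h (shifted I g w j)) {Suc k..n} \<^bold>* h (nxt I g w (Suc k)) = F (\<lambda>j. h (g j)) {Suc k..n} \<^bold>* h w"
      using Suc by (intro Suc.hyps(1)) auto
    have *: "h (shifted I g w k) \<^bold>* (h (nxt I g w k) \<^bold>* r) = h (g k) \<^bold>* (h (nxt I g w (Suc k)) \<^bold>* r)" for r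
      by (simp add: shifted_def nxt_mem nxt_notmem left_commute)
    have "F (\<lambda>j. h (shifted I g w j)) {k..n} \<^bold>* h (nxt I g w k)
      = h (g k) \<^bold>* (F (\<lambda>j. h (shifted I g w j)) {Suc k..n} \<^bold>* h (nxt I g w (Suc k)))"
      using *[of "F (\<lambda>j. h (shifted I g w j)) {Suc k..n}"] unfolding k by (simp add: ac_simps)
    also have "\<dots> = F (\<lambda>j. h (g j)) {k..n} \<^bold>* h w"
      unfolding IH k by (simp add: ac_simps)
    finally show ?case .
  qed
  note * = this[of 1]
  have "1 \<le> Min I" using Min_in[OF fin I(1)] I(2) by auto
  then have "nxt I g w 1 = g (Min I)" by (rule nxt_first[OF fin I(1)])
  then show ?thesis using * by simp
qed

context
  fixes I :: "nat set" and n :: nat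
  assumes I: "I \<noteq> {}" "I \<subseteq> {1..n}"
begin

lemma finite_I: "finite I"
  using I finite_subset by blast

lemma card_pos: "card I \<ge> 1"
  using finite_I I by (simp add: Suc_le_eq card_gt_0_iff)

lemma elem_mem: "u \<in> {1..card I} \<Longrightarrow> elem I u \<in> I"
proof -
  assume u: "u \<in> {1..card I}"
  then have "sorted_list_of_set I ! (u - 1) \<in> set (sorted_list_of_set I)" using finite_I by (intro nth_mem) auto
  then show ?thesis using u finite_I by (simp add: elem_def)
qed

lemma elem_strict:
  assumes "u < v" "v \<in> {1..card I}"
  shows "elem I u < elem I v"
proof (cases "u = 0")
  case True
  then show ?thesis using elem_mem[OF assms(2)] I by (auto simp: elem_def[of I 0])
next
  case False
  then show ?thesis
    using assms sorted_wrt_nth_less[OF strict_sorted_list_of_set[of I], of "u - 1" "v - 1"] finite_I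
    by (auto simp: elem_def)
qed

lemma elem_image: "elem I ` {1..card I} = I"
proof
  show "I \<subseteq> elem I ` {1..card I}"
  proof
    fix i assume "i \<in> I"
    then have "i \<in> set (sorted_list_of_set I)" using finite_I by simp
    then obtain u where "u < card I" "sorted_list_of_set I ! u = i"
      by (metis in_set_conv_nth length_sorted_list_of_set)
    then show "i \<in> elem I ` {1..card I}" by (intro image_eqI[of _ _ "Suc u"]) (auto simp: elem_def)
  qed
qed (use elem_mem in auto)

lemma elem_inj: "inj_on (elem I) {1..card I}"
  using elem_strict by (intro linorder_inj_onI) (auto simp: neq_iff)

lemma elem_1: "elem I 1 = Min I"
proof (rule Min_eqI[symmetric, OF finite_I])
  show "elem I 1 \<in> I" using card_pos by (intro elem_mem) auto
  fix i assume "i \<in> I"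
  then obtain u where "u \<in> {1..card I}" "i = elem I u" using elem_image by blast
  then show "elem I 1 \<le> i" using elem_strict[of 1 u] by (cases "u = 1") auto
qed

lemma nxt_elem:
  assumes u: "u \<in> {1..card I}" and "elem I (u - 1) < j" "j \<le> elem I u"
  shows "nxt I g z j = g (elem I u)"
proof -
  have "(LEAST i. i \<in> I \<and> j \<le> i) = elem I u"
  proof (rule Least_equality)
    fix i assume i: "i \<in> I \<and> j \<le> i"
    then obtain v where v: "v \<in> {1..card I}" "i = elem I v" using elem_image by blast
    have "\<not> v < u"
    proof
      assume "v < u"
      then have "elem I v \<le> elem I (u - 1)"
      proof (cases "v = u - 1")
        case False
        with \<open>v < u\<close> u have "v < u - 1" "u - 1 \<in> {1..card I}" by auto
        then show ?thesis using elem_strict by (simp add: less_imp_le)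
      qed simp
      then show False using i v assms by auto
    qed
    then show "elem I u \<le> i" using elem_strict[of u v] v by (cases "u = v") auto
  qed (use assms elem_mem in auto)
  then show ?thesis using assms elem_mem[OF u] by (auto simp: nxt_def)
qed

lemma nxt_after_last: "elem I (card I) < j \<Longrightarrow> nxt I g z j = z"
proof (rule nxt_beyond)
  fix i assume j: "elem I (card I) < j" and "i \<in> I"
  then obtain v where v: "v \<in> {1..card I}" "i = elem I v" using elem_image by blast
  then show "i < j" using elem_strict[of v "card I"] card_pos j by (cases "v = card I") auto
qed

lemma nxt_Suc_elem:
  assumes u: "u \<in> {1..card I}"
  shows "nxt I g z (Suc (elem I u)) = (if u < card I then g (elem I (Suc u)) else z)"
proof (cases "u < card I")
  case True
  then show ?thesis using nxt_elem[of "Suc u" "Suc (elem I u)" g z] elem_strict[of u "Suc u"] by simp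
next
  case False
  then show ?thesis using u by (auto intro: nxt_after_last)
qed

lemma gap_cases:
  "{1..n} - I = (\<Union>u\<in>{1..card I}. {elem I (u - 1)<..<elem I u}) \<union> {elem I (card I)<..n}" (is "_ = ?R")
proof
  show "?R \<subseteq> {1..n} - I"
  proof
    fix j assume "j \<in> ?R"
    then show "j \<in> {1..n} - I"
    proof
      assume "j \<in> (\<Union>u\<in>{1..card I}. {elem I (u - 1)<..<elem I u})"
      then obtain u where u: "u \<in> {1..card I}" "elem I (u - 1) < j" "j < elem I u" by auto
      have "j \<notin> I"
        using nxt_mem[of j I id undefined] nxt_elem[OF u(1,2), of id undefined] u(3) by auto
      then show ?thesis using elem_mem[OF u(1)] u I by fastforce
    next
      assume j: "j \<in> {elem I (card I)<..n}"
      have "j \<notin> I"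
      proof
        assume "j \<in> I"
        then show False
          using nxt_mem[of j I "\<lambda>_. 0" "1 :: nat"] nxt_after_last[of j "\<lambda>_. 0" "1 :: nat"] j by simp
      qed
      then show ?thesis using j by auto
    qed
  qed
  show "{1..n} - I \<subseteq> ?R"
  proof
    fix j assume j: "j \<in> {1..n} - I"
    show "j \<in> ?R"
    proof (cases "elem I (card I) < j")
      case False
      define u where "u = (LEAST u. j \<le> elem I u)"
      have ju: "j \<le> elem I u" unfolding u_def using False by (intro LeastI[of "\<lambda>u. j \<le> elem I u" "card I"]) simp
      have "u \<le> card I" unfolding u_def using False by (intro Least_le) simp
      moreover have "u \<noteq> 0" using ju j by (cases u) (simp_all add: elem_def)
      ultimately have u: "u \<in> {1..card I}" by auto
      have "\<not> j \<le> elem I (u - 1)"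
        using not_less_Least[of "u - 1" "\<lambda>u. j \<le> elem I u"] u by (simp add: u_def[symmetric])
      moreover have "j \<noteq> elem I u" using elem_mem[OF u] j by auto
      ultimately have "j \<in> {elem I (u - 1)<..<elem I u}" using ju by simp
      then show ?thesis using u by blast
    qed (use j in auto)
  qed
qed

text \<open>The gaps and the tail together make up the complement of I, and \<open>nxt\<close> is
  constant on each of them.\<close>

lemma maximal_sets_iff:
  "I \<in> maximal_sets n \<eta> \<longleftrightarrow> (\<forall>j\<in>{1..n} - I. \<eta> j \<noteq> nxt I \<eta> (\<eta> (Min I) + 1) j)"
proof -
  have "I \<in> maximal_sets n \<eta> \<longleftrightarrow>
    (\<forall>u\<in>{1..card I}. \<forall>j\<in>{elem I (u - 1)<..<elem I u}. \<eta> j \<noteq> nxt I \<eta> (\<eta> (Min I) + 1) j) \<and>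
    (\<forall>j\<in>{elem I (card I)<..n}. \<eta> j \<noteq> nxt I \<eta> (\<eta> (Min I) + 1) j)"
    unfolding maximal_sets_def elem_1[symmetric] using I
    by (auto simp: nxt_elem nxt_after_last simp del: One_nat_def)
  then show ?thesis unfolding gap_cases by blast
qed

lemma shift_comp_eq: "shift_comp I \<eta> = shifted I \<eta> (\<eta> (Min I) + 1)"
proof
  fix j
  show "shift_comp I \<eta> j = shifted I \<eta> (\<eta> (Min I) + 1) j"
  proof (cases "j \<in> I")
    case True
    then have "j \<in> elem I ` {1..card I}" unfolding elem_image .
    then obtain u where u: "u \<in> {1..card I}" "elem I u = j" by auto
    have "(THE k. k \<in> {1..card I} \<and> elem I k = j) = u"
    proof (rule the_equality)
      fix k assume "k \<in> {1..card I} \<and> elem I k = j"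
      then show "k = u" using inj_onD[OF elem_inj, of k u] u by simp
    qed (use u in simp)
    then show ?thesis
      using True nxt_Suc_elem[OF u(1), of \<eta> "\<eta> (Min I) + 1"] u(2) elem_1
      by (simp add: shift_comp_def shifted_def)
  qed (simp add: shift_comp_def shifted_def)
qed

text \<open>As \<open>ahat\<close> is homogeneous of degree 0, the division by q in the first factor
  moves to the other argument as a multiplication; the wrap-around is then another value of
  \<open>nxt\<close>.\<close>

lemma A_fun_eq: "A_fun I y = (\<Prod>j\<in>I. ahat (y j) (nxt I y (qq * y (Min I)) (Suc j)))"
proof -
  let ?s = "card I"
  have "(\<Prod>j\<in>I. ahat (y j) (nxt I y (qq * y (Min I)) (Suc j)))
     = (\<Prod>u=1..?s. ahat (y (elem I u)) (nxt I y (qq * y (Min I)) (Suc (elem I u))))"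
    by (subst elem_image[symmetric], subst prod.reindex[OF elem_inj]) simp
  also have "\<dots> = (\<Prod>u=1..?s. ahat (y (elem I u)) (if u < ?s then y (elem I (Suc u)) else qq * y (Min I)))"
    by (intro prod.cong refl) (simp add: nxt_Suc_elem)
  also have "{1..?s} = insert ?s {1..?s - 1}" using card_pos by auto
  also have "(\<Prod>u\<in>insert ?s {1..?s - 1}. ahat (y (elem I u)) (if u < ?s then y (elem I (Suc u)) else qq * y (Min I)))
    = ahat (y (elem I ?s)) (qq * y (Min I)) * (\<Prod>u=1..?s - 1. ahat (y (elem I u)) (y (elem I (u + 1))))"
    using card_pos by (subst prod.insert) (auto intro!: arg_cong2[where f = "(*)"] prod.cong)
  also have "ahat (y (elem I ?s)) (qq * y (Min I)) = ahat (y (elem I ?s) / qq) (y (elem I 1))"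
  proof -
    have "y (elem I ?s) / qq - y (elem I 1) = (y (elem I ?s) - qq * y (Min I)) / qq"
      unfolding elem_1 by (simp add: diff_divide_distrib)
    then show ?thesis unfolding ahat_def by simp
  qed
  finally show ?thesis by (simp add: A_fun_def)
qed

lemma B_fun_eq: "B_fun n I y = (qq * y (Min I) - tt powi (1 - int n)) *
   (\<Prod>j\<in>{1..n} - I. bhat (nxt I y (qq * y (Min I)) j) (y j))"
proof -
  let ?f = "\<lambda>j. bhat (nxt I y (qq * y (Min I)) j) (y j)"
  have "(\<Prod>j\<in>{1..n} - I. ?f j) = (\<Prod>j\<in>(\<Union>u\<in>{1..card I}. {elem I (u - 1)<..<elem I u}). ?f j) * (\<Prod>j\<in>{elem I (card I)<..n}. ?f j)"
    unfolding gap_cases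
  proof (rule prod.union_disjoint)
    show "(\<Union>u\<in>{1..card I}. {elem I (u - 1)<..<elem I u}) \<inter> {elem I (card I)<..n} = {}"
    proof (intro equals0I)
      fix j assume j: "j \<in> (\<Union>u\<in>{1..card I}. {elem I (u - 1)<..<elem I u}) \<inter> {elem I (card I)<..n}"
      then obtain u where "u \<in> {1..card I}" "elem I (u - 1) < j" "j \<le> elem I u" by auto
      then show False using nxt_elem[of u j "\<lambda>_. 0" "1 :: nat"] nxt_after_last[of j "\<lambda>_. 0" "1 :: nat"] j by auto
    qed
  qed auto
  also have "(\<Prod>j\<in>(\<Union>u\<in>{1..card I}. {elem I (u - 1)<..<elem I u}). ?f j) = (\<Prod>u\<in>{1..card I}. \<Prod>j\<in>{elem I (u - 1)<..<elem I u}. ?f j)"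
  proof (rule prod.UNION_disjoint)
    show "\<forall>u\<in>{1..card I}. \<forall>v\<in>{1..card I}. u \<noteq> v \<longrightarrow> {elem I (u - 1)<..<elem I u} \<inter> {elem I (v - 1)<..<elem I v} = {}"
    proof (intro ballI impI equals0I)
      fix u v j assume uv: "u \<in> {1..card I}" "v \<in> {1..card I}" "u \<noteq> v"
        and j: "j \<in> {elem I (u - 1)<..<elem I u} \<inter> {elem I (v - 1)<..<elem I v}"
      then have "elem I u = elem I v"
        using nxt_elem[of u j id undefined] nxt_elem[of v j id undefined] by auto
      then show False using uv inj_onD[OF elem_inj, of u v] by simp
    qed
  qed auto
  also have "\<dots> = (\<Prod>u\<in>{1..card I}. \<Prod>j\<in>{elem I (u - 1)<..<elem I u}. bhat (y (elem I u)) (y j))"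
    by (intro prod.cong refl) (auto simp: nxt_elem)
  also have "(\<Prod>j\<in>{elem I (card I)<..n}. ?f j) = (\<Prod>j\<in>{elem I (card I)<..n}. bhat (qq * y (elem I 1)) (y j))"
    unfolding elem_1 by (intro prod.cong refl) (auto simp: nxt_after_last)
  finally show ?thesis unfolding B_fun_def mult.assoc by (simp only: elem_1)
qed

end

section \<open>Values at the spectral points of the next degree\<close>

text \<open>
  The compositions met when the factors of \<^const>\<open>W_op\<close> are expanded one after another at
  \<open>c\<^sub>I(\<eta>)\<close>: \<open>path1\<close> before and \<open>path2\<close> after \<^const>\<open>phi\<close>. The entry at \<open>k\<close> is the one in motion, and
  the entries that later factors no longer touch already agree with \<open>\<eta>\<close>, shifted by one place in
  \<open>path1\<close>.
\<close>

definition path1 :: "nat set \<Rightarrow> nat \<Rightarrow> (nat \<Rightarrow> 'a) \<Rightarrow> 'a \<Rightarrow> nat \<Rightarrow> 'a" where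
  "path1 I k g w j = (if j < Min I then g j else if j < k then g (Suc j)
     else if j = k then nxt I g w (Suc k) else shifted I g w j)"

definition path2 :: "nat \<Rightarrow> nat \<Rightarrow> (nat \<Rightarrow> 'a) \<Rightarrow> nat \<Rightarrow> 'a" where
  "path2 m k g j = (if j < k then g j else if j = k then g m else if j \<le> m then g (j - 1) else g j)"

lemma path2_end: "path2 m m g = g"
  by (auto simp: path2_def)

lemma path2_step: "1 \<le> k \<Longrightarrow> k < m \<Longrightarrow> path2 m (Suc k) g = path2 m k g \<circ> transpose k (Suc k)"
  by (intro ext) (auto simp: path2_def transpose_def)

lemma path1_step_mem:
  assumes "Min I \<le> k" "Suc k \<in> I"
  shows "path1 I (Suc k) g w = path1 I k g w"
  using assms by (intro ext) (auto simp: path1_def shifted_def nxt_mem less_Suc_eq)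

lemma path1_step_notmem:
  assumes "Min I \<le> k" "Suc k \<notin> I"
  shows "path1 I (Suc k) g w = path1 I k g w \<circ> transpose k (Suc k)"
  using assms by (intro ext) (auto simp: path1_def shifted_def nxt_notmem[of "Suc k"] less_Suc_eq transpose_def)

text \<open>The branching rule for paths: stay, or swap two unequal entries. Swapping equal ones has
  weight 0.\<close>

lemma hecke_nonzero_cases:
  assumes "i \<in> {1..<n}" "val n (hecke i f) \<mu> \<noteq> 0"
  shows "val n f \<mu> \<noteq> 0 \<or> \<mu> i \<noteq> \<mu> (Suc i) \<and> val n f (\<mu> \<circ> transpose i (Suc i)) \<noteq> 0"
  using assms bhat_eigenval_equal[OF assms(1), of \<mu>] by (auto simp: val_hecke simp del: o_apply)

section \<open>Constraints on surviving paths\<close>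

locale interpolation =
  fixes n :: nat and \<eta> :: "nat \<Rightarrow> nat" and F G :: zpoly
  assumes n: "n \<ge> 1" and \<eta>: "composition n \<eta>" and I: "interp n \<eta> F G"
begin

abbreviation "y \<equiv> eigenval n \<eta>"
abbreviation "d \<equiv> weight n \<eta>"

lemma F_graded: "F \<in> graded n {..d}"
  by (rule interp_graded[OF I])

lemma val_F: "composition n \<mu> \<Longrightarrow> weight n \<mu> \<le> d \<Longrightarrow> val n F \<mu> = (if \<mu> = \<eta> then self_val n \<eta> else 0)"
  using I by (simp add: interp_def)

lemma chain_F_graded: "1 \<le> m \<Longrightarrow> m \<le> n \<Longrightarrow> chain 1 m F \<in> graded n {..d}"
  by (rule graded_chain[OF F_graded]) auto

text \<open>
  A place that no factor of the chain touches must already carry the coordinate of \<open>\<eta>\<close>, as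
  \<open>F\<close> has no other nonzero value in its degree.
\<close>

lemma chain_F_nonzero:
  assumes "1 \<le> k" "k \<le> m" "m \<le> n" "composition n \<mu>" "weight n \<mu> = d" "val n (chain k m F) \<mu> \<noteq> 0"
    "j \<in> {1..n}" "j < k \<or> j > m"
  shows "eigenval n \<mu> j = y j"
  using assms(1-6,8)
proof (induction "m - k" arbitrary: k \<mu>)
  case 0
  then show ?case using val_F[of \<mu>] by (auto split: if_splits)
next
  case (Suc l)
  then have k: "k \<in> {1..<n}" "k < m" by auto
  then have "val n (hecke k (chain (Suc k) m F)) \<mu> \<noteq> 0" using Suc.prems by (simp add: chain_less)
  from hecke_nonzero_cases[OF k(1) this] show ?case
  proof
    assume "val n (chain (Suc k) m F) \<mu> \<noteq> 0"
    then show ?case using Suc.prems Suc.hyps(2) by (intro Suc.hyps(1)[of "Suc k" \<mu>]) auto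
  next
    assume *: "\<mu> k \<noteq> \<mu> (Suc k) \<and> val n (chain (Suc k) m F) (\<mu> \<circ> transpose k (Suc k)) \<noteq> 0"
    have "eigenval n (\<mu> \<circ> transpose k (Suc k)) j = y j"
      using * Suc.prems Suc.hyps(2) composition_swap[OF k(1), of \<mu>] weight_swap[OF k(1), of \<mu>]
      by (intro Suc.hyps(1)[of "Suc k" "\<mu> \<circ> transpose k (Suc k)"]) (auto simp del: o_apply)
    then show ?case
      using eigenval_swap[OF k(1), of \<mu> j] * Suc.prems k(2) by (auto simp: transpose_def split: if_splits)
  qed
qed

text \<open>The analogue after \<open>phi\<close>: the places from m to k - 1 are out of reach.
  Through \<open>up\<close> they correspond to places beyond m before \<open>phi\<close>, whence the
  shift by one.\<close>

lemma phi_chain_nonzero: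
  assumes "1 \<le> m" "m \<le> k" "k \<le> n" "composition n \<mu>" "weight n \<mu> = Suc d"
    "val n (chain k n (phi n (chain 1 m F))) \<mu> \<noteq> 0" "j \<in> {m..<k}"
  shows "eigenval n \<mu> j = y (Suc j)"
  using assms(2-)
proof (induction "n - k" arbitrary: k \<mu>)
  case 0
  have m: "m \<le> n" using 0 by simp
  have v: "val n (phi n (chain 1 m F)) \<mu> \<noteq> 0" using 0 by simp
  then have "\<mu> n \<noteq> 0" using val_phi_0[OF n] by blast
  then have \<mu>: "up n (down n \<mu>) = \<mu>" using up_down[OF n] 0 by auto
  have w: "weight n (down n \<mu>) = d" using weight_up[OF n, of "down n \<mu>"] \<mu> 0 by simp
  have "val n (chain 1 m F) (down n \<mu>) \<noteq> 0"
    using v val_phi_up[OF n chain_F_graded[OF assms(1) m], of "down n \<mu>"] \<mu> by auto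
  then have "eigenval n (down n \<mu>) (Suc j) = y (Suc j)"
    using 0 assms(1) m composition_down[OF n] w by (intro chain_F_nonzero[of 1 m]) auto
  then show ?case using eigenval_up[of j n "down n \<mu>"] \<mu> 0 assms(1) by simp
next
  case (Suc l)
  then have k: "k \<in> {1..<n}" "k < n" using assms(1) by auto
  let ?f = "phi n (chain 1 m F)"
  have "val n (hecke k (chain (Suc k) n ?f)) \<mu> \<noteq> 0" using Suc.prems k by (simp add: chain_less)
  from hecke_nonzero_cases[OF k(1) this] show ?case
  proof
    assume "val n (chain (Suc k) n ?f) \<mu> \<noteq> 0"
    then show ?case using Suc.prems Suc.hyps(2) by (intro Suc.hyps(1)[of "Suc k" \<mu>]) auto
  next
    assume *: "\<mu> k \<noteq> \<mu> (Suc k) \<and> val n (chain (Suc k) n ?f) (\<mu> \<circ> transpose k (Suc k)) \<noteq> 0"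
    have "eigenval n (\<mu> \<circ> transpose k (Suc k)) j = y (Suc j)"
      using * Suc.prems Suc.hyps(2) composition_swap[OF k(1), of \<mu>] weight_swap[OF k(1), of \<mu>]
      by (intro Suc.hyps(1)[of "Suc k" "\<mu> \<circ> transpose k (Suc k)"]) (auto simp del: o_apply)
    then show ?case
      using eigenval_swap[OF k(1), of \<mu> j] * Suc.prems by (auto simp: transpose_def split: if_splits)
  qed
qed

end

section \<open>The path of a maximal set\<close>

locale maximal_set = interpolation +
  fixes S :: "nat set"
  assumes S: "S \<noteq> {}" "S \<subseteq> {1..n}" and max: "\<And>j. j \<in> {1..n} \<Longrightarrow> j \<notin> S \<Longrightarrow> \<eta> j \<noteq> nxt S \<eta> (\<eta> (Min S) + 1) j"
begin

abbreviation "m \<equiv> Min S"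
abbreviation "\<kappa> k \<equiv> path1 S k \<eta> (\<eta> m + 1)"
abbreviation "\<mu> k \<equiv> path2 m k \<eta>"
abbreviation "Y \<equiv> nxt S y (qq * y m)"

lemma finite_S: "finite S"
  using S finite_subset by blast

lemma m: "m \<in> S" "1 \<le> m" "m \<le> n"
  using Min_in[OF finite_S S(1)] S(2) by auto

lemma below_m: "j < m \<Longrightarrow> j \<notin> S"
  using Min_le[OF finite_S, of j] by auto

lemma \<eta>_m: "j \<in> {1..<m} \<Longrightarrow> \<eta> j \<noteq> \<eta> m"
  using max[of j] below_m[of j] nxt_first[OF finite_S S(1), of j \<eta> "\<eta> m + 1"] m by auto

lemma outside: "j \<notin> {1..n} \<Longrightarrow> \<eta> j = 0"
  using \<eta> by (auto simp: composition_def)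

lemma composition_\<mu>: "k \<in> {1..m} \<Longrightarrow> composition n (\<mu> k)"
  using m outside by (auto simp: composition_def path2_def)

lemma \<mu>_step:
  assumes "k \<in> {1..<m}"
  shows "\<mu> (Suc k) = \<mu> k \<circ> transpose k (Suc k)" "\<mu> k k = \<eta> m" "\<mu> k (Suc k) = \<eta> k" "\<eta> k \<noteq> \<eta> m"
  using assms \<eta>_m[of k] path2_step[of k m \<eta>] by (auto simp: path2_def)

text \<open>The junction of both halves: the moving entry has reached place n as
  \<open>\<eta> m + 1\<close>; undoing \<open>up\<close> puts \<open>\<eta> m\<close> in front, from
  where the second half carries it back to m.\<close>

lemma \<kappa>_end: "\<kappa> n = up n (\<mu> 1)"
proof
  fix j
  have "nxt S \<eta> (\<eta> m + 1) (Suc n) = \<eta> m + 1" using S by (intro nxt_beyond) auto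
  then show "\<kappa> n j = up n (\<mu> 1) j"
    using m outside[of j] S by (auto simp: path1_def path2_def up_def shifted_def)
qed

lemma \<kappa>_start: "\<kappa> m = shifted S \<eta> (\<eta> m + 1)"
  using below_m m by (intro ext) (auto simp: path1_def shifted_def)

text \<open>Maximality at Suc k says precisely that the two swapped entries differ.\<close>

lemma \<kappa>_step_notmem:
  assumes "k \<in> {m..<n}" "Suc k \<notin> S"
  shows "\<kappa> (Suc k) = \<kappa> k \<circ> transpose k (Suc k)" "\<kappa> k k \<noteq> \<kappa> k (Suc k)"
proof -
  show "\<kappa> (Suc k) = \<kappa> k \<circ> transpose k (Suc k)" using assms by (intro path1_step_notmem) auto
  have "\<kappa> k k = nxt S \<eta> (\<eta> m + 1) (Suc k)" "\<kappa> k (Suc k) = \<eta> (Suc k)"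
    using assms by (auto simp: path1_def shifted_def)
  then show "\<kappa> k k \<noteq> \<kappa> k (Suc k)" using max[of "Suc k"] assms by auto
qed

lemma \<kappa>_step_mem: "k \<in> {m..<n} \<Longrightarrow> Suc k \<in> S \<Longrightarrow> \<kappa> (Suc k) = \<kappa> k"
  by (intro path1_step_mem) auto

lemma \<mu>_weight: "k \<in> {1..m} \<Longrightarrow> weight n (\<mu> k) = d"
proof (induction "m - k" arbitrary: k)
  case 0
  then have "k = m" by simp
  then show ?case by (simp add: path2_end)
next
  case (Suc l)
  then have k: "k \<in> {1..<m}" by auto
  then have kn: "k \<in> {1..<n}" using m by auto
  have "weight n (\<mu> (Suc k)) = d" using Suc by (intro Suc.hyps(1)) auto
  then show ?case unfolding \<mu>_step(1)[OF k] weight_swap[OF kn] .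
qed

lemma \<kappa>_props: "k \<in> {m..n} \<Longrightarrow> composition n (\<kappa> k) \<and> weight n (\<kappa> k) = Suc d"
proof (induction "n - k" arbitrary: k)
  case 0
  then have "k = n" by simp
  then show ?case using \<mu>_weight[of 1] m weight_up[OF n] composition_up[OF n] \<kappa>_end by auto
next
  case (Suc l)
  then have k: "k \<in> {m..<n}" by auto
  then have kn: "k \<in> {1..<n}" using m by auto
  have IH: "composition n (\<kappa> (Suc k)) \<and> weight n (\<kappa> (Suc k)) = Suc d" using Suc by (intro Suc.hyps(1)) auto
  show ?case
  proof (cases "Suc k \<in> S")
    case True
    then show ?thesis using IH \<kappa>_step_mem[OF k] by simp
  next
    case False
    have "\<kappa> k = \<kappa> (Suc k) \<circ> transpose k (Suc k)" unfolding \<kappa>_step_notmem(1)[OF k False] by (simp add: comp_assoc)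
    then show ?thesis using IH composition_swap[OF kn] weight_swap[OF kn] by metis
  qed
qed

lemma eigenval_\<mu>: "k \<in> {1..m} \<Longrightarrow> eigenval n (\<mu> k) j = path2 m k y j"
proof (induction "m - k" arbitrary: k j)
  case 0
  then have "k = m" by simp
  then show ?case by (simp add: path2_end)
next
  case (Suc l)
  then have k: "k \<in> {1..<m}" by auto
  then have kn: "k \<in> {1..<n}" using m by auto
  let ?t = "transpose k (Suc k)"
  have "eigenval n (\<mu> (Suc k)) (?t j) = path2 m (Suc k) y (?t j)" using Suc by (intro Suc.hyps(1)) auto
  moreover have "eigenval n (\<mu> (Suc k)) (?t j) = eigenval n (\<mu> k) j"
    unfolding \<mu>_step(1)[OF k] using \<mu>_step[OF k] by (subst eigenval_swap[OF kn]) auto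
  moreover have "path2 m (Suc k) y (?t j) = path2 m k y j"
    using k path2_step[of k m y] by simp
  ultimately show ?case by simp
qed

text \<open>All swaps on the path exchange unequal entries, so coordinates follow entries. The
  induction starts at the end of the path with \<open>eigenval_up\<close>; at k = m it yields the
  spectral point of c_S(\<eta>).\<close>

lemma eigenval_\<kappa>: "k \<in> {m..n} \<Longrightarrow> j \<in> {1..n} \<Longrightarrow> eigenval n (\<kappa> k) j = path1 S k y (qq * y m) j"
proof (induction "n - k" arbitrary: k j)
  case 0
  then have k: "k = n" by simp
  have "nxt S y (qq * y m) (Suc n) = qq * y m" using S by (intro nxt_beyond) auto
  then have "path1 S n y (qq * y m) j = (if j = n then qq * path2 m 1 y 1 else path2 m 1 y (Suc j))"
    using 0 m S by (auto simp: path1_def path2_def)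
  also have "\<dots> = eigenval n (up n (\<mu> 1)) j"
    using eigenval_up_top[OF n, of "\<mu> 1"] eigenval_up[of j n "\<mu> 1"] 0 m eigenval_\<mu>[of 1] by auto
  finally show ?case using k \<kappa>_end by simp
next
  case (Suc l)
  then have k: "k \<in> {m..<n}" by auto
  then have kn: "k \<in> {1..<n}" using m by auto
  let ?t = "transpose k (Suc k)"
  show ?case
  proof (cases "Suc k \<in> S")
    case True
    have "eigenval n (\<kappa> (Suc k)) j = path1 S (Suc k) y (qq * y m) j" using Suc by (intro Suc.hyps(1)) auto
    then show ?thesis using \<kappa>_step_mem[OF k True] path1_step_mem[of S k y "qq * y m"] True k by simp
  next
    case False
    have "?t j \<in> {1..n}" using Suc.prems kn by (auto simp: transpose_def)
    then have "eigenval n (\<kappa> (Suc k)) (?t j) = path1 S (Suc k) y (qq * y m) (?t j)"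
      using Suc by (intro Suc.hyps(1)) auto
    moreover have "eigenval n (\<kappa> (Suc k)) (?t j) = eigenval n (\<kappa> k) j"
      unfolding \<kappa>_step_notmem(1)[OF k False] using \<kappa>_step_notmem(2)[OF k False]
      by (subst eigenval_swap[OF kn]) auto
    moreover have "path1 S (Suc k) y (qq * y m) (?t j) = path1 S k y (qq * y m) j"
      using k path1_step_notmem[of S k y "qq * y m"] False by simp
    ultimately show ?thesis by simp
  qed
qed

lemma eigenval_shifted: "j \<in> {1..n} \<Longrightarrow> eigenval n (shifted S \<eta> (\<eta> m + 1)) j = shifted S y (qq * y m) j"
  using eigenval_\<kappa>[of m j] \<kappa>_start m below_m by (auto simp: path1_def shifted_def)

text \<open>Staying would leave \<open>y m\<close> at place k, where only \<open>y k\<close> permits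
  a nonzero value; hence every step is a swap.\<close>

lemma val_phase2: "k \<in> {1..m} \<Longrightarrow> val n (chain k m F) (\<mu> k) = (\<Prod>j=k..<m. bhat (y m) (y j)) * self_val n \<eta>"
proof (induction "m - k" arbitrary: k)
  case 0
  then have "k = m" by simp
  then show ?case using val_F[of \<eta>] \<eta> by (simp add: path2_end)
next
  case (Suc l)
  then have k: "k \<in> {1..<m}" by auto
  then have kn: "k \<in> {1..<n}" using m by auto
  have e: "eigenval n (\<mu> k) k = y m" "eigenval n (\<mu> k) (Suc k) = y k"
    using k by (simp_all add: eigenval_\<mu> path2_def)
  have z: "val n (chain (Suc k) m F) (\<mu> k) = 0"
  proof (rule ccontr)
    assume *: "val n (chain (Suc k) m F) (\<mu> k) \<noteq> 0"
    have "eigenval n (\<mu> k) k = y k"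
      by (rule chain_F_nonzero[of "Suc k" m]) (use * k kn m composition_\<mu>[of k] \<mu>_weight[of k] in auto)
    then show False using e eigenval_inj[of k n m \<eta>] k m kn by auto
  qed
  have IH: "val n (chain (Suc k) m F) (\<mu> (Suc k)) = (\<Prod>j=Suc k..<m. bhat (y m) (y j)) * self_val n \<eta>"
    using Suc by (intro Suc.hyps(1)) auto
  have "val n (chain k m F) (\<mu> k) = bhat (y m) (y k) * val n (chain (Suc k) m F) (\<mu> (Suc k))"
    using k by (simp add: chain_less val_hecke[OF kn] e z \<mu>_step(1)[OF k])
  also have "\<dots> = (\<Prod>j=k..<m. bhat (y m) (y j)) * self_val n \<eta>"
    unfolding IH using k by (simp add: prod.atLeast_Suc_lessThan)
  finally show ?case .
qed

text \<open>Weight of the step that settles coordinate j, by staying for j in S and by swapping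
  otherwise. The factor at j = m belongs to no step and enters in
  \<open>val_shifted\<close>.\<close>

definition step_coeff :: "nat \<Rightarrow> qtfield" where
  "step_coeff j = (if j \<in> S then ahat (y j) (Y (Suc j)) else bhat (Y j) (y j))"

text \<open>By \<open>phi_chain_nonzero\<close>, place k must carry \<open>y (Suc k)\<close> after
  its step. If Suc k is in S it does so already, otherwise the swap brings it there. Coordinates
  being distinct, the other branch contributes 0.\<close>

lemma val_phase1: "k \<in> {m..n} \<Longrightarrow> val n (chain k n (phi n (chain 1 m F))) (\<kappa> k)
   = (\<Prod>j=Suc k..n. step_coeff j) * ((qq * y m - tt powi (1 - int n)) * ((\<Prod>j=1..<m. bhat (y m) (y j)) * self_val n \<eta>))"
proof (induction "n - k" arbitrary: k)
  case 0
  then have k: "k = n" by simp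
  have "eigenval n (\<mu> 1) 1 = y m" using m by (simp add: eigenval_\<mu> path2_def)
  then have "val n (phi n (chain 1 m F)) (\<kappa> n) = (qq * y m - tt powi (1 - int n)) * ((\<Prod>j=1..<m. bhat (y m) (y j)) * self_val n \<eta>)"
    unfolding \<kappa>_end val_phi_up[OF n chain_F_graded[OF m(2,3)]] using val_phase2[of 1] m by simp
  then show ?case using k by simp
next
  case (Suc l)
  then have k: "k \<in> {m..<n}" by auto
  then have kn: "k \<in> {1..<n}" using m by auto
  let ?f = "phi n (chain 1 m F)" and ?t = "transpose k (Suc k)"
  let ?c = "(qq * y m - tt powi (1 - int n)) * ((\<Prod>j=1..<m. bhat (y m) (y j)) * self_val n \<eta>)"
  have IH: "val n (chain (Suc k) n ?f) (\<kappa> (Suc k)) = (\<Prod>j=Suc (Suc k)..n. step_coeff j) * ?c"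
    using Suc by (intro Suc.hyps(1)) auto
  have \<kappa>k: "composition n (\<kappa> k)" "weight n (\<kappa> k) = Suc d" using \<kappa>_props[of k] k by auto
  have nz: "eigenval n \<nu> k = y (Suc k)" if "val n (chain (Suc k) n ?f) \<nu> \<noteq> 0" "composition n \<nu>" "weight n \<nu> = Suc d" for \<nu>
    using that k m by (intro phi_chain_nonzero[of m "Suc k"]) auto
  have e: "eigenval n (\<kappa> k) k = Y (Suc k)" "eigenval n (\<kappa> k) (Suc k) = shifted S y (qq * y m) (Suc k)"
    using k kn eigenval_\<kappa>[of k k] eigenval_\<kappa>[of k "Suc k"] by (auto simp: path1_def)
  have ne: "eigenval n (\<kappa> k) k \<noteq> eigenval n (\<kappa> k) (Suc k)"
    using eigenval_inj[of k n "Suc k" "\<kappa> k"] kn by auto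
  have "val n (chain k n ?f) (\<kappa> k) = step_coeff (Suc k) * val n (chain (Suc k) n ?f) (\<kappa> (Suc k))"
  proof (cases "Suc k \<in> S")
    case True
    have "bhat (eigenval n (\<kappa> k) k) (eigenval n (\<kappa> k) (Suc k)) * val n (chain (Suc k) n ?f) (\<kappa> k \<circ> ?t) = 0"
    proof (rule ccontr)
      assume *: "\<not> ?thesis"
      then have ne': "\<kappa> k k \<noteq> \<kappa> k (Suc k)" using bhat_eigenval_equal[OF kn, of "\<kappa> k"] by auto
      have "eigenval n (\<kappa> k \<circ> ?t) k = y (Suc k)"
        using * \<kappa>k composition_swap[OF kn, of "\<kappa> k"] weight_swap[OF kn, of "\<kappa> k"] by (intro nz) auto
      then have "eigenval n (\<kappa> k) (Suc k) = y (Suc k)" using eigenval_swap[OF kn ne', of k] by simp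
      then show False using ne e(1) True by (simp add: nxt_mem)
    qed
    then show ?thesis
      unfolding \<kappa>_step_mem[OF k True]
      using k True e by (simp add: chain_less val_hecke[OF kn] step_coeff_def shifted_def nxt_mem)
  next
    case False
    have "val n (chain (Suc k) n ?f) (\<kappa> k) = 0"
    proof (rule ccontr)
      assume "\<not> ?thesis"
      then have "eigenval n (\<kappa> k) k = y (Suc k)" using \<kappa>k by (intro nz)
      then show False using ne e(2) False by (simp add: shifted_def)
    qed
    then show ?thesis
      unfolding \<kappa>_step_notmem(1)[OF k False]
      using k False e by (simp add: chain_less val_hecke[OF kn] step_coeff_def shifted_def)
  qed
  also have "\<dots> = (\<Prod>j=Suc k..n. step_coeff j) * ?c"
    unfolding IH using k by (simp add: prod.atLeast_Suc_atMost mult.assoc)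
  finally show ?case .
qed

text \<open>The path supplies all factors of \<open>A_fun\<close> and \<open>B_fun\<close> except
  \<open>ahat\<close> at m. Solving the eigenvalue equation divides by
  \<open>Y (Suc m) / y m - 1\<close>, whose product with the missing factor is -(t - 1).\<close>

lemma val_shifted:
  "val n F (shifted S \<eta> (\<eta> m + 1)) = - A_fun S y * B_fun n S y * self_val n \<eta> / (tt - 1)"
proof -
  let ?\<nu> = "shifted S \<eta> (\<eta> m + 1)" and ?c = "qq * y m - tt powi (1 - int n)"
  have mn: "m \<in> {1..n}" using m by auto
  have "val n (W_op n m F) ?\<nu> = val n ((Const (inverse (y m)) * zvar m - 1) * F) ?\<nu>"
    unfolding interp_eigen[OF n \<eta> I mn] ..
  then have 1: "(inverse (y m) * Y (Suc m) - 1) * val n F ?\<nu>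
     = (\<Prod>j=Suc m..n. step_coeff j) * (?c * ((\<Prod>j=1..<m. bhat (y m) (y j)) * self_val n \<eta>))"
    using val_phase1[of m, unfolded \<kappa>_start] m eigenval_shifted[OF mn]
    by (simp add: W_op_def val_simps val_def[of n 1] shifted_def[of S y])
  have un: "{1..n} = {1..<m} \<union> insert m {Suc m..n}" using m by auto
  have "(\<Prod>j=1..n. step_coeff j) = (\<Prod>j=1..<m. step_coeff j) * (\<Prod>j\<in>insert m {Suc m..n}. step_coeff j)"
    unfolding un by (rule prod.union_disjoint) auto
  also have "(\<Prod>j\<in>insert m {Suc m..n}. step_coeff j) = step_coeff m * (\<Prod>j=Suc m..n. step_coeff j)"
    by simp
  also have "(\<Prod>j=1..<m. step_coeff j) = (\<Prod>j=1..<m. bhat (y m) (y j))"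
  proof (rule prod.cong)
    fix j assume "j \<in> {1..<m}"
    then have "j \<notin> S" "Y j = y m" using below_m nxt_first[OF finite_S S(1), of j y "qq * y m"] by auto
    then show "step_coeff j = bhat (y m) (y j)" by (simp only: step_coeff_def if_False)
  qed simp
  also have "step_coeff m = ahat (y m) (Y (Suc m))" using m by (simp add: step_coeff_def)
  finally have 2: "(\<Prod>j=1..n. step_coeff j) = (\<Prod>j=1..<m. bhat (y m) (y j)) * (ahat (y m) (Y (Suc m)) * (\<Prod>j=Suc m..n. step_coeff j))" .
  have "{1..n} = S \<union> ({1..n} - S)" using S by auto
  then have "(\<Prod>j=1..n. step_coeff j) = (\<Prod>j\<in>S. step_coeff j) * (\<Prod>j\<in>{1..n} - S. step_coeff j)"
    using finite_S by (metis Diff_disjoint finite_Diff finite_atLeastAtMost prod.union_disjoint)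
  also have "(\<Prod>j\<in>S. step_coeff j) = A_fun S y"
    unfolding A_fun_eq[OF S] by (intro prod.cong) (auto simp: step_coeff_def)
  also have "(\<Prod>j\<in>{1..n} - S. step_coeff j) = (\<Prod>j\<in>{1..n} - S. bhat (Y j) (y j))"
    by (intro prod.cong) (auto simp: step_coeff_def)
  finally have P: "(\<Prod>j=1..n. step_coeff j) = A_fun S y * (\<Prod>j\<in>{1..n} - S. bhat (Y j) (y j))" .
  have 3: "?c * (\<Prod>j=1..n. step_coeff j) = A_fun S y * B_fun n S y"
    unfolding P B_fun_eq[OF S] by (rule mult.left_commute)
  have ne: "Y (Suc m) \<noteq> y m"
  proof (cases "\<exists>i\<in>S. Suc m \<le> i")
    case True
    define i where "i = (LEAST i. i \<in> S \<and> Suc m \<le> i)"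
    have i: "i \<in> S \<and> Suc m \<le> i" unfolding i_def by (rule LeastI_ex) (use True in auto)
    then have "Y (Suc m) = y i" using True by (simp add: nxt_def i_def)
    then show ?thesis using eigenval_inj[of i n m \<eta>] i mn S by auto
  next
    case False
    then have "Y (Suc m) = qq * y m" by (simp add: nxt_def)
    then show ?thesis using qq_neq_1 by simp
  qed
  have 4: "ahat (y m) (Y (Suc m)) * (inverse (y m) * Y (Suc m) - 1) = - (tt - 1)"
  proof -
    have *: "(c * a / e) * (- e / a) = - c" if "a \<noteq> 0" "e \<noteq> 0" for a c e :: qtfield
      using that by simp
    have "inverse (y m) * Y (Suc m) - 1 = - (y m - Y (Suc m)) / y m"
      by (simp add: field_simps)
    then show ?thesis unfolding ahat_def by (simp only:) (rule *, use ne in auto)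
  qed
  have "- (tt - 1) * val n F ?\<nu> = A_fun S y * B_fun n S y * self_val n \<eta>"
  proof -
    have "- (tt - 1) * val n F ?\<nu> = ahat (y m) (Y (Suc m)) * ((inverse (y m) * Y (Suc m) - 1) * val n F ?\<nu>)"
      unfolding 4[symmetric] by (simp only: mult.assoc)
    also have "\<dots> = ?c * (\<Prod>j=1..n. step_coeff j) * self_val n \<eta>"
      unfolding 1 2 by (simp only: mult_ac)
    finally show ?thesis unfolding 3 .
  qed
  then show ?thesis using tt_neq_1 by (simp add: field_simps)
qed

end

section \<open>Nonzero values occur only for maximal sets\<close>

lemma nxt_cong:
  assumes "\<And>i. j \<le> i \<Longrightarrow> i \<in> I \<longleftrightarrow> i \<in> J"
  shows "nxt I g w j = nxt J g w j"
proof -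
  have "i \<in> I \<and> j \<le> i \<longleftrightarrow> i \<in> J \<and> j \<le> i" for i using assms by blast
  then show ?thesis by (simp only: nxt_def Bex_def)
qed

context interpolation
begin

text \<open>Converse of \<open>val_phase2\<close>. Staying at k would require \<open>y k\<close> at
  k as well as at Suc k, which distinct coordinates forbid. So all steps swap unequal entries, and
  this gives the inequalities.\<close>

lemma phase2_nonzero:
  assumes "1 \<le> k" "k \<le> m" "m \<le> n" "composition n \<mu>" "weight n \<mu> = d" "val n (chain k m F) \<mu> \<noteq> 0"
    "\<And>j. j \<in> {k..<m} \<Longrightarrow> eigenval n \<mu> (Suc j) = y j"
  shows "\<mu> k = \<eta> m \<and> (\<forall>j\<in>{k..<m}. \<eta> j \<noteq> \<eta> m)"
  using assms
proof (induction "m - k" arbitrary: k \<mu>)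
  case 0
  then show ?case using val_F[of \<mu>] by (auto split: if_splits)
next
  case (Suc l)
  then have k: "k \<in> {1..<n}" "k < m" by auto
  let ?t = "transpose k (Suc k)"
  have Sk: "eigenval n \<mu> (Suc k) = y k" using Suc.prems k by auto
  have "val n (hecke k (chain (Suc k) m F)) \<mu> \<noteq> 0" using Suc.prems k by (simp add: chain_less)
  from hecke_nonzero_cases[OF k(1) this] show ?case
  proof
    assume *: "val n (chain (Suc k) m F) \<mu> \<noteq> 0"
    have "eigenval n \<mu> k = y k"
      by (rule chain_F_nonzero[of "Suc k" m]) (use * Suc.prems k in auto)
    then show ?case using Sk eigenval_inj[of k n "Suc k" \<mu>] k by auto
  next
    assume *: "\<mu> k \<noteq> \<mu> (Suc k) \<and> val n (chain (Suc k) m F) (\<mu> \<circ> ?t) \<noteq> 0"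
    have sw: "eigenval n (\<mu> \<circ> ?t) i = eigenval n \<mu> (?t i)" for i using eigenval_swap[OF k(1)] * by blast
    have "(\<mu> \<circ> ?t) (Suc k) = \<eta> m \<and> (\<forall>j\<in>{Suc k..<m}. \<eta> j \<noteq> \<eta> m)"
    proof (rule Suc.hyps(1)[of "Suc k" "\<mu> \<circ> ?t"])
      show "composition n (\<mu> \<circ> ?t)" "weight n (\<mu> \<circ> ?t) = d"
        using Suc.prems composition_swap[OF k(1)] weight_swap[OF k(1)] by auto
      show "eigenval n (\<mu> \<circ> ?t) (Suc j) = y j" if "j \<in> {Suc k..<m}" for j
        unfolding sw using Suc.prems(7)[of j] that by simp
    qed (use * Suc.hyps(2) Suc.prems k in auto)
    moreover have "\<eta> k \<noteq> \<eta> m" using calculation * eigenval_eq_imp[OF Sk] by simp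
    moreover have "{k..<m} = insert k {Suc k..<m}" using k by auto
    ultimately show ?case by simp
  qed
qed

text \<open>Converse of \<open>val_phase1\<close>: the set is read off from the path.
  \<open>T\<close> collects the places Suc j such that the path stays at step j, and each swap
  contributes one maximality condition.\<close>

lemma phase1_nonzero:
  assumes "1 \<le> m" "m \<le> k" "k \<le> n" "composition n \<kappa>" "weight n \<kappa> = Suc d"
    "val n (chain k n (phi n (chain 1 m F))) \<kappa> \<noteq> 0" "\<And>j. j \<in> {1..<m} \<Longrightarrow> eigenval n \<kappa> j = y j"
  shows "\<exists>T \<subseteq> {k<..n}. \<kappa> k = nxt T \<eta> (\<eta> m + 1) (Suc k) \<and>
    (\<forall>j\<in>{k<..n}. \<kappa> j = shifted T \<eta> (\<eta> m + 1) j) \<and>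
    (\<forall>j\<in>{k<..n} - T. \<eta> j \<noteq> nxt T \<eta> (\<eta> m + 1) j) \<and> (\<forall>j\<in>{1..<m}. \<eta> j \<noteq> \<eta> m)"
  using assms(2-)
proof (induction "n - k" arbitrary: k \<kappa>)
  case 0
  then have k: "k = n" and m: "m \<le> n" by auto
  have v: "val n (phi n (chain 1 m F)) \<kappa> \<noteq> 0" using 0 k by simp
  then have pos: "\<kappa> n \<noteq> 0" using val_phi_0[OF n] by blast
  define \<mu> where "\<mu> = down n \<kappa>"
  have \<kappa>: "\<kappa> = up n \<mu>" using up_down[OF n, of \<kappa>] pos 0 by (simp add: \<mu>_def)
  have \<mu>: "composition n \<mu>" unfolding \<mu>_def by (rule composition_down[OF n])
  have w: "weight n \<mu> = d" using weight_up[OF n, of \<mu>] \<kappa> 0 by simp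
  have "\<mu> 1 = \<eta> m \<and> (\<forall>j\<in>{1..<m}. \<eta> j \<noteq> \<eta> m)"
  proof (rule phase2_nonzero[OF _ assms(1) m \<mu> w])
    show "val n (chain 1 m F) \<mu> \<noteq> 0"
      using v val_phi_up[OF n chain_F_graded[OF assms(1) m], of \<mu>] \<kappa> by auto
    show "eigenval n \<mu> (Suc j) = y j" if "j \<in> {1..<m}" for j
      using "0.prems"(6)[OF that] eigenval_up[of j n \<mu>] that m by (simp add: \<kappa>)
  qed simp
  moreover have "\<kappa> n = \<mu> 1 + 1" unfolding \<kappa> by (simp add: up_def)
  \<comment> \<open>Nothing has been collected yet, so \<open>nxt\<close> returns its
    default.\<close>
  ultimately show ?case unfolding k by (intro exI[of _ "{}"]) (simp add: nxt_def)
next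
  case (Suc l)
  then have k: "k \<in> {1..<n}" "m \<le> k" "k < n" using assms(1) by auto
  let ?f = "phi n (chain 1 m F)" and ?t = "transpose k (Suc k)" and ?w = "\<eta> m + 1"
  have ins: "{k<..n} = insert (Suc k) {Suc k<..n}" using k by auto
  have nz: "\<nu> k = \<eta> (Suc k)" if "val n (chain (Suc k) n ?f) \<nu> \<noteq> 0" "composition n \<nu>" "weight n \<nu> = Suc d" for \<nu>
  proof -
    have "eigenval n \<nu> k = y (Suc k)"
      using that k assms(1) by (intro phi_chain_nonzero[of m "Suc k"]) auto
    then show ?thesis by (rule eigenval_eq_imp)
  qed
  have "val n (hecke k (chain (Suc k) n ?f)) \<kappa> \<noteq> 0" using Suc.prems k by (simp add: chain_less)
  from hecke_nonzero_cases[OF k(1) this] show ?case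
  proof
    assume *: "val n (chain (Suc k) n ?f) \<kappa> \<noteq> 0"
    have \<kappa>k: "\<kappa> k = \<eta> (Suc k)" using * Suc.prems by (intro nz)
    have "\<exists>T \<subseteq> {Suc k<..n}. \<kappa> (Suc k) = nxt T \<eta> ?w (Suc (Suc k)) \<and>
      (\<forall>j\<in>{Suc k<..n}. \<kappa> j = shifted T \<eta> ?w j) \<and>
      (\<forall>j\<in>{Suc k<..n} - T. \<eta> j \<noteq> nxt T \<eta> ?w j) \<and> (\<forall>j\<in>{1..<m}. \<eta> j \<noteq> \<eta> m)"
      using * Suc.prems Suc.hyps(2) k by (intro Suc.hyps(1)[of "Suc k" \<kappa>]) auto
    then obtain T where T: "T \<subseteq> {Suc k<..n}" "\<kappa> (Suc k) = nxt T \<eta> ?w (Suc (Suc k))"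
      "\<forall>j\<in>{Suc k<..n}. \<kappa> j = shifted T \<eta> ?w j" "\<forall>j\<in>{Suc k<..n} - T. \<eta> j \<noteq> nxt T \<eta> ?w j"
      "\<forall>j\<in>{1..<m}. \<eta> j \<noteq> \<eta> m" by blast
    have nxt: "nxt (insert (Suc k) T) \<eta> ?w j = nxt T \<eta> ?w j" if "j > Suc k" for j
      using that by (intro nxt_cong) auto
    have sh: "shifted (insert (Suc k) T) \<eta> ?w j = shifted T \<eta> ?w j" if "j > Suc k" for j
      using that nxt by (simp add: shifted_def)
    show ?case
    \<comment> \<open>The path stays, so Suc k joins the set.\<close>
    proof (intro exI[of _ "insert (Suc k) T"] conjI)
      show "insert (Suc k) T \<subseteq> {k<..n}" using T(1) k by auto
      show "\<kappa> k = nxt (insert (Suc k) T) \<eta> ?w (Suc k)" by (simp add: nxt_mem \<kappa>k)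
      show "\<forall>j\<in>{k<..n}. \<kappa> j = shifted (insert (Suc k) T) \<eta> ?w j"
        unfolding ins using T nxt[of "Suc (Suc k)"] sh by (auto simp: shifted_def[of _ _ _ "Suc k"])
      show "\<forall>j\<in>{k<..n} - insert (Suc k) T. \<eta> j \<noteq> nxt (insert (Suc k) T) \<eta> ?w j"
        unfolding ins using T nxt by auto
    qed (rule T)
  next
    assume *: "\<kappa> k \<noteq> \<kappa> (Suc k) \<and> val n (chain (Suc k) n ?f) (\<kappa> \<circ> ?t) \<noteq> 0"
    have \<kappa>t: "composition n (\<kappa> \<circ> ?t)" "weight n (\<kappa> \<circ> ?t) = Suc d"
      using Suc.prems composition_swap[OF k(1)] weight_swap[OF k(1)] by auto
    have sw: "eigenval n (\<kappa> \<circ> ?t) i = eigenval n \<kappa> (?t i)" for i using eigenval_swap[OF k(1)] * by blast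
    have \<kappa>k: "\<kappa> (Suc k) = \<eta> (Suc k)" using nz[of "\<kappa> \<circ> ?t"] * \<kappa>t by simp
    have "\<exists>T \<subseteq> {Suc k<..n}. (\<kappa> \<circ> ?t) (Suc k) = nxt T \<eta> ?w (Suc (Suc k)) \<and>
      (\<forall>j\<in>{Suc k<..n}. (\<kappa> \<circ> ?t) j = shifted T \<eta> ?w j) \<and>
      (\<forall>j\<in>{Suc k<..n} - T. \<eta> j \<noteq> nxt T \<eta> ?w j) \<and> (\<forall>j\<in>{1..<m}. \<eta> j \<noteq> \<eta> m)"
    proof (rule Suc.hyps(1)[of "Suc k" "\<kappa> \<circ> ?t"])
      show "eigenval n (\<kappa> \<circ> ?t) j = y j" if "j \<in> {1..<m}" for j
        unfolding sw using Suc.prems(6)[OF that] that k by simp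
    qed (use * \<kappa>t Suc.hyps(2) k in auto)
    then obtain T where T: "T \<subseteq> {Suc k<..n}" "\<kappa> k = nxt T \<eta> ?w (Suc (Suc k))"
      "\<forall>j\<in>{Suc k<..n}. \<kappa> j = shifted T \<eta> ?w j" "\<forall>j\<in>{Suc k<..n} - T. \<eta> j \<noteq> nxt T \<eta> ?w j"
      "\<forall>j\<in>{1..<m}. \<eta> j \<noteq> \<eta> m"
      by (auto simp: transpose_def)
    have Sk: "Suc k \<notin> T" using T(1) by auto
    have svk: "nxt T \<eta> ?w (Suc k) = \<kappa> k" unfolding T(2) by (rule nxt_notmem[OF Sk])
    show ?case
    \<comment> \<open>The path swaps, so Suc k remains outside; the inequality of the swapped
      entries is maximality there.\<close>
    proof (intro exI[of _ T] conjI)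
      show "T \<subseteq> {k<..n}" using T(1) by auto
      show "\<kappa> k = nxt T \<eta> ?w (Suc k)" by (simp only: svk)
      show "\<forall>j\<in>{k<..n}. \<kappa> j = shifted T \<eta> ?w j"
        unfolding ins using T(3) Sk \<kappa>k by (auto simp: shifted_def[of _ _ _ "Suc k"])
      show "\<forall>j\<in>{k<..n} - T. \<eta> j \<noteq> nxt T \<eta> ?w j"
        unfolding ins using T(4) svk \<kappa>k * by auto
    qed (rule T)
  qed
qed

lemma nonzero_imp_maximal:
  assumes \<nu>: "composition n \<nu>" "weight n \<nu> = Suc d" and nz: "val n F \<nu> \<noteq> 0"
  obtains S where "S \<in> maximal_sets n \<eta>" "\<nu> = shift_comp S \<eta>"
proof -
  define A where "A = {i \<in> {1..n}. eigenval n \<nu> i \<noteq> y i}"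
  have "\<nu> \<noteq> \<eta>" using \<nu> by auto
  then have A: "A \<noteq> {}" "finite A" using composition_eqI[OF \<nu>(1) \<eta>] by (auto simp: A_def)
  \<comment> \<open>The first place with a changed coordinate is the candidate for the minimum: the
    eigenvalue factor is nonzero there, and agreement at all smaller places is what
    \<open>phase1_nonzero\<close> requires.\<close>
  define m where "m = Min A"
  have m: "m \<in> {1..n}" "eigenval n \<nu> m \<noteq> y m" using Min_in[OF A(2,1)] by (auto simp: m_def A_def)
  have below: "eigenval n \<nu> j = y j" if "j \<in> {1..<m}" for j
    using Min_le[OF A(2), of j] that m(1) unfolding m_def[symmetric] by (force simp: A_def)
  have "val n (W_op n m F) \<nu> = val n ((Const (inverse (y m)) * zvar m - 1) * F) \<nu>"
    unfolding interp_eigen[OF n \<eta> I m(1)] ..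
  also have "\<dots> = (inverse (y m) * eigenval n \<nu> m - 1) * val n F \<nu>"
    by (simp add: val_simps val_def[of n 1])
  also have "\<dots> \<noteq> 0" using nz m(2) by (simp add: field_simps)
  finally have "val n (chain m n (phi n (chain 1 m F))) \<nu> \<noteq> 0" by (simp add: W_op_def)
  then obtain T where T: "T \<subseteq> {m<..n}" "\<nu> m = nxt T \<eta> (\<eta> m + 1) (Suc m)"
    "\<forall>j\<in>{m<..n}. \<nu> j = shifted T \<eta> (\<eta> m + 1) j" "\<forall>j\<in>{m<..n} - T. \<eta> j \<noteq> nxt T \<eta> (\<eta> m + 1) j"
    "\<forall>j\<in>{1..<m}. \<eta> j \<noteq> \<eta> m"
    using phase1_nonzero[of m m \<nu>] \<nu> m(1) below by auto
  define S where "S = insert m T"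
  have S: "S \<noteq> {}" "S \<subseteq> {1..n}" using T(1) m(1) by (auto simp: S_def)
  then have fin: "finite S" using finite_subset by blast
  have Min: "Min S = m" using T(1) fin by (intro Min_eqI) (auto simp: S_def)
  have nxt: "nxt S \<eta> (\<eta> m + 1) j = nxt T \<eta> (\<eta> m + 1) j" if "j > m" for j
    using that by (intro nxt_cong) (auto simp: S_def)
  have "\<nu> = shifted S \<eta> (\<eta> m + 1)"
  proof
    fix j
    consider "j \<notin> {1..n}" | "j \<in> {1..<m}" | "j = m" | "j \<in> {m<..n}" using m(1) by fastforce
    then show "\<nu> j = shifted S \<eta> (\<eta> m + 1) j"
    proof cases
      case 1
      then have "j \<notin> S" using S by auto
      then show ?thesis using 1 \<nu>(1) \<eta> by (simp add: shifted_def composition_def)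
    next
      case 2
      then have "j \<notin> S" using T(1) by (auto simp: S_def)
      then show ?thesis using eigenval_eq_imp[OF below[OF 2]] by (simp add: shifted_def)
    next
      case 3
      then show ?thesis using T(2) nxt[of "Suc m"] by (simp add: shifted_def S_def)
    next
      case 4
      then have "\<nu> j = shifted T \<eta> (\<eta> m + 1) j" using T(3) by blast
      also have "\<dots> = shifted S \<eta> (\<eta> m + 1) j" using 4 nxt[of "Suc j"] by (simp add: shifted_def S_def)
      finally show ?thesis .
    qed
  qed
  moreover have "S \<in> maximal_sets n \<eta>"
    unfolding maximal_sets_iff[OF S] Min
  proof
    fix j assume j: "j \<in> {1..n} - S"
    show "\<eta> j \<noteq> nxt S \<eta> (\<eta> m + 1) j"
    proof (cases "j < m")
      case True
      then show ?thesis using nxt_first[OF fin S(1), of j \<eta> "\<eta> m + 1"] Min T(5) j by auto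
    next
      case False
      then have "j \<in> {m<..n} - T" using j by (auto simp: S_def)
      then show ?thesis using T(4) nxt[of j] by auto
    qed
  qed
  ultimately show thesis using that[of S] shift_comp_eq[OF S, of \<eta>] Min by simp
qed

end

section \<open>Assembly of the coefficients\<close>

context maximal_set
begin

lemma shift_comp_S: "shift_comp S \<eta> = shifted S \<eta> (\<eta> m + 1)"
  by (rule shift_comp_eq[OF S])

lemma shift_comp_comps: "shift_comp S \<eta> \<in> comps_eq n (Suc d)"
  using \<kappa>_props[of m] m unfolding shift_comp_S \<kappa>_start[symmetric] by (simp add: comps_eq_def)

text \<open>Recovers S from c_S(\<eta>), hence the injectivity needed to turn a sum over
  compositions into one over sets.\<close>

lemma eigenval_shift_comp_neq:
  assumes "j \<in> {1..n}"
  shows "eigenval n (shift_comp S \<eta>) j \<noteq> y j \<longleftrightarrow> j \<in> S"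
proof -
  let ?x = "eigenval n (shift_comp S \<eta>)"
  have x: "?x i = (if i \<in> S then Y (Suc i) else y i)" if "i \<in> {1..n}" for i
    using eigenval_shifted[OF that] by (simp add: shift_comp_S shifted_def)
  have "Y (Suc j) \<noteq> y j" if jS: "j \<in> S"
  proof (cases "\<exists>i\<in>S. Suc j \<le> i")
    case True
    define i where "i = (LEAST i. i \<in> S \<and> Suc j \<le> i)"
    have i: "i \<in> S \<and> Suc j \<le> i" unfolding i_def by (rule LeastI_ex) (use True in auto)
    then have "Y (Suc j) = y i" using True by (simp add: nxt_def i_def)
    then show ?thesis using eigenval_inj[of i n j \<eta>] i assms S by auto
  next
    case False
    then have Yj: "Y (Suc j) = qq * y m" by (simp add: nxt_def)
    show ?thesis
    proof (cases "j = m")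
      case True
      then show ?thesis using Yj qq_neq_1 by simp
    next
      case False
      then have mj: "m < j" using below_m[of j] jS by (meson linorder_neqE_nat)
      \<comment> \<open>Here j is the last member of S and receives q times \<open>y m\<close>. This
        cannot be \<open>y j\<close>: the preceding member k has taken over \<open>y j\<close>, and
        the coordinates of a spectral point are distinct.\<close>
      define k where "k = Max {i \<in> S. i < j}"
      have ne: "{i \<in> S. i < j} \<noteq> {}" using mj m by auto
      have fin: "finite {i \<in> S. i < j}" using finite_S by simp
      have k: "k \<in> S" "k < j" using Max_in[OF fin ne] by (auto simp: k_def)
      have "(LEAST i. i \<in> S \<and> Suc k \<le> i) = j"
      proof (rule Least_equality)
        fix i assume i: "i \<in> S \<and> Suc k \<le> i"
        show "j \<le> i"
        proof (rule ccontr)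
          assume "\<not> j \<le> i"
          then have "i \<le> k" using i Max_ge[OF fin, of i] by (simp add: k_def)
          then show False using i by simp
        qed
      qed (use k jS in auto)
      then have "Y (Suc k) = y j" using k jS by (auto simp: nxt_def)
      moreover have kn: "k \<in> {1..n}" using k S by auto
      moreover have "?x k \<noteq> ?x j" using eigenval_inj[OF kn assms, of "shift_comp S \<eta>"] k by auto
      ultimately show ?thesis using x[OF kn] x[OF assms] k jS by simp
    qed
  qed
  then show ?thesis using x[OF assms] by simp
qed

text \<open>Origin of the factor q - 1: \<open>y m\<close> leaves the multiset of coordinates and q
  times \<open>y m\<close> enters.\<close>

lemma sum_eigenval_shift:
  "(\<Sum>i=1..n. eigenval n (shift_comp S \<eta>) i) - (\<Sum>i=1..n. y i) = (qq - 1) * y m"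
proof -
  have "(\<Sum>i=1..n. eigenval n (shift_comp S \<eta>) i) = (\<Sum>i=1..n. shifted S y (qq * y m) i)"
    unfolding shift_comp_S by (intro sum.cong refl eigenval_shifted)
  then show ?thesis
    using sum.shifted[OF S, of "\<lambda>x. x" y "qq * y m"] by (simp add: algebra_simps)
qed

text \<open>Coordinates and entries are shifted as pairs, so that \<open>prod.shifted\<close>
  applies to powers whose base and exponent move together. This yields the power of q in the
  denominator of the coefficient.\<close>

lemma prod_eigenval_shift:
  "(\<Prod>i=1..n. eigenval n (shift_comp S \<eta>) i ^ shift_comp S \<eta> i) = qq ^ (\<eta> m + 1) * y m * (\<Prod>i=1..n. y i ^ \<eta> i)"
proof -
  let ?g = "\<lambda>j. (y j, \<eta> j)" and ?w = "(qq * y m, \<eta> m + 1)" and ?h = "\<lambda>p. fst p ^ snd p :: qtfield"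
  have "shifted S y (qq * y m) j = fst (shifted S ?g ?w j)" "shifted S \<eta> (\<eta> m + 1) j = snd (shifted S ?g ?w j)" for j
    by (simp_all add: shifted_def nxt_map[of fst] nxt_map[of snd])
  then have "eigenval n (shift_comp S \<eta>) i ^ shift_comp S \<eta> i = ?h (shifted S ?g ?w i)" if "i \<in> {1..n}" for i
    using eigenval_shifted[OF that] by (simp add: shift_comp_S)
  then have "(\<Prod>i=1..n. eigenval n (shift_comp S \<eta>) i ^ shift_comp S \<eta> i) = (\<Prod>i=1..n. ?h (shifted S ?g ?w i))"
    by (intro prod.cong) auto
  then have "(\<Prod>i=1..n. eigenval n (shift_comp S \<eta>) i ^ shift_comp S \<eta> i) * y m ^ \<eta> m
      = (\<Prod>i=1..n. y i ^ \<eta> i) * (qq * y m) ^ (\<eta> m + 1)"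
    using prod.shifted[OF S, of ?h ?g ?w] by simp
  also have "\<dots> = (qq ^ (\<eta> m + 1) * y m * (\<Prod>i=1..n. y i ^ \<eta> i)) * y m ^ \<eta> m"
    by (simp add: power_mult_distrib mult_ac)
  finally show ?thesis by (simp only: mult_right_cancel[OF power_not_zero[OF eigenval_nonzero]])
qed

text \<open>The coordinate \<open>y m\<close> from the difference of sums cancels against the one in
  the self-value of c_S(\<eta>), and so does the common product of powers.\<close>

lemma pieri_coefficient:
  "((\<Sum>i=1..n. eigenval n (shift_comp S \<eta>) i) - (\<Sum>i=1..n. y i)) * val n F (shift_comp S \<eta>) / self_val n (shift_comp S \<eta>)
    = pieri_coeff n \<eta> S"
proof -
  have P: "(\<Prod>i=1..n. y i ^ \<eta> i) \<noteq> 0" by simp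
  have *: "((q1 * ym) * (- A * B * (D * P) / t1)) / (D' * (Q * ym * P)) = - q1 * D * A * B / (Q * t1 * D')"
    if "ym \<noteq> 0" "P \<noteq> 0" for q1 ym A B D P t1 D' Q :: qtfield
    using that by (simp add: mult_ac)
  show ?thesis
    unfolding sum_eigenval_shift val_shifted[folded shift_comp_S] self_val_def prod_eigenval_shift pieri_coeff_def
    by (rule *[OF eigenval_nonzero P])
qed

end

theorem proposition8:
  fixes n :: nat and \<eta> :: "nat \<Rightarrow> nat"
  assumes "n \<ge> 1" and "composition n \<eta>"
  shows "e1 n * macdonald_E_inv n \<eta> =
    (\<Sum>I\<in>maximal_sets n \<eta>. Const (pieri_coeff n \<eta> I) * macdonald_E_inv n (shift_comp I \<eta>))"
proof -
  let ?M = "maximal_sets n \<eta>" and ?C = "comps_eq n (Suc (weight n \<eta>))"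
  interpret interpolation n \<eta> "E_star n \<eta>" "E_top n \<eta>"
    by unfold_locales (use assms interp_E_star in auto)
  have mx: "maximal_set n \<eta> (E_star n \<eta>) (E_top n \<eta>) I" if "I \<in> ?M" for I
  proof -
    have S: "I \<noteq> {}" "I \<subseteq> {1..n}" using that by (auto simp: maximal_sets_def)
    show ?thesis by unfold_locales (use that S maximal_sets_iff[OF S, of \<eta>] in auto)
  qed
  define a where "a \<nu> = ((\<Sum>i=1..n. eigenval n \<nu> i) - (\<Sum>i=1..n. eigenval n \<eta> i)) * val n (E_star n \<eta>) \<nu> / self_val n \<nu>" for \<nu>
  \<comment> \<open>The coordinates that differ from those of \<eta> determine the set.\<close>
  have inj: "inj_on (\<lambda>I. shift_comp I \<eta>) ?M"
  proof
    fix I J assume IJ: "I \<in> ?M" "J \<in> ?M" "shift_comp I \<eta> = shift_comp J \<eta>"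
    then have "j \<in> I \<longleftrightarrow> j \<in> J" if "j \<in> {1..n}" for j
      using maximal_set.eigenval_shift_comp_neq[OF mx that] by metis
    moreover have "I \<subseteq> {1..n}" "J \<subseteq> {1..n}" using IJ by (auto simp: maximal_sets_def)
    ultimately show "I = J" by blast
  qed
  have "e1 n * macdonald_E_inv n \<eta> = (\<Sum>\<nu>\<in>?C. Const (a \<nu>) * E_top n \<nu>)"
    unfolding macdonald_E_inv_eq[OF assms] a_def by (rule pieri_interp[OF assms])
  also have "\<dots> = (\<Sum>\<nu>\<in>(\<lambda>I. shift_comp I \<eta>) ` ?M. Const (a \<nu>) * E_top n \<nu>)"
  proof (rule sum.mono_neutral_right)
    show "(\<lambda>I. shift_comp I \<eta>) ` ?M \<subseteq> ?C"
      using maximal_set.shift_comp_comps[OF mx] by auto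
    show "\<forall>\<nu>\<in>?C - (\<lambda>I. shift_comp I \<eta>) ` ?M. Const (a \<nu>) * E_top n \<nu> = 0"
    proof
      fix \<nu> assume \<nu>: "\<nu> \<in> ?C - (\<lambda>I. shift_comp I \<eta>) ` ?M"
      have "val n (E_star n \<eta>) \<nu> = 0"
      proof (rule ccontr)
        assume "val n (E_star n \<eta>) \<nu> \<noteq> 0"
        then obtain S where "S \<in> ?M" "\<nu> = shift_comp S \<eta>"
          using nonzero_imp_maximal \<nu> by (auto simp: comps_eq_def)
        then show False using \<nu> by blast
      qed
      then show "Const (a \<nu>) * E_top n \<nu> = 0" by (simp add: a_def)
    qed
  qed simp
  also have "\<dots> = (\<Sum>I\<in>?M. Const (a (shift_comp I \<eta>)) * E_top n (shift_comp I \<eta>))"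
    by (simp add: sum.reindex[OF inj])
  also have "\<dots> = (\<Sum>I\<in>?M. Const (pieri_coeff n \<eta> I) * macdonald_E_inv n (shift_comp I \<eta>))"
  proof (rule sum.cong)
    fix I assume I: "I \<in> ?M"
    have "composition n (shift_comp I \<eta>)"
      using maximal_set.shift_comp_comps[OF mx[OF I]] by (simp add: comps_eq_def)
    then show "Const (a (shift_comp I \<eta>)) * E_top n (shift_comp I \<eta>)
        = Const (pieri_coeff n \<eta> I) * macdonald_E_inv n (shift_comp I \<eta>)"
      unfolding a_def maximal_set.pieri_coefficient[OF mx[OF I]] by (simp add: macdonald_E_inv_eq[OF assms(1)])
  qed simp
  finally show ?thesis .
qed

end
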